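(* Let $A$ be a Villadsen algebra of the first kind with underlying compact Hausdorff space $X$, let $C\subseteq A$ be its canonical C$^*$-diagonal, and let $\mathcal B$ be the Bratteli diagram of its AF-subsystem. Then the groupoid model for $A$ (the Weyl groupoid of $C\subseteq A$) is given by the transformation groupoid $$\mathcal G_{\mathcal B}\ltimes E_{\mathcal P^\infty_{\mathcal B}},$$ where $E=E_{\mathcal P^\infty_{\mathcal B}}=\widehat C$ is fibred over the space $\mathcal P^\infty_{\mathcal B}$ of infinite paths of $\mathcal B$, and each fibre of $E$ is (up to homeomorphism) of the form $\{*\}$, $X^n$ for some $n\in\mathbb N$, or $X^\infty=\prod_{\mathbb N}X$ (depending on the Villadsen algebra in question).
   Context: Villadsen algebras of the first kind. Let $X$ be a (nonempty) compact Hausdorff space, and for $i\in\mathbb N=\{1,2,\dots\}$ let $n_i,k_i\in\mathbb N$ with $n_i\mid n_{i+1}$, $k_i\mid k_{i+1}$ and $(k_i)$ unbounded. Put $A_i=C(X^{n_i})\otimes M_{k_i}$ and write $X^{n_{i+1}}=(X^{n_i})^{m_i}$, $n_im_i=n_{i+1}$. The algebra is $A=\varinjlim(A_i,\phi_i)$ with $$\phi_i(f)=\mathrm{diag}(f\circ\pi^i_1,\dots,f\circ\pi^i_{p_i},f\circ c^i_1,\dots,f\circ c^i_{q_i}),$$ where each $\pi^i_s\colon X^{n_{i+1}}=(X^{n_i})^{m_i}\to X^{n_i}$ is a projection onto one of the $m_i$ coordinate components, each $c^i_r\colon X^{n_{i+1}}\to X^{n_i}$ is a constant map, $p_i\ge1$,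 $q_i\ge0$, and $p_i+q_i=k_{i+1}/k_i$. Thus the $\phi_i$ are unital and injective. Canonical diagonal and AF-subsystem. $C=\varinjlim_i C(X^{n_i})\otimes D_{k_i}\subseteq A$, where $D_k\subseteq M_k$ are the diagonal matrices; $\widehat C$ is its Gelfand spectrum (with the inverse limit topology of the spectra $X^{n_i}\times\{1,\dots,k_i\}$). $B=\varinjlim_i 1\otimes M_{k_i}\subseteq A$. The Bratteli diagram $\mathcal B$ has one vertex $v_i$ at each level $i\ge0$ ($v_0$ the root), $k_1$ edges $v_0\to v_1$, and for $i\ge1$ the edges $v_i\to v_{i+1}$ are the $k_{i+1}/k_i$ eigenfunctions (listed with multiplicity) of $\phi_i$. Indices $\{1,\dots,k_i\}$ are identified with paths of length $i$ from $v_0$ to $v_i$, the position of index $p$ in the block of the eigenfunction $e$ in $\phi_i(f)$ being labelled $pe$. Groupoids. $\mathcal P^\infty_{\mathcal B}$ is the space of infinite paths $x=x_1x_2\cdots$ from $v_0$, with base $Z_p=\{x:x_{[1,n]}=p\}$. $\mathcal G_{\mathcal B}$ is the groupoid of pairs $(x,y)$ of tail-equivalent paths ($x_{[m,\infty)}=y_{[m,\infty)}$ for some $m$), with $(x,y)(y,z)=(x,z)$ and base $Z_{p,q}=\{(x,y):x_{[1,n]}=p,y_{[1,n]}=q,x_{[n+1,\infty)}=y_{[n+1,\infty)}\}$, $p,q$ of equal length $n$. $1_{Z_{p,q}}$ denotes the matrix unit $e_{p,q}\in 1\otimes M_{k_n}\subseteq B$, so $C\cap B=C(\mathcal P^\infty_{\mathcal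 B})$. The fibration (anchor map) $\rho\colon\widehat C\to\mathcal P^\infty_{\mathcal B}$ is the Gelfand dual of $C\cap B\subseteq C$, fibres are the sets $\rho^{-1}(x)$, and the action is $((x,y)\cdot\chi)(c)=\chi(1_{Z_{p,q}}^*c\,1_{Z_{p,q}})$ for $\rho(\chi)=y$, $c\in C$, $(x,y)\in Z_{p,q}$. The transformation groupoid $\mathcal G_{\mathcal B}\ltimes\widehat C$ is $\{(\gamma,\chi):s(\gamma)=\rho(\chi)\}$ with subspace topology, $r(\gamma,\chi)=(r(\gamma),\gamma\cdot\chi)$, $s(\gamma,\chi)=(s(\gamma),\chi)$, $(\eta,\gamma\cdot\chi)(\gamma,\chi)=(\eta\gamma,\chi)$. The Weyl groupoid of the Cartan inclusion $C\subseteq A$ is Renault's groupoid of germs of the partial homeomorphisms of $\widehat C$ induced by normalisers of $C$ in $A$; here its Weyl twist is trivial, so $A\cong C^*_{\mathrm r}$ of it, compatibly with $C$. *)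

theory Defs
  imports "HOL-Analysis.Analysis" "Jordan_Normal_Form.Matrix"
begin

section \<open>Unital C*-algebras\<close>

text \<open>\<^class>\<open>real_normed_algebra_1\<close> makes the algebra unital and nonzero; \<^class>\<open>banach\<close> makes
  it complete. The real scaling of these classes is the restriction of the complex one.\<close>

class unital_cstar_algebra = banach + real_normed_algebra_1 +
  fixes scaleC :: "complex \<Rightarrow> 'a \<Rightarrow> 'a"
    and star :: "'a \<Rightarrow> 'a"
  assumes scaleC_of_real: "scaleC (complex_of_real r) a = r *\<^sub>R a"
    and scaleC_add_right: "scaleC z (a + b) = scaleC z a + scaleC z b"
    and scaleC_add_left: "scaleC (z + w) a = scaleC z a + scaleC w a"
    and scaleC_scaleC: "scaleC z (scaleC w a) = scaleC (z * w) a"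
    and mult_scaleC_left: "scaleC z a * b = scaleC z (a * b)"
    and mult_scaleC_right: "a * scaleC z b = scaleC z (a * b)"
    and norm_scaleC: "norm (scaleC z a) = cmod z * norm a"
    and star_star: "star (star a) = a"
    and star_add: "star (a + b) = star a + star b"
    and star_mult: "star (a * b) = star b * star a"
    and star_scaleC: "star (scaleC z a) = scaleC (cnj z) (star a)"
    and cstar_identity: "norm (star a * a) = (norm a)\<^sup>2"

text \<open>Characters of a subalgebra \<open>D\<close> are functions that are \<^const>\<open>undefined\<close> off \<open>D\<close>, so that
  the topology of pointwise convergence on \<open>D\<close> (the weak* topology) is a product topology.\<close>

definition characters :: "'a::unital_cstar_algebra set \<Rightarrow> ('a \<Rightarrow> complex) set" where
  "characters D = {\<xi> \<in> extensional D.
     (\<forall>a\<in>D. \<forall>b\<in>D. \<xi> (a + b) = \<xi> a + \<xi> b \<and> \<xi> (a * b) = \<xi> a * \<xi> b) \<and>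
     (\<forall>z. \<forall>a\<in>D. \<xi> (scaleC z a) = z * \<xi> a) \<and>
     (\<exists>a\<in>D. \<xi> a \<noteq> 0)}"

definition spectrum_top :: "'a::unital_cstar_algebra set \<Rightarrow> ('a \<Rightarrow> complex) topology" where
  "spectrum_top D = subtopology (product_topology (\<lambda>_. euclidean) D) (characters D)"


section \<open>Topological groupoids\<close>

text \<open>The unit space is kept as a space of its own, \<open>units\<close>; \<open>mul g h\<close> is only meaningful when
  \<open>src g = rng h\<close>.\<close>

record ('g, 'u) top_groupoid =
  arrows :: "'g topology"
  units :: "'u topology"
  src :: "'g \<Rightarrow> 'u"
  rng :: "'g \<Rightarrow> 'u"
  mul :: "'g \<Rightarrow> 'g \<Rightarrow> 'g"

text \<open>Units and inverses of a groupoid are determined by its partial multiplication, so an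
  isomorphism preserves them automatically.\<close>

definition groupoid_iso ::
  "('g, 'u) top_groupoid \<Rightarrow> ('h, 'v) top_groupoid \<Rightarrow> ('g \<Rightarrow> 'h) \<Rightarrow> ('u \<Rightarrow> 'v) \<Rightarrow> bool" where
  "groupoid_iso G H h h0 \<longleftrightarrow>
     homeomorphic_map (arrows G) (arrows H) h \<and>
     homeomorphic_map (units G) (units H) h0 \<and>
     (\<forall>g \<in> topspace (arrows G). src H (h g) = h0 (src G g) \<and> rng H (h g) = h0 (rng G g)) \<and>
     (\<forall>g \<in> topspace (arrows G). \<forall>g' \<in> topspace (arrows G).
        src G g = rng G g' \<longrightarrow> h (mul G g g') = mul H (h g) (h g'))"

definition transformation_groupoid ::
  "('g, 'u) top_groupoid \<Rightarrow> 'e topology \<Rightarrow> ('e \<Rightarrow> 'u) \<Rightarrow> ('g \<Rightarrow> 'e \<Rightarrow> 'e)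
     \<Rightarrow> ('g \<times> 'e, 'u \<times> 'e) top_groupoid" where
  "transformation_groupoid G E \<rho> act = \<lparr>
     arrows = subtopology (prod_topology (arrows G) E) {(\<gamma>, \<xi>). src G \<gamma> = \<rho> \<xi>},
     units = subtopology (prod_topology (units G) E) {(x, \<xi>). x = \<rho> \<xi>},
     src = (\<lambda>(\<gamma>, \<xi>). (src G \<gamma>, \<xi>)),
     rng = (\<lambda>(\<gamma>, \<xi>). (rng G \<gamma>, act \<gamma> \<xi>)),
     mul = (\<lambda>(\<eta>, _) (\<gamma>, \<xi>). (mul G \<eta> \<gamma>, \<xi>))\<rparr>"


section \<open>The Weyl groupoid\<close>

text \<open>The groupoid of germs of a family \<open>S\<close> of partial homeomorphisms of a space \<open>T\<close>, closed under
  composition and inversion. The germ \<open>[f(x), f, x]\<close> is the class of all \<open>(g, x)\<close> such that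
  \<open>g\<close> agrees with \<open>f\<close> on a neighbourhood of \<open>x\<close>.\<close>

definition germ :: "'c topology \<Rightarrow> ('c \<rightharpoonup> 'c) set \<Rightarrow> ('c \<rightharpoonup> 'c) \<Rightarrow> 'c \<Rightarrow> (('c \<rightharpoonup> 'c) \<times> 'c) set" where
  "germ T S f x = {(g, y). y = x \<and> g \<in> S \<and>
     (\<exists>U. openin T U \<and> x \<in> U \<and> U \<subseteq> dom f \<inter> dom g \<and> (\<forall>z\<in>U. f z = g z))}"

definition germ_groupoid ::
  "'c topology \<Rightarrow> ('c \<rightharpoonup> 'c) set \<Rightarrow> ((('c \<rightharpoonup> 'c) \<times> 'c) set, 'c) top_groupoid" where
  "germ_groupoid T S = \<lparr>
     arrows = topology_generated_by {germ T S f ` U | f U. f \<in> S \<and> openin T U \<and> U \<subseteq> dom f},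
     units = T,
     src = (\<lambda>a. THE x. \<exists>f. (f, x) \<in> a),
     rng = (\<lambda>a. THE y. \<exists>f x. (f, x) \<in> a \<and> f x = Some y),
     mul = (\<lambda>a b. THE c. \<exists>f y g x. (f, y) \<in> a \<and> (g, x) \<in> b \<and> c = germ T S (f \<circ>\<^sub>m g) x)\<rparr>"

definition normalisers :: "'a::unital_cstar_algebra set \<Rightarrow> 'a set" where
  "normalisers C = {n. \<forall>c\<in>C. n * c * star n \<in> C \<and> star n * c * n \<in> C}"

text \<open>Renault's \<open>\<alpha>\<^sub>n\<close>, determined by \<open>\<xi>(n*cn) = \<alpha>\<^sub>n(\<xi>)(c) \<xi>(n*n)\<close> on its domain
  \<open>{\<xi>. \<xi>(n*n) > 0}\<close>; as \<open>\<xi>(n*n) \<ge> 0\<close> always, the domain is \<open>{\<xi>. \<xi>(n*n) \<noteq> 0}\<close>.\<close>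

definition normaliser_map ::
  "'a::unital_cstar_algebra set \<Rightarrow> 'a \<Rightarrow> ('a \<Rightarrow> complex) \<rightharpoonup> ('a \<Rightarrow> complex)" where
  "normaliser_map C n = (\<lambda>\<xi>. if \<xi> \<in> characters C \<and> \<xi> (star n * n) \<noteq> 0
     then Some (\<lambda>c\<in>C. \<xi> (star n * c * n) / \<xi> (star n * n)) else None)"

definition weyl_groupoid ::
  "'a::unital_cstar_algebra set
     \<Rightarrow> (((('a \<Rightarrow> complex) \<rightharpoonup> ('a \<Rightarrow> complex)) \<times> ('a \<Rightarrow> complex)) set, 'a \<Rightarrow> complex) top_groupoid" where
  "weyl_groupoid C = germ_groupoid (spectrum_top C) (normaliser_map C ` normalisers C)"


section \<open>Villadsen algebras of the first kind\<close>

text \<open>\<open>proj_comp V i s\<close> is the index (from \<open>0\<close>) of the component of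
  \<open>X\<^bsup>n(i+1)\<^esup> = (X\<^bsup>n i\<^esup>)\<^bsup>m\<^esup>\<close> onto which \<open>\<pi>\<close> number \<open>s\<close> projects; \<open>const_val V i r\<close> is the
  value of the constant map number \<open>r\<close>. Levels \<open>i\<close> start at \<open>1\<close>, numbers \<open>s\<close> and \<open>r\<close> at \<open>0\<close>.\<close>

record 'x villadsen =
  base_space :: "'x topology"
  vn :: "nat \<Rightarrow> nat"
  vk :: "nat \<Rightarrow> nat"
  vp :: "nat \<Rightarrow> nat"
  vq :: "nat \<Rightarrow> nat"
  proj_comp :: "nat \<Rightarrow> nat \<Rightarrow> nat"
  const_val :: "nat \<Rightarrow> nat \<Rightarrow> (nat \<Rightarrow> 'x)"

definition power_top :: "'x topology \<Rightarrow> nat \<Rightarrow> (nat \<Rightarrow> 'x) topology" where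
  "power_top X m = product_topology (\<lambda>_. X) {..<m}"

definition villadsen_data :: "'x villadsen \<Rightarrow> bool" where
  "villadsen_data V \<longleftrightarrow>
     compact_space (base_space V) \<and> Hausdorff_space (base_space V) \<and> topspace (base_space V) \<noteq> {} \<and>
     (\<forall>i\<ge>1. vn V i \<ge> 1 \<and> vk V i \<ge> 1 \<and> vn V i dvd vn V (Suc i) \<and> vk V i dvd vk V (Suc i)) \<and>
     (\<forall>N. \<exists>i\<ge>1. vk V i > N) \<and>
     (\<forall>i\<ge>1. vp V i \<ge> 1 \<and> vp V i + vq V i = vk V (Suc i) div vk V i) \<and>
     (\<forall>i\<ge>1. \<forall>s<vp V i. proj_comp V i s < vn V (Suc i) div vn V i) \<and>
     (\<forall>i\<ge>1. \<forall>r<vq V i. const_val V i r \<in> topspace (power_top (base_space V) (vn V i)))"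

abbreviation level_points :: "'x villadsen \<Rightarrow> nat \<Rightarrow> (nat \<Rightarrow> 'x) set" where
  "level_points V i \<equiv> topspace (power_top (base_space V) (vn V i))"

text \<open>The eigenfunctions of the \<open>i\<close>-th connecting map, in the order in which they occur on the
  diagonal.\<close>

definition eigenfun :: "'x villadsen \<Rightarrow> nat \<Rightarrow> nat \<Rightarrow> (nat \<Rightarrow> 'x) \<Rightarrow> (nat \<Rightarrow> 'x)" where
  "eigenfun V i e y =
     (if e < vp V i then (\<lambda>j\<in>{..<vn V i}. y (proj_comp V i e * vn V i + j))
      else const_val V i (e - vp V i))"

text \<open>\<open>C(X\<^bsup>n i\<^esup>) \<otimes> M\<^bsub>k i\<^esub>\<close> as continuous matrix-valued functions.\<close>

definition level_algebra :: "'x villadsen \<Rightarrow> nat \<Rightarrow> ((nat \<Rightarrow> 'x) \<Rightarrow> complex mat) set" where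
  "level_algebra V i = {f \<in> level_points V i \<rightarrow>\<^sub>E carrier_mat (vk V i) (vk V i).
     \<forall>a<vk V i. \<forall>b<vk V i.
       continuous_map (power_top (base_space V) (vn V i)) euclidean (\<lambda>y. f y $$ (a, b))}"

definition connecting_map ::
  "'x villadsen \<Rightarrow> nat \<Rightarrow> ((nat \<Rightarrow> 'x) \<Rightarrow> complex mat) \<Rightarrow> ((nat \<Rightarrow> 'x) \<Rightarrow> complex mat)" where
  "connecting_map V i f = (\<lambda>y\<in>level_points V (Suc i).
     diag_block_mat (map (\<lambda>e. f (eigenfun V i e y)) [0..<vp V i + vq V i]))"

definition level_star_hom ::
  "'x villadsen \<Rightarrow> nat \<Rightarrow> (((nat \<Rightarrow> 'x) \<Rightarrow> complex mat) \<Rightarrow> 'a::unital_cstar_algebra) \<Rightarrow> bool" where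
  "level_star_hom V i \<phi> \<longleftrightarrow>
     (\<forall>f\<in>level_algebra V i. \<forall>g\<in>level_algebra V i.
        \<phi> (\<lambda>y\<in>level_points V i. f y + g y) = \<phi> f + \<phi> g \<and>
        \<phi> (\<lambda>y\<in>level_points V i. f y * g y) = \<phi> f * \<phi> g) \<and>
     (\<forall>f\<in>level_algebra V i.
        (\<forall>z. \<phi> (\<lambda>y\<in>level_points V i. z \<cdot>\<^sub>m f y) = scaleC z (\<phi> f)) \<and>
        \<phi> (\<lambda>y\<in>level_points V i. map_mat cnj (transpose_mat (f y))) = star (\<phi> f)) \<and>
     \<phi> (\<lambda>y\<in>level_points V i. 1\<^sub>m (vk V i)) = 1"

text \<open>The whole type \<open>'a\<close> is the C*-algebraic inductive limit \<open>A\<close> with canonical maps \<open>\<Phi> i\<close>. As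
  the connecting maps are unital and injective, the limit is characterised by canonical maps that
  are unital, injective and compatible and whose images have dense union. Norms on the algebras at
  finite levels need not be mentioned: *-homomorphisms between C*-algebras are contractive, and
  isometric if injective.\<close>

definition is_inductive_limit ::
  "'x villadsen \<Rightarrow> (nat \<Rightarrow> ((nat \<Rightarrow> 'x) \<Rightarrow> complex mat) \<Rightarrow> 'a::unital_cstar_algebra) \<Rightarrow> bool" where
  "is_inductive_limit V \<Phi> \<longleftrightarrow>
     (\<forall>i\<ge>1. level_star_hom V i (\<Phi> i) \<and> inj_on (\<Phi> i) (level_algebra V i)) \<and>
     (\<forall>i\<ge>1. \<forall>f\<in>level_algebra V i. \<Phi> (Suc i) (connecting_map V i f) = \<Phi> i f) \<and>
     closure (\<Union>i\<in>{1..}. \<Phi> i ` level_algebra V i) = UNIV"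

definition canonical_diagonal ::
  "'x villadsen \<Rightarrow> (nat \<Rightarrow> ((nat \<Rightarrow> 'x) \<Rightarrow> complex mat) \<Rightarrow> 'a::unital_cstar_algebra) \<Rightarrow> 'a set" where
  "canonical_diagonal V \<Phi> = closure (\<Union>i\<in>{1..}.
     \<Phi> i ` {f \<in> level_algebra V i. \<forall>y\<in>level_points V i. diagonal_mat (f y)})"

definition af_subsystem ::
  "'x villadsen \<Rightarrow> (nat \<Rightarrow> ((nat \<Rightarrow> 'x) \<Rightarrow> complex mat) \<Rightarrow> 'a::unital_cstar_algebra) \<Rightarrow> 'a set" where
  "af_subsystem V \<Phi> = closure (\<Union>i\<in>{1..}.
     \<Phi> i ` {(\<lambda>y\<in>level_points V i. M) | M. M \<in> carrier_mat (vk V i) (vk V i)})"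


section \<open>The Bratteli diagram and its path groupoid\<close>

text \<open>The edges \<open>v\<^sub>i \<rightarrow> v\<^bsub>i+1\<^esub>\<close> are the numbers below \<open>edge_count V i\<close>. An infinite path
  \<open>x\<^sub>1 x\<^sub>2 \<dots>\<close> is the function \<open>x\<close> whose value \<open>x i\<close> is the edge leaving \<open>v\<^sub>i\<close>, that is
  \<open>x\<^bsub>i+1\<^esub>\<close>; finite paths are lists.\<close>

definition edge_count :: "'x villadsen \<Rightarrow> nat \<Rightarrow> nat" where
  "edge_count V i = (if i = 0 then vk V 1 else vp V i + vq V i)"

definition inf_paths :: "'x villadsen \<Rightarrow> (nat \<Rightarrow> nat) set" where
  "inf_paths V = {x. \<forall>i. x i < edge_count V i}"

definition fin_paths :: "'x villadsen \<Rightarrow> nat \<Rightarrow> nat list set" where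
  "fin_paths V n = {p. length p = n \<and> (\<forall>i<n. p ! i < edge_count V i)}"

definition cylinder :: "'x villadsen \<Rightarrow> nat list \<Rightarrow> (nat \<Rightarrow> nat) set" where
  "cylinder V p = {x \<in> inf_paths V. map x [0..<length p] = p}"

definition path_space :: "'x villadsen \<Rightarrow> (nat \<Rightarrow> nat) topology" where
  "path_space V = topology_generated_by {cylinder V p | p n. p \<in> fin_paths V n}"

definition bicylinder ::
  "'x villadsen \<Rightarrow> nat list \<Rightarrow> nat list \<Rightarrow> ((nat \<Rightarrow> nat) \<times> (nat \<Rightarrow> nat)) set" where
  "bicylinder V p q =
     {(x, y). x \<in> cylinder V p \<and> y \<in> cylinder V q \<and> (\<forall>j\<ge>length p. x j = y j)}"

text \<open>The tail-equivalent pairs of paths are exactly the points of the topology generated by the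
  sets \<^const>\<open>bicylinder\<close>.\<close>

definition path_groupoid ::
  "'x villadsen \<Rightarrow> ((nat \<Rightarrow> nat) \<times> (nat \<Rightarrow> nat), nat \<Rightarrow> nat) top_groupoid" where
  "path_groupoid V = \<lparr>
     arrows = topology_generated_by
       {bicylinder V p q | p q n. p \<in> fin_paths V n \<and> q \<in> fin_paths V n},
     units = path_space V,
     src = snd,
     rng = fst,
     mul = (\<lambda>(x, _) (_, z). (x, z))\<rparr>"

text \<open>The position of a path among the \<open>vk V i\<close> matrix indices (counted from \<open>0\<close>):
  \<open>path_index V (p @ [e]) = e * vk V i + path_index V p\<close> for \<open>p\<close> of length \<open>i \<ge> 1\<close>, which is the
  place of \<open>p\<close> within the block of the eigenfunction \<open>e\<close> in \<^const>\<open>connecting_map\<close>.\<close>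

definition path_index :: "'x villadsen \<Rightarrow> nat list \<Rightarrow> nat" where
  "path_index V p = (\<Sum>j<length p. p ! j * (if j = 0 then 1 else vk V j))"

text \<open>The element \<open>1\<^bsub>Z\<^esub>\<close> of \<open>A\<close> for \<open>Z = Z\<^bsub>p,q\<^esub>\<close>, with \<open>p, q\<close> of equal length at least \<open>1\<close>
  (there is no level \<open>0\<close> in the inductive system).\<close>

definition path_unit ::
  "'x villadsen \<Rightarrow> (nat \<Rightarrow> ((nat \<Rightarrow> 'x) \<Rightarrow> complex mat) \<Rightarrow> 'a::unital_cstar_algebra)
     \<Rightarrow> nat list \<Rightarrow> nat list \<Rightarrow> 'a" where
  "path_unit V \<Phi> p q = (let i = length p in
     \<Phi> i (\<lambda>y\<in>level_points V i. mat (vk V i) (vk V i)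
       (\<lambda>(a, b). if a = path_index V p \<and> b = path_index V q then 1 else 0)))"


section \<open>The fibration of the spectrum and the action\<close>

text \<open>Evaluation at \<open>x\<close> as a character of \<open>C \<inter> B\<close>, under the identification
  \<open>C \<inter> B = C(P)\<close>, \<open>P\<close> the space of infinite paths, that sends \<open>e\<^bsub>p,p\<^esub>\<close> to the indicator
  function of the cylinder of \<open>p\<close>. These indicator functions span a dense subalgebra of \<open>C(P)\<close>.\<close>

definition path_character ::
  "'x villadsen \<Rightarrow> (nat \<Rightarrow> ((nat \<Rightarrow> 'x) \<Rightarrow> complex mat) \<Rightarrow> 'a::unital_cstar_algebra)
     \<Rightarrow> (nat \<Rightarrow> nat) \<Rightarrow> ('a \<Rightarrow> complex)" where
  "path_character V \<Phi> x = (THE \<psi>. \<psi> \<in> characters (canonical_diagonal V \<Phi> \<inter> af_subsystem V \<Phi>) \<and>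
     (\<forall>n\<ge>1. \<forall>p\<in>fin_paths V n. \<psi> (path_unit V \<Phi> p p) = (if x \<in> cylinder V p then 1 else 0)))"

definition anchor ::
  "'x villadsen \<Rightarrow> (nat \<Rightarrow> ((nat \<Rightarrow> 'x) \<Rightarrow> complex mat) \<Rightarrow> 'a::unital_cstar_algebra)
     \<Rightarrow> ('a \<Rightarrow> complex) \<Rightarrow> (nat \<Rightarrow> nat)" where
  "anchor V \<Phi> \<xi> = (THE x. x \<in> inf_paths V \<and>
     restrict \<xi> (canonical_diagonal V \<Phi> \<inter> af_subsystem V \<Phi>) = path_character V \<Phi> x)"

text \<open>The defining formula is required for every \<open>(p, q)\<close> with \<open>\<gamma> \<in> Z\<^bsub>p,q\<^esub>\<close>.\<close>

definition path_action ::
  "'x villadsen \<Rightarrow> (nat \<Rightarrow> ((nat \<Rightarrow> 'x) \<Rightarrow> complex mat) \<Rightarrow> 'a::unital_cstar_algebra)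
     \<Rightarrow> (nat \<Rightarrow> nat) \<times> (nat \<Rightarrow> nat) \<Rightarrow> ('a \<Rightarrow> complex) \<Rightarrow> ('a \<Rightarrow> complex)" where
  "path_action V \<Phi> \<gamma> \<xi> = (THE \<psi>. \<psi> \<in> extensional (canonical_diagonal V \<Phi>) \<and>
     (\<forall>n\<ge>1. \<forall>p\<in>fin_paths V n. \<forall>q\<in>fin_paths V n. \<gamma> \<in> bicylinder V p q \<longrightarrow>
        (\<forall>c\<in>canonical_diagonal V \<Phi>. \<psi> c = \<xi> (star (path_unit V \<Phi> p q) * c * path_unit V \<Phi> p q))))"

definition fibre_top ::
  "'x villadsen \<Rightarrow> (nat \<Rightarrow> ((nat \<Rightarrow> 'x) \<Rightarrow> complex mat) \<Rightarrow> 'a::unital_cstar_algebra)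
     \<Rightarrow> (nat \<Rightarrow> nat) \<Rightarrow> ('a \<Rightarrow> complex) topology" where
  "fibre_top V \<Phi> x = subtopology (spectrum_top (canonical_diagonal V \<Phi>)) {\<xi>. anchor V \<Phi> \<xi> = x}"

end

theory Submission
  imports Defs
begin

text \<open>The canonical diagonal \<open>C\<close> is an inductive limit of algebras of continuous functions on the
  spaces \<open>X\<^bsup>n i\<^esup> \<times> {1, \<dots>, k i}\<close>, so its characters are the threads in these spaces, and a thread is an
  infinite path \<open>x\<close> together with points \<open>y i\<close> of \<open>X\<^bsup>n i\<^esup>\<close> that the edges of \<open>x\<close> map onto each other.
  The fibre over \<open>x\<close> is the inverse limit of the spaces \<open>X\<^bsup>n i\<^esup>\<close> along \<open>x\<close>: one point if \<open>x\<close> has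
  infinitely many constant edges, and otherwise a power of \<open>X\<close>, as projections merely forget
  coordinates. The isomorphism sends \<open>(\<gamma>, \<xi>)\<close>, where \<open>\<gamma>\<close> lies in the basic set of the finite paths
  \<open>p, q\<close>, to the germ at \<open>\<xi>\<close> of the partial homeomorphism of the matrix unit for \<open>p, q\<close>. It is
  injective because the path under the range of a germ recovers the range of \<open>\<gamma>\<close>. It is
  surjective because a normaliser is approximated by matrices of a finite level, which forces its
  germ at any point to be that of a single matrix unit.\<close>


section \<open>Unital C*-algebras and their characters\<close>

text \<open>The finite levels carry no norm: the canonical maps are only assumed to be injective
  unital star homomorphisms. Norm bounds for them have to be won from the C*-identity in the limit
  and from injectivity, and together these make such a map of C(K) isometric. This is what extends
  evaluation along a thread from the union of the levels to its closure. Conversely, characters of a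
  closed subalgebra are contractive, hence determined by the levels.

  A normaliser is merely close to a matrix of a finite level, and that matrix need not normalise C.
  Compressing it by the diagonal units of the range and source prefixes cuts out a single entry,
  which is an element of C times a matrix unit; in this form it can be compared with the map of the
  matrix unit.

  Anchor and action are given by unique existence, and each uniqueness costs an argument: every path
  must carry a character, so that nonempty fibres are already needed to identify the anchor, and the
  formula for the action must give the same value at every level.\<close>

lemma scaleC_one [simp]: "scaleC 1 (a::'a::unital_cstar_algebra) = a"
  using scaleC_of_real[of 1 a] by simp

lemma scaleC_zero [simp]: "scaleC 0 (a::'a::unital_cstar_algebra) = 0"
  using scaleC_of_real[of 0 a] by simp

lemma scaleC_minus_one: "scaleC (-1) (a::'a::unital_cstar_algebra) = - a"
  using scaleC_of_real[of "-1" a] by simp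

lemma star_zero [simp]: "star (0::'a::unital_cstar_algebra) = 0"
  using star_add[of 0 "0::'a"] by simp

lemma star_minus: "star (- a) = - star (a::'a::unital_cstar_algebra)"
  using star_add[of a "- a"] by (simp add: eq_neg_iff_add_eq_0 add.commute)

lemma star_diff: "star (a - b) = star a - star (b::'a::unital_cstar_algebra)"
  using star_add[of a "- b"] by (simp add: star_minus)

lemma norm_star [simp]: "norm (star a) = norm (a::'a::unital_cstar_algebra)"
proof -
  have le: "norm b \<le> norm (star b)" for b :: 'a
  proof (cases "norm b = 0")
    case False
    have "(norm b)\<^sup>2 \<le> norm (star b) * norm b"
      using norm_mult_ineq[of "star b" b] by (simp add: cstar_identity)
    with False show ?thesis by (simp add: power2_eq_square)
  qed simp
  show ?thesis using le[of a] le[of "star a"] by (simp add: star_star)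
qed

lemma bounded_linear_star: "bounded_linear (star :: 'a::unital_cstar_algebra \<Rightarrow> 'a)"
proof (rule bounded_linear_intro[of _ 1])
  fix r and a :: 'a
  show "star (r *\<^sub>R a) = r *\<^sub>R star a"
    using star_scaleC[of "complex_of_real r" a] by (simp add: scaleC_of_real)
qed (simp_all add: star_add)

lemma bounded_linear_scaleC: "bounded_linear (scaleC z :: 'a::unital_cstar_algebra \<Rightarrow> 'a)"
proof (rule bounded_linear_intro[of _ "cmod z"])
  fix r and a :: 'a
  show "scaleC z (r *\<^sub>R a) = r *\<^sub>R scaleC z a"
    by (simp add: scaleC_of_real[symmetric] scaleC_scaleC mult.commute)
qed (simp_all add: scaleC_add_right norm_scaleC mult.commute)

lemma tendsto_star [tendsto_intros]:
  "(f \<longlongrightarrow> a) F \<Longrightarrow> ((\<lambda>x. star (f x)) \<longlongrightarrow> star (a::'a::unital_cstar_algebra)) F"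
  by (rule bounded_linear.tendsto[OF bounded_linear_star])

lemma tendsto_scaleC [tendsto_intros]:
  "(f \<longlongrightarrow> a) F \<Longrightarrow> ((\<lambda>x. scaleC z (f x)) \<longlongrightarrow> scaleC z (a::'a::unital_cstar_algebra)) F"
  by (rule bounded_linear.tendsto[OF bounded_linear_scaleC])

text \<open>Closedness is kept out of the definition so that it also covers the dense unions of
  finite levels; closed subalgebras are obtained from these by
  \<open>unital_subalgebra_closure\<close>.\<close>

definition unital_subalgebra :: "'a::unital_cstar_algebra set \<Rightarrow> bool" where
  "unital_subalgebra D \<longleftrightarrow> 1 \<in> D \<and> (\<forall>a\<in>D. \<forall>b\<in>D. a + b \<in> D \<and> a * b \<in> D) \<and>
     (\<forall>z. \<forall>a\<in>D. scaleC z a \<in> D)"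

lemma unital_subalgebraD:
  assumes "unital_subalgebra D"
  shows "1 \<in> D" "a \<in> D \<Longrightarrow> b \<in> D \<Longrightarrow> a + b \<in> D" "a \<in> D \<Longrightarrow> b \<in> D \<Longrightarrow> a * b \<in> D"
    "a \<in> D \<Longrightarrow> scaleC z a \<in> D" "0 \<in> D" "a \<in> D \<Longrightarrow> b \<in> D \<Longrightarrow> a - b \<in> D"
proof -
  show 1: "1 \<in> D" "a \<in> D \<Longrightarrow> b \<in> D \<Longrightarrow> a + b \<in> D" "a \<in> D \<Longrightarrow> b \<in> D \<Longrightarrow> a * b \<in> D"
    "a \<in> D \<Longrightarrow> scaleC z a \<in> D" for a b z
    using assms by (auto simp: unital_subalgebra_def)
  show "0 \<in> D" using 1(4)[of 1 0] 1(1) by simp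
  assume "a \<in> D" "b \<in> D"
  then show "a - b \<in> D" using 1(2)[of a "scaleC (-1) b"] 1(4)[of b "-1"]
    by (simp add: scaleC_minus_one)
qed

lemma closure_limI:
  fixes l :: "'a::metric_space"
  shows "(\<And>n. f n \<in> S) \<Longrightarrow> f \<longlonglongrightarrow> l \<Longrightarrow> l \<in> closure S"
  by (auto simp: closure_sequential)

lemma unital_subalgebra_closure:
  assumes "unital_subalgebra D"
  shows "unital_subalgebra (closure D)"
proof -
  note D = unital_subalgebraD[OF assms]
  have "a + b \<in> closure D \<and> a * b \<in> closure D" if "a \<in> closure D" "b \<in> closure D" for a b
  proof -
    from that obtain f g where fg: "\<And>n. f n \<in> D" "f \<longlonglongrightarrow> a" "\<And>n. g n \<in> D" "g \<longlonglongrightarrow> b"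
      unfolding closure_sequential by blast
    show ?thesis
    proof
      show "a + b \<in> closure D"
        by (rule closure_limI[OF _ tendsto_add[OF fg(2,4)]]) (intro D fg)
      show "a * b \<in> closure D"
        by (rule closure_limI[OF _ tendsto_mult[OF fg(2,4)]]) (intro D fg)
    qed
  qed
  moreover have "scaleC z a \<in> closure D" if "a \<in> closure D" for a z
  proof -
    from that obtain f where f: "\<And>n. f n \<in> D" "f \<longlonglongrightarrow> a"
      unfolding closure_sequential by blast
    show ?thesis
      by (rule closure_limI[OF _ tendsto_scaleC[OF f(2)]]) (intro D f)
  qed
  ultimately show ?thesis
    using D(1) closure_subset unfolding unital_subalgebra_def by blast
qed

lemma unital_subalgebra_Int:
  "unital_subalgebra D \<Longrightarrow> unital_subalgebra E \<Longrightarrow> unital_subalgebra (D \<inter> E)"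
  by (auto simp: unital_subalgebra_def)

lemma characterD:
  assumes "\<xi> \<in> characters D" "unital_subalgebra D"
  shows "a \<in> D \<Longrightarrow> b \<in> D \<Longrightarrow> \<xi> (a + b) = \<xi> a + \<xi> b"
    "a \<in> D \<Longrightarrow> b \<in> D \<Longrightarrow> \<xi> (a * b) = \<xi> a * \<xi> b"
    "a \<in> D \<Longrightarrow> \<xi> (scaleC z a) = z * \<xi> a"
    "\<xi> 1 = 1" "\<xi> 0 = 0" "a \<in> D \<Longrightarrow> b \<in> D \<Longrightarrow> \<xi> (a - b) = \<xi> a - \<xi> b"
    "\<xi> \<in> extensional D"
proof -
  note D = unital_subalgebraD[OF assms(2)]
  show 1: "a \<in> D \<Longrightarrow> b \<in> D \<Longrightarrow> \<xi> (a + b) = \<xi> a + \<xi> b"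
    "a \<in> D \<Longrightarrow> b \<in> D \<Longrightarrow> \<xi> (a * b) = \<xi> a * \<xi> b"
    "a \<in> D \<Longrightarrow> \<xi> (scaleC z a) = z * \<xi> a" for a b z
    using assms(1) by (auto simp: characters_def)
  show "\<xi> \<in> extensional D" using assms(1) by (auto simp: characters_def)
  obtain c where c: "c \<in> D" "\<xi> c \<noteq> 0" using assms(1) by (auto simp: characters_def)
  with 1(2)[of c 1] D(1) show "\<xi> 1 = 1" by simp
  show "\<xi> 0 = 0" using 1(3)[of 0 0] D(5) by simp
  assume "a \<in> D" "b \<in> D"
  then show "\<xi> (a - b) = \<xi> a - \<xi> b"
    using 1(1)[of a "scaleC (-1) b"] 1(3)[of b "-1"] D(4)[of b "-1"]
    by (simp add: scaleC_minus_one)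
qed

text \<open>If \<open>\<xi>(b) = 1\<close> for some \<open>b\<close> with \<open>\<parallel>b\<parallel> < 1\<close>, then the Neumann series \<open>s = 1 + b s\<close> gives
  \<open>\<xi>(s) = 1 + \<xi>(s)\<close>.\<close>

lemma character_le_norm:
  assumes "\<xi> \<in> characters D" "unital_subalgebra D" "closed D" "a \<in> D"
  shows "cmod (\<xi> a) \<le> norm a"
proof (rule ccontr)
  note D = unital_subalgebraD[OF assms(2)]
  note \<xi> = characterD[OF assms(1,2)]
  assume less: "\<not> cmod (\<xi> a) \<le> norm a"
  then have nz: "\<xi> a \<noteq> 0" by auto
  define b where "b = scaleC (1 / \<xi> a) a"
  have b: "b \<in> D" "\<xi> b = 1" "norm b < 1"
    using assms(4) D(4) nz less by (auto simp: b_def \<xi> norm_scaleC norm_divide field_simps)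
  have sum: "summable (\<lambda>n. b ^ n)" by (rule complete_algebra_summable_geometric[OF b(3)])
  have pow: "b ^ n \<in> D" for n by (induction n) (auto intro: D b(1))
  have part: "(\<Sum>i<n. b ^ i) \<in> D" for n by (induction n) (auto intro: D pow)
  define s where "s = (\<Sum>n. b ^ n)"
  have s: "s \<in> D"
    using assms(3) part summable_LIMSEQ[OF sum] unfolding s_def by (rule closed_sequentially)
  have "s = 1 + b * s"
    using suminf_split_head[OF sum] suminf_mult[OF sum, of b] by (simp add: s_def)
  then have "\<xi> s = \<xi> 1 + \<xi> b * \<xi> s"
    using \<xi>(1)[of 1 "b * s"] \<xi>(2)[of b s] D b(1) s by metis
  then show False using \<xi>(4) b(2) by simp
qed

lemma continuous_map_character:
  "a \<in> D \<Longrightarrow> continuous_map (spectrum_top D) euclidean (\<lambda>\<xi>. \<xi> a)"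
  unfolding spectrum_top_def
  by (intro continuous_map_from_subtopology continuous_map_product_projection)

lemma topspace_spectrum [simp]: "topspace (spectrum_top D) = characters D"
  by (auto simp: spectrum_top_def characters_def PiE_def)

lemma Hausdorff_spectrum: "Hausdorff_space (spectrum_top D)"
  unfolding spectrum_top_def
  by (intro Hausdorff_space_subtopology) (simp add: Hausdorff_space_product_topology)


section \<open>Representations of \<open>C(K)\<close>\<close>

text \<open>Continuity read pointwise as convergence along \<open>atin\<close> makes
  \<open>tendsto_intros\<close> available for maps on an abstract topology.\<close>

lemma continuous_map_euclidean_iff:
  fixes f :: "'k \<Rightarrow> 'b::topological_space"
  shows "continuous_map K euclidean f \<longleftrightarrow> (\<forall>x\<in>topspace K. (f \<longlongrightarrow> f x) (atin K x))"
  by (simp add: continuous_map_atin)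

lemma continuous_map_mult_complex:
  fixes f g :: "'k \<Rightarrow> complex"
  assumes "continuous_map K euclidean f" "continuous_map K euclidean g"
  shows "continuous_map K euclidean (\<lambda>x. f x * g x)"
  using assms by (auto simp: continuous_map_euclidean_iff intro!: tendsto_intros)

lemma continuous_map_add_complex:
  fixes f g :: "'k \<Rightarrow> complex"
  assumes "continuous_map K euclidean f" "continuous_map K euclidean g"
  shows "continuous_map K euclidean (\<lambda>x. f x + g x)"
  using assms by (auto simp: continuous_map_euclidean_iff intro!: tendsto_intros)

lemma continuous_map_cnj:
  assumes "continuous_map K euclidean f"
  shows "continuous_map K euclidean (\<lambda>x. cnj (f x))"
  using assms by (auto simp: continuous_map_euclidean_iff intro!: tendsto_intros)

lemma cnj_mult_self: "cnj z * z = complex_of_real ((cmod z)\<^sup>2)"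
  by (simp add: complex_norm_square mult.commute del: of_real_power)

lemma Urysohn_points:
  assumes "compact_space K" "Hausdorff_space K" "x \<in> topspace K" "closedin K T" "x \<notin> T"
  obtains u :: "'k \<Rightarrow> real" where "continuous_map K euclidean u" "\<And>z. z \<in> topspace K \<Longrightarrow> 0 \<le> u z \<and> u z \<le> 1"
    "u x = 1" "\<And>z. z \<in> T \<Longrightarrow> u z = 0"
proof -
  have n: "normal_space K" using assms compact_Hausdorff_or_regular_imp_normal_space by blast
  have c: "closedin K {x}" using assms(2,3) by (simp add: closedin_Hausdorff_singleton)
  obtain u where u: "continuous_map K (top_of_set {0..1::real}) u" "u ` T \<subseteq> {0}" "u ` {x} \<subseteq> {1}"
    by (rule Urysohn_lemma[OF n assms(4) c, of 0 1]) (use assms(5) in \<open>auto simp: disjnt_def\<close>)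
  show thesis
  proof
    show "continuous_map K euclidean u" using u(1) continuous_map_in_subtopology by blast
    show "\<And>z. z \<in> topspace K \<Longrightarrow> 0 \<le> u z \<and> u z \<le> 1"
      using u(1) by (fastforce simp: continuous_map_in_subtopology)
  qed (use u in auto)
qed

text \<open>An injective unital star representation of C(K), stated without a norm on C(K); the
  bounds that make it isometric are derived below. Functions are total on the type, so
  \<open>cong\<close> is what makes \<phi> depend on the values on \<open>K\<close> alone.\<close>

locale function_rep =
  fixes K :: "'k topology" and \<phi> :: "('k \<Rightarrow> complex) \<Rightarrow> 'a::unital_cstar_algebra"
  assumes compact: "compact_space K" and Hausdorff: "Hausdorff_space K"
    and cong: "(\<And>x. x \<in> topspace K \<Longrightarrow> f x = g x) \<Longrightarrow> \<phi> f = \<phi> g"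
    and add: "continuous_map K euclidean f \<Longrightarrow> continuous_map K euclidean g \<Longrightarrow>
          \<phi> (\<lambda>x. f x + g x) = \<phi> f + \<phi> g"
    and mult: "continuous_map K euclidean f \<Longrightarrow> continuous_map K euclidean g \<Longrightarrow>
          \<phi> (\<lambda>x. f x * g x) = \<phi> f * \<phi> g"
    and scale: "continuous_map K euclidean f \<Longrightarrow> \<phi> (\<lambda>x. z * f x) = scaleC z (\<phi> f)"
    and star: "continuous_map K euclidean f \<Longrightarrow> \<phi> (\<lambda>x. cnj (f x)) = star (\<phi> f)"
    and one: "\<phi> (\<lambda>x. 1) = 1"
    and inj: "continuous_map K euclidean f \<Longrightarrow> \<phi> f = 0 \<Longrightarrow> x \<in> topspace K \<Longrightarrow> f x = 0"
begin

lemma zero: "\<phi> (\<lambda>x. 0) = 0"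
  using scale[of "\<lambda>x. 1" 0] by (simp add: one)

text \<open>Unimodular functions go to unitaries, and the C*-identity gives a unitary the norm
  \<open>1\<close>. The upper bounds start here, since no continuity of \<phi> is assumed.\<close>

lemma isometry_unimodular:
  assumes "continuous_map K euclidean f" "\<And>x. x \<in> topspace K \<Longrightarrow> cmod (f x) = 1"
  shows "norm (\<phi> f) = 1"
proof -
  have "(norm (\<phi> f))\<^sup>2 = norm (\<phi> (\<lambda>x. cnj (f x)) * \<phi> f)"
    by (simp add: star[OF assms(1)] cstar_identity)
  also have "\<phi> (\<lambda>x. cnj (f x)) * \<phi> f = \<phi> (\<lambda>x. cnj (f x) * f x)"
    by (rule mult[symmetric]) (intro continuous_map_cnj assms)+
  also have "\<dots> = \<phi> (\<lambda>x. 1)"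
    using assms(2) by (intro cong) (simp add: cnj_mult_self)
  finally have "(norm (\<phi> f))\<^sup>2 = 1" by (simp add: one)
  then show ?thesis using power2_eq_imp_eq[of "norm (\<phi> f)" 1] by simp
qed

text \<open>A real function \<open>f\<close> with \<open>|f| \<le> 1\<close> is the mean of the unitaries \<open>f \<plusminus> i \<surd>(1 - f\<^sup>2)\<close>.\<close>

lemma norm_le_one_real:
  assumes f: "continuous_map K euclidean f" and le: "\<And>x. x \<in> topspace K \<Longrightarrow> \<bar>f x\<bar> \<le> (1::real)"
  shows "norm (\<phi> (\<lambda>x. complex_of_real (f x))) \<le> 1"
proof -
  define u where "u = (\<lambda>x. Complex (f x) (sqrt (1 - (f x)\<^sup>2)))"
  have u: "continuous_map K euclidean u"
    using f by (auto simp: continuous_map_euclidean_iff u_def intro!: tendsto_intros)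
  have n: "cmod (u x) = 1" if "x \<in> topspace K" for x
  proof -
    have "0 \<le> 1 - (f x)\<^sup>2" using le[OF that] by (simp add: abs_square_le_1)
    then show ?thesis by (simp add: u_def cmod_def)
  qed
  have "norm (\<phi> u) = 1" using isometry_unimodular u n by blast
  moreover have "\<phi> (\<lambda>x. complex_of_real (f x)) = scaleC (1/2) (\<phi> u + star (\<phi> u))"
  proof -
    have "\<phi> (\<lambda>x. complex_of_real (f x)) = \<phi> (\<lambda>x. (1/2) * (u x + cnj (u x)))"
      by (intro cong) (simp add: complex_eq_iff u_def)
    also have "\<dots> = scaleC (1/2) (\<phi> (\<lambda>x. u x + cnj (u x)))"
      using u by (intro scale) (auto simp: continuous_map_euclidean_iff intro!: tendsto_intros)
    also have "\<phi> (\<lambda>x. u x + cnj (u x)) = \<phi> u + star (\<phi> u)"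
      using u by (simp add: add continuous_map_cnj star)
    finally show ?thesis .
  qed
  ultimately show ?thesis
    using norm_triangle_ineq[of "\<phi> u" "star (\<phi> u)"] by (simp add: norm_scaleC)
qed

text \<open>The C*-identity replaces the complex function \<open>g = f / r\<close> by the real
  function \<open>|g|^2\<close>, for which the bound by unitaries applies.\<close>

lemma norm_le:
  assumes f: "continuous_map K euclidean f" and r: "r \<ge> 0"
    and le: "\<And>x. x \<in> topspace K \<Longrightarrow> cmod (f x) \<le> r"
  shows "norm (\<phi> f) \<le> r"
proof (cases "r = 0")
  case True
  then have "\<phi> f = \<phi> (\<lambda>x. 0)" using le by (intro cong) simp
  with True show ?thesis by (simp add: zero)
next
  case False
  with r have r: "r > 0" by simp
  define g where "g = (\<lambda>x. complex_of_real (1/r) * f x)"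
  have g: "continuous_map K euclidean g"
    using f r by (auto simp: continuous_map_euclidean_iff g_def intro!: tendsto_intros)
  have "(norm (\<phi> g))\<^sup>2 = norm (\<phi> (\<lambda>x. cnj (g x) * g x))"
    by (simp add: star[OF g] cstar_identity mult[OF continuous_map_cnj[OF g] g])
  also have "\<phi> (\<lambda>x. cnj (g x) * g x) = \<phi> (\<lambda>x. complex_of_real ((cmod (g x))\<^sup>2))"
    by (intro cong) (simp add: cnj_mult_self)
  also have "norm \<dots> \<le> 1"
  proof (rule norm_le_one_real)
    show "continuous_map K euclidean (\<lambda>x. (cmod (g x))\<^sup>2)"
      using g by (auto simp: continuous_map_euclidean_iff intro!: tendsto_intros)
    show "\<bar>(cmod (g x))\<^sup>2\<bar> \<le> 1" if "x \<in> topspace K" for x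
      using le[OF that] r by (simp add: g_def norm_mult norm_divide divide_le_eq power_le_one)
  qed
  finally have "norm (\<phi> g) \<le> 1" using power2_le_imp_le[of "norm (\<phi> g)" 1] by simp
  moreover have "\<phi> g = scaleC (complex_of_real (1/r)) (\<phi> f)"
    unfolding g_def by (rule scale[OF f])
  ultimately show ?thesis using r by (simp add: norm_scaleC norm_divide field_simps)
qed

text \<open>If \<open>|f(x)| > s > \<parallel>\<phi>(f)\<parallel>\<close>, take \<open>g\<close> supported in \<open>{|f| \<ge> s}\<close> with \<open>g(x) \<noteq> 0\<close>, and \<open>k\<close> equal
  to \<open>1 / f\<close> on this set with \<open>|k| \<le> 1 / s\<close>. Then \<open>\<phi>(g) = \<phi>(g) \<phi>(k) \<phi>(f)\<close> and \<open>\<parallel>\<phi>(k) \<phi>(f)\<parallel> < 1\<close>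
  force \<open>\<phi>(g) = 0\<close>, against injectivity.\<close>

lemma norm_ge:
  assumes f: "continuous_map K euclidean f" and x: "x \<in> topspace K"
  shows "cmod (f x) \<le> norm (\<phi> f)"
proof (rule ccontr)
  assume "\<not> ?thesis"
  then obtain s where s: "norm (\<phi> f) < s" "s < cmod (f x)" using dense not_le by metis
  have s0: "s > 0" using s(1) norm_ge_zero le_less_trans by blast
  define T where "T = {z \<in> topspace K. cmod (f z) \<le> s}"
  have T: "closedin K T"
  proof -
    have "continuous_map K euclidean (\<lambda>z. cmod (f z))"
      using f by (auto simp: continuous_map_euclidean_iff intro!: tendsto_intros)
    from closedin_continuous_map_preimage[OF this, of "{..s}"] show ?thesis
      by (simp add: T_def)
  qed
  have "x \<notin> T" using s by (simp add: T_def)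
  from Urysohn_points[OF compact Hausdorff x T this] obtain u :: "'k \<Rightarrow> real" where
    u: "continuous_map K euclidean u" "\<And>z. z \<in> topspace K \<Longrightarrow> 0 \<le> u z \<and> u z \<le> 1"
      "u x = 1" "\<And>z. z \<in> T \<Longrightarrow> u z = 0" by metis
  define g where "g = (\<lambda>z. complex_of_real (u z))"
  have g: "continuous_map K euclidean g"
    using u(1) by (auto simp: continuous_map_euclidean_iff g_def intro!: tendsto_intros)
  define k where "k = (\<lambda>z. cnj (f z) / complex_of_real ((max s (cmod (f z)))\<^sup>2))"
  have k: "continuous_map K euclidean k"
    using f s0 by (auto simp: continuous_map_euclidean_iff k_def intro!: tendsto_intros)
  have kf: "g z * (k z * f z) = g z" if "z \<in> topspace K" for z
  proof (cases "z \<in> T")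
    case True then show ?thesis using u(4) by (simp add: g_def)
  next
    case False
    then have "max s (cmod (f z)) = cmod (f z)" "f z \<noteq> 0" using that s0 by (auto simp: T_def)
    then have "k z * f z = 1"
      by (simp add: k_def cnj_mult_self)
    then show ?thesis by simp
  qed
  have kn: "cmod (k z) \<le> 1 / s" for z
  proof -
    define M where "M = max s (cmod (f z))"
    have M: "M \<ge> s" "M \<ge> cmod (f z)" "M > 0" using s0 by (auto simp: M_def)
    have "cmod (k z) = cmod (f z) / M\<^sup>2"
      by (simp add: k_def M_def norm_divide norm_power)
    also have "\<dots> \<le> M / M\<^sup>2" using M by (intro divide_right_mono) auto
    also have "\<dots> = 1 / M" using M by (simp add: power2_eq_square)
    also have "\<dots> \<le> 1 / s" using M s0 by (simp add: frac_le)
    finally show ?thesis .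
  qed
  have pk: "norm (\<phi> k) \<le> 1 / s" using norm_le[OF k] kn s0 by simp
  have eq: "\<phi> g = \<phi> g * (\<phi> k * \<phi> f)"
  proof -
    have "\<phi> g = \<phi> (\<lambda>z. g z * (k z * f z))" using kf by (intro cong) simp
    also have "\<dots> = \<phi> g * (\<phi> k * \<phi> f)"
      using mult[OF g continuous_map_mult_complex[OF k f]] mult[OF k f] by simp
    finally show ?thesis .
  qed
  define q where "q = norm (\<phi> k) * norm (\<phi> f)"
  have "q \<le> (1/s) * norm (\<phi> f)" unfolding q_def using pk by (intro mult_right_mono) auto
  also have "\<dots> < 1" using s s0 by (simp add: field_simps)
  finally have q: "q < 1" .
  have "norm (\<phi> g) \<le> norm (\<phi> g) * norm (\<phi> k * \<phi> f)"
    using eq norm_mult_ineq by metis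
  also have "\<dots> \<le> norm (\<phi> g) * q" unfolding q_def
    by (intro mult_left_mono norm_mult_ineq) auto
  finally have "norm (\<phi> g) * (1 - q) \<le> 0" by (simp add: algebra_simps)
  with q have "\<phi> g = 0" by (simp add: mult_le_0_iff)
  from inj[OF g this x] u(3) show False by (simp add: g_def)
qed

text \<open>The kernel of \<xi> on C(K) has a common zero: otherwise compactness yields finitely
  many kernel functions without a common zero, and the sum of their squared moduli is an invertible
  element of the kernel. The assumptions speak of the range of \<phi>, as \<xi> will be a character
  of a larger algebra.\<close>

lemma functional_eq_evaluation:
  assumes add': "\<And>f g. continuous_map K euclidean f \<Longrightarrow> continuous_map K euclidean g \<Longrightarrow>
      \<xi> (\<phi> f + \<phi> g) = \<xi> (\<phi> f) + \<xi> (\<phi> g)"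
    and mult': "\<And>f g. continuous_map K euclidean f \<Longrightarrow> continuous_map K euclidean g \<Longrightarrow>
      \<xi> (\<phi> f * \<phi> g) = \<xi> (\<phi> f) * \<xi> (\<phi> g)"
    and scale': "\<And>f z. continuous_map K euclidean f \<Longrightarrow> \<xi> (scaleC z (\<phi> f)) = z * \<xi> (\<phi> f)"
    and one': "\<xi> 1 = (1::complex)"
  obtains x where "x \<in> topspace K" "\<And>f. continuous_map K euclidean f \<Longrightarrow> \<xi> (\<phi> f) = f x"
proof -
  define L where "L f = \<xi> (\<phi> f)" for f
  note C = continuous_map_cnj continuous_map_mult_complex
  have Ladd: "L (\<lambda>x. f x + g x) = L f + L g"
    if "continuous_map K euclidean f" "continuous_map K euclidean g" for f g
    using that by (simp add: L_def add add')
  have Lmult: "L (\<lambda>x. f x * g x) = L f * L g"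
    if "continuous_map K euclidean f" "continuous_map K euclidean g" for f g
    using that by (simp add: L_def mult mult')
  have Lc: "L (\<lambda>x. z) = z" for z
    using scale[of "\<lambda>x. 1" z] scale'[of "\<lambda>x. 1" z] by (simp add: L_def one one')
  have Lcong: "L f = L g" if "\<And>x. x \<in> topspace K \<Longrightarrow> f x = g x" for f g
    unfolding L_def using cong[OF that] by simp
  have ex: "\<exists>x\<in>topspace K. \<forall>f. continuous_map K euclidean f \<longrightarrow> L f = 0 \<longrightarrow> f x = 0"
  proof (rule ccontr)
    assume "\<not> ?thesis"
    then have "\<forall>x\<in>topspace K. \<exists>f. continuous_map K euclidean f \<and> L f = 0 \<and> f x \<noteq> 0" by blast
    then obtain F where F: "\<And>x. x \<in> topspace K \<Longrightarrow> continuous_map K euclidean (F x)"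
      "\<And>x. x \<in> topspace K \<Longrightarrow> L (F x) = 0" "\<And>x. x \<in> topspace K \<Longrightarrow> F x x \<noteq> 0" by metis
    define U where "U x = {z \<in> topspace K. F x z \<in> - {0}}" for x
    have U: "openin K (U x)" "x \<in> U x" if "x \<in> topspace K" for x
      using openin_continuous_map_preimage[OF F(1)[OF that], of "- {0}"] F(3)[OF that] that
      by (auto simp: U_def)
    have "topspace K \<subseteq> \<Union> (U ` topspace K)" using U(2) by blast
    moreover have "\<And>W. W \<in> U ` topspace K \<Longrightarrow> openin K W" using U(1) by blast
    ultimately obtain \<F> where \<F>: "finite \<F>" "\<F> \<subseteq> U ` topspace K" "topspace K \<subseteq> \<Union>\<F>"
      using compact unfolding compact_space_alt by metis
    then obtain P where P: "finite P" "P \<subseteq> topspace K" "\<F> = U ` P"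
      by (meson finite_subset_image)
    define S where "S z = (\<Sum>x\<in>P. cnj (F x z) * F x z)" for z
    have *: "continuous_map K euclidean (\<lambda>z. \<Sum>x\<in>Q. cnj (F x z) * F x z) \<and>
        L (\<lambda>z. \<Sum>x\<in>Q. cnj (F x z) * F x z) = 0" if "Q \<subseteq> P" "finite Q" for Q
      using that(2,1)
    proof (induction Q rule: finite_induct)
      case empty then show ?case using Lc[of 0] by simp
    next
      case (insert a Q)
      then have a: "a \<in> topspace K" using P by auto
      have 1: "continuous_map K euclidean (\<lambda>z. cnj (F a z) * F a z)"
        by (intro C F a)
      have 2: "L (\<lambda>z. cnj (F a z) * F a z) = 0"
        using F[OF a] by (simp add: Lmult C)
      have 3: "continuous_map K euclidean (\<lambda>z. \<Sum>x\<in>Q. cnj (F x z) * F x z)"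
        "L (\<lambda>z. \<Sum>x\<in>Q. cnj (F x z) * F x z) = 0" using insert by auto
      have 4: "continuous_map K euclidean (\<lambda>z. cnj (F a z) * F a z + (\<Sum>x\<in>Q. cnj (F x z) * F x z))"
        using 1 3(1) by (rule continuous_map_add_complex)
      show ?case using insert(1,2) Ladd[OF 1 3(1)] 2 3 4 by simp
    qed
    have S: "continuous_map K euclidean S" "L S = 0"
      using *[OF order_refl P(1)] unfolding S_def by auto
    have Snz: "S z \<noteq> 0" if "z \<in> topspace K" for z
    proof -
      have "S z = complex_of_real (\<Sum>x\<in>P. (cmod (F x z))\<^sup>2)"
        unfolding S_def of_real_sum by (intro sum.cong refl) (rule cnj_mult_self)
      moreover have "z \<in> (\<Union>x\<in>P. U x)" using \<F>(3) that unfolding P(3) by (rule subsetD)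
      then obtain x where "x \<in> P" "z \<in> U x" by (rule UN_E)
      then have "(\<Sum>x\<in>P. (cmod (F x z))\<^sup>2) > 0"
        using P(1) by (intro sum_pos2[of _ x]) (auto simp: U_def)
      ultimately show ?thesis by (simp only: of_real_eq_0_iff)
    qed
    have inv: "continuous_map K euclidean (\<lambda>z. inverse (S z))"
      using S(1) Snz by (auto simp: continuous_map_euclidean_iff intro!: tendsto_intros)
    have "L (\<lambda>z. inverse (S z) * S z) = L (\<lambda>z. 1)" using Snz by (intro Lcong) simp
    then show False using Lmult[OF inv S(1)] S(2) Lc by simp
  qed
  then obtain x where x: "x \<in> topspace K" "\<And>f. continuous_map K euclidean f \<Longrightarrow> L f = 0 \<Longrightarrow> f x = 0"
    by blast
  show thesis
  proof
    fix f :: "'k \<Rightarrow> complex" assume f: "continuous_map K euclidean f"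
    \<comment> \<open>Subtracting the value \<open>L f\<close> puts \<open>f\<close> into the
      kernel, so the difference vanishes at the common zero.\<close>
    have c: "continuous_map K euclidean (\<lambda>z. f z + - L f)"
      using f by (auto simp: continuous_map_euclidean_iff intro!: tendsto_intros)
    have "L (\<lambda>z. f z + - L f) = 0" using Ladd[OF f, of "\<lambda>_. - L f"] Lc[of "- L f"] by simp
    from x(2)[OF c this] show "\<xi> (\<phi> f) = f x" by (simp add: L_def)
  qed (rule x(1))
qed

end


section \<open>Inductive limits of commutative algebras\<close>

locale tower =
  fixes K :: "nat \<Rightarrow> 'k topology" and \<kappa> :: "nat \<Rightarrow> 'k \<Rightarrow> 'k"
    and \<phi> :: "nat \<Rightarrow> ('k \<Rightarrow> complex) \<Rightarrow> 'a::unital_cstar_algebra"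
  assumes rep: "i \<ge> 1 \<Longrightarrow> function_rep (K i) (\<phi> i)"
    and cont: "i \<ge> 1 \<Longrightarrow> continuous_map (K (Suc i)) (K i) (\<kappa> i)"
    and compat: "i \<ge> 1 \<Longrightarrow> continuous_map (K i) euclidean f \<Longrightarrow> \<phi> (Suc i) (f \<circ> \<kappa> i) = \<phi> i f"
begin

text \<open>The inverse limit of the spaces \<open>K i\<close>. The value at index \<open>0\<close>
  is free, so threads are compared only from index \<open>1\<close> on.\<close>

definition threads :: "(nat \<Rightarrow> 'k) set" where
  "threads = {t. \<forall>i\<ge>1. t i \<in> topspace (K i) \<and> \<kappa> i (t (Suc i)) = t i}"

definition levels :: "'a set" where
  "levels = (\<Union>i\<in>{1..}. \<phi> i ` {f. continuous_map (K i) euclidean f})"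

definition limit :: "'a set" where "limit = closure levels"

lemma levelsI: "i \<ge> 1 \<Longrightarrow> continuous_map (K i) euclidean f \<Longrightarrow> \<phi> i f \<in> levels"
  by (auto simp: levels_def)

lemma limitI: "i \<ge> 1 \<Longrightarrow> continuous_map (K i) euclidean f \<Longrightarrow> \<phi> i f \<in> limit"
  using levelsI closure_subset unfolding limit_def by blast

lemma closed_limit: "closed limit"
  by (simp add: limit_def)

text \<open>Pulling back along \<open>\<kappa>\<close> moves a function to a higher level without
  changing its image. The last conjunct records that the value along a thread is unchanged too,
  which makes evaluation along a thread independent of the level.\<close>

lemma lift:
  assumes "i \<ge> 1" "i \<le> m" "continuous_map (K i) euclidean f"
  shows "\<exists>g. continuous_map (K m) euclidean g \<and> \<phi> m g = \<phi> i f \<and> (\<forall>t\<in>threads. g (t m) = f (t i))"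
  using assms(2)
proof (induction m rule: dec_induct)
  case base
  show ?case using assms by blast
next
  case (step m)
  then obtain g where g: "continuous_map (K m) euclidean g" "\<phi> m g = \<phi> i f"
    "\<And>t. t \<in> threads \<Longrightarrow> g (t m) = f (t i)" by blast
  have m: "m \<ge> 1" using step assms by simp
  show ?case
  proof (intro exI conjI ballI)
    show "continuous_map (K (Suc m)) euclidean (g \<circ> \<kappa> m)"
      by (rule continuous_map_compose[OF cont[OF m] g(1)])
    show "\<phi> (Suc m) (g \<circ> \<kappa> m) = \<phi> i f" using compat[OF m g(1)] g(2) by simp
    show "(g \<circ> \<kappa> m) (t (Suc m)) = f (t i)" if "t \<in> threads" for t
      using that m g(3)[OF that] by (simp add: threads_def)
  qed
qed

lemma levelsE:
  assumes "a \<in> levels" "b \<in> levels"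
  obtains i f g where "i \<ge> 1" "continuous_map (K i) euclidean f" "continuous_map (K i) euclidean g"
    "a = \<phi> i f" "b = \<phi> i g"
proof -
  from assms obtain i j f g where ij: "i \<ge> 1" "j \<ge> 1" "continuous_map (K i) euclidean f"
    "continuous_map (K j) euclidean g" "a = \<phi> i f" "b = \<phi> j g" by (auto simp: levels_def)
  obtain f' where "continuous_map (K (max i j)) euclidean f'" "\<phi> (max i j) f' = \<phi> i f"
    using lift[of i "max i j" f] ij by auto
  moreover obtain g' where "continuous_map (K (max i j)) euclidean g'" "\<phi> (max i j) g' = \<phi> j g"
    using lift[of j "max i j" g] ij by auto
  ultimately show thesis using that[of "max i j" f' g'] ij by simp
qed

lemma levels_algebra:
  assumes "a \<in> levels" "b \<in> levels"
  shows "a + b \<in> levels" "a * b \<in> levels" "a * b = b * a"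
proof -
  obtain i f g where i: "i \<ge> 1" "continuous_map (K i) euclidean f" "continuous_map (K i) euclidean g"
    "a = \<phi> i f" "b = \<phi> i g" using levelsE[OF assms] by metis
  interpret function_rep "K i" "\<phi> i" by (rule rep) fact
  have "a + b = \<phi> i (\<lambda>x. f x + g x)" "a * b = \<phi> i (\<lambda>x. f x * g x)" "b * a = \<phi> i (\<lambda>x. g x * f x)"
    using i by (simp_all add: add mult)
  with i show "a + b \<in> levels" "a * b \<in> levels" "a * b = b * a"
    by (auto intro!: levelsI continuous_map_add_complex continuous_map_mult_complex simp: mult.commute)
qed

lemma levels_scale_star:
  assumes "a \<in> levels"
  shows "scaleC z a \<in> levels" "star a \<in> levels"
proof -
  obtain i f where i: "i \<ge> 1" "continuous_map (K i) euclidean f" "a = \<phi> i f"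
    using assms by (auto simp: levels_def)
  interpret function_rep "K i" "\<phi> i" by (rule rep) fact
  have "scaleC z a = \<phi> i (\<lambda>x. z * f x)" "star a = \<phi> i (\<lambda>x. cnj (f x))"
    using i by (simp_all add: scale star)
  with i show "scaleC z a \<in> levels" "star a \<in> levels"
    by (auto intro!: levelsI continuous_map_mult_complex continuous_map_cnj)
qed

lemma one_in_levels: "1 \<in> levels"
proof -
  interpret function_rep "K 1" "\<phi> 1" by (rule rep) simp
  show ?thesis by (subst one[symmetric]) (rule levelsI, simp_all)
qed

lemma subalgebra_limit: "unital_subalgebra limit"
  unfolding limit_def
  by (rule unital_subalgebra_closure)
    (auto simp: unital_subalgebra_def intro: one_in_levels levels_algebra levels_scale_star)

lemmas limit_closed = unital_subalgebraD[OF subalgebra_limit]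

lemma limit_seqE:
  assumes "a \<in> limit"
  obtains f where "\<And>n::nat. f n \<in> levels" "f \<longlonglongrightarrow> a"
  using assms unfolding limit_def closure_sequential by blast

lemma star_in_limit:
  assumes "a \<in> limit"
  shows "star a \<in> limit"
proof -
  obtain f where f: "\<And>n::nat. f n \<in> levels" "f \<longlonglongrightarrow> a" using limit_seqE[OF assms] by metis
  show ?thesis unfolding limit_def
    by (rule closure_limI[OF _ tendsto_star[OF f(2)]]) (intro levels_scale_star f)
qed

lemma limit_commute:
  assumes "a \<in> limit" "b \<in> limit"
  shows "a * b = b * a"
proof -
  obtain f where f: "\<And>n::nat. f n \<in> levels" "f \<longlonglongrightarrow> a" using limit_seqE[OF assms(1)] by metis
  obtain g where g: "\<And>n::nat. g n \<in> levels" "g \<longlonglongrightarrow> b" using limit_seqE[OF assms(2)] by metis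
  have "(\<lambda>n. f n * g n) \<longlonglongrightarrow> a * b" by (intro tendsto_mult f g)
  moreover have "(\<lambda>n. f n * g n) \<longlonglongrightarrow> b * a"
    unfolding levels_algebra(3)[OF f(1) g(1)] by (intro tendsto_mult f g)
  ultimately show ?thesis by (rule LIMSEQ_unique)
qed

lemma limit_approx:
  assumes "a \<in> limit" "e > 0"
  shows "\<exists>i f. i \<ge> 1 \<and> continuous_map (K i) euclidean f \<and> norm (a - \<phi> i f) < e"
proof -
  obtain b where b: "b \<in> levels" "dist b a < e"
    using assms unfolding limit_def closure_approachable by blast
  then show ?thesis by (auto simp: levels_def dist_norm norm_minus_commute)
qed

lemma characters_eqI:
  assumes "\<xi> \<in> characters limit" "\<eta> \<in> characters limit"
    and eq: "\<And>i f. i \<ge> 1 \<Longrightarrow> continuous_map (K i) euclidean f \<Longrightarrow> \<xi> (\<phi> i f) = \<eta> (\<phi> i f)"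
  shows "\<xi> = \<eta>"
proof (rule extensionalityI[of _ limit])
  fix a assume a: "a \<in> limit"
  note cl = subalgebra_limit closed_limit
  have "cmod (\<xi> a - \<eta> a) \<le> e" if e: "e > 0" for e
  proof -
    obtain i f where f: "i \<ge> 1" "continuous_map (K i) euclidean f" "norm (a - \<phi> i f) < e / 2"
      using limit_approx[OF a half_gt_zero[OF e]] by metis
    have d: "a - \<phi> i f \<in> limit" by (intro limit_closed a limitI f)
    have "\<xi> a - \<eta> a = \<xi> (a - \<phi> i f) - \<eta> (a - \<phi> i f)"
      using assms(1,2) a f limitI by (simp add: characterD[OF _ subalgebra_limit] eq)
    also have "cmod \<dots> \<le> cmod (\<xi> (a - \<phi> i f)) + cmod (\<eta> (a - \<phi> i f))" by (rule norm_triangle_ineq4)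
    also have "\<dots> \<le> e" using character_le_norm[OF assms(1) cl d] character_le_norm[OF assms(2) cl d] f(3)
      by simp
    finally show ?thesis .
  qed
  then show "\<xi> a = \<eta> a" using field_le_epsilon[of "cmod (\<xi> a - \<eta> a)" 0] by simp
qed (use assms in \<open>auto simp: characters_def\<close>)

section \<open>Characters of the limit as threads\<close>

lemma separate_points:
  assumes "i \<ge> 1" "x \<in> topspace (K i)" "y \<in> topspace (K i)" "x \<noteq> y"
  obtains u where "continuous_map (K i) euclidean u" "u x = 1" "u y = 0"
    "\<And>z. z \<in> topspace (K i) \<Longrightarrow> cmod (u z) \<le> 1"
proof -
  interpret function_rep "K i" "\<phi> i" by (rule rep) fact
  have "closedin (K i) {y}" using Hausdorff assms(3) by (simp add: closedin_Hausdorff_singleton)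
  then obtain u :: "_ \<Rightarrow> real" where
    u: "continuous_map (K i) euclidean u" "\<And>z. z \<in> topspace (K i) \<Longrightarrow> 0 \<le> u z \<and> u z \<le> 1"
      "u x = 1" "\<And>z. z \<in> {y} \<Longrightarrow> u z = 0"
    using Urysohn_points[OF compact Hausdorff assms(2), of "{y}"] assms(4) by auto
  show thesis
  proof
    show "continuous_map (K i) euclidean (\<lambda>z. complex_of_real (u z))"
      using u(1) by (auto simp: continuous_map_euclidean_iff intro!: tendsto_intros)
  qed (use u(2-4) in auto)
qed

text \<open>On each level a character is evaluation at a point. Were the points of two successive
  levels not linked by \<open>\<kappa> i\<close>, a function separating the two candidates would
  take contradictory values under the character.\<close>

lemma character_thread:
  assumes "\<xi> \<in> characters limit"
  shows "\<exists>t\<in>threads. \<forall>i\<ge>1. \<forall>f. continuous_map (K i) euclidean f \<longrightarrow> \<xi> (\<phi> i f) = f (t i)"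
proof -
  note \<xi> = characterD[OF assms subalgebra_limit]
  have "\<exists>x\<in>topspace (K i). \<forall>f. continuous_map (K i) euclidean f \<longrightarrow> \<xi> (\<phi> i f) = f x" if "i \<ge> 1" for i
  proof -
    interpret function_rep "K i" "\<phi> i" by (rule rep) fact
    show ?thesis
      by (rule functional_eq_evaluation[of \<xi>]) (use limitI[OF that] \<xi> in auto)
  qed
  then obtain t where t: "\<And>i. i \<ge> 1 \<Longrightarrow> t i \<in> topspace (K i)"
    "\<And>i f. i \<ge> 1 \<Longrightarrow> continuous_map (K i) euclidean f \<Longrightarrow> \<xi> (\<phi> i f) = f (t i)" by metis
  have "\<kappa> i (t (Suc i)) = t i" if i: "i \<ge> 1" for i
  proof (rule ccontr)
    have mem: "\<kappa> i (t (Suc i)) \<in> topspace (K i)"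
      using continuous_map_image_subset_topspace[OF cont[OF i]] t(1)[of "Suc i"] by auto
    assume "\<kappa> i (t (Suc i)) \<noteq> t i"
    then obtain u :: "'k \<Rightarrow> complex" where u: "continuous_map (K i) euclidean u" "u (\<kappa> i (t (Suc i))) = 1" "u (t i) = 0"
      using separate_points[OF i mem t(1)[OF i]] by metis
    have "u (t i) = \<xi> (\<phi> (Suc i) (u \<circ> \<kappa> i))" using t(2)[OF i u(1)] compat[OF i u(1)] by simp
    also have "\<dots> = u (\<kappa> i (t (Suc i)))"
      using t(2)[of "Suc i", OF _ continuous_map_compose[OF cont[OF i] u(1)]] by simp
    finally show False using u by simp
  qed
  with t(1) have "t \<in> threads" by (simp add: threads_def)
  with t(2) show ?thesis by blast
qed

text \<open>Both elements are lifted to a common level, where the lower norm bound applies to their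
  difference. This makes evaluation along a thread well defined and \<open>1\<close>-Lipschitz on
  the union of the levels.\<close>

lemma thread_contraction:
  assumes t: "t \<in> threads"
    and ij: "i \<ge> 1" "j \<ge> 1" "continuous_map (K i) euclidean f" "continuous_map (K j) euclidean g"
  shows "cmod (f (t i) - g (t j)) \<le> norm (\<phi> i f - \<phi> j g)"
proof -
  define m where "m = max i j"
  have m: "m \<ge> 1" "i \<le> m" "j \<le> m" using ij by (auto simp: m_def)
  interpret function_rep "K m" "\<phi> m" by (rule rep) fact
  obtain f' where f': "continuous_map (K m) euclidean f'" "\<phi> m f' = \<phi> i f" "f' (t m) = f (t i)"
    using lift[OF ij(1) m(2) ij(3)] t by blast
  obtain g' where g': "continuous_map (K m) euclidean g'" "\<phi> m g' = \<phi> j g" "g' (t m) = g (t j)"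
    using lift[OF ij(2) m(3) ij(4)] t by blast
  have s: "continuous_map (K m) euclidean (\<lambda>x. (-1) * g' x)"
    using g'(1) by (intro continuous_map_mult_complex) auto
  have eq: "\<phi> m (\<lambda>x. f' x + (-1) * g' x) = \<phi> i f - \<phi> j g"
    by (subst add[OF f'(1) s], subst scale[OF g'(1)]) (simp add: f' g' scaleC_minus_one)
  have "t m \<in> topspace (K m)" using t m by (simp add: threads_def)
  from norm_ge[OF continuous_map_add_complex[OF f'(1) s] this] show ?thesis
    unfolding eq by (simp add: f' g')
qed

lemma thread_functional:
  assumes t: "t \<in> threads"
  shows "\<exists>g. continuous_on limit g \<and>
    (\<forall>i\<ge>1. \<forall>f. continuous_map (K i) euclidean f \<longrightarrow> g (\<phi> i f) = f (t i))"
proof -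
  \<comment> \<open>The value is read off an arbitrary presentation of \<open>a\<close>; by
    \<open>thread_contraction\<close>, at distance \<open>0\<close>, all presentations give the same
    value.\<close>
  define l where "l a = (SOME v. \<exists>i f. i \<ge> 1 \<and> continuous_map (K i) euclidean f \<and> a = \<phi> i f \<and> v = f (t i))" for a
  have l: "l (\<phi> i f) = f (t i)" if i: "i \<ge> 1" "continuous_map (K i) euclidean f" for i f
    unfolding l_def
  proof (rule some_equality)
    fix v assume "\<exists>j g. j \<ge> 1 \<and> continuous_map (K j) euclidean g \<and> \<phi> i f = \<phi> j g \<and> v = g (t j)"
    then obtain j g where j: "j \<ge> 1" "continuous_map (K j) euclidean g" "\<phi> i f = \<phi> j g" "v = g (t j)"
      by blast
    from thread_contraction[OF t i(1) j(1) i(2) j(2)] j(3,4) show "v = f (t i)" by simp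
  qed (use i in blast)
  have "uniformly_continuous_on levels l"
    unfolding uniformly_continuous_on_def
  proof (intro allI impI)
    fix e :: real assume e: "e > 0"
    have "dist (l b) (l a) \<le> dist b a" if ab: "a \<in> levels" "b \<in> levels" for a b
    proof -
      obtain i f g where "i \<ge> 1" "continuous_map (K i) euclidean f" "continuous_map (K i) euclidean g"
        "a = \<phi> i f" "b = \<phi> i g" using levelsE[OF ab] by metis
      with thread_contraction[OF t, of i i g f] l show ?thesis by (simp add: dist_norm)
    qed
    with e show "\<exists>d>0. \<forall>a\<in>levels. \<forall>b\<in>levels. dist b a < d \<longrightarrow> dist (l b) (l a) < e"
      by (meson le_less_trans)
  qed
  then obtain g where g: "uniformly_continuous_on (closure levels) g" "\<And>a. a \<in> levels \<Longrightarrow> l a = g a"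
    by (rule uniformly_continuous_on_extension_on_closure) blast
  have gc: "continuous_on limit g"
    using uniformly_continuous_imp_continuous[OF g(1)] by (simp add: limit_def)
  have "\<forall>i\<ge>1. \<forall>f. continuous_map (K i) euclidean f \<longrightarrow> g (\<phi> i f) = f (t i)"
    using l g(2) levelsI by metis
  with gc show ?thesis by blast
qed

lemma continuous_evaluation_character:
  assumes t: "t \<in> threads" and gc: "continuous_on limit g"
    and g: "\<And>i f. i \<ge> 1 \<Longrightarrow> continuous_map (K i) euclidean f \<Longrightarrow> g (\<phi> i f) = f (t i)"
  shows "restrict g limit \<in> characters limit"
proof -
  have seq: "(\<lambda>n. g (f n)) \<longlonglongrightarrow> g a" if "\<And>n. f n \<in> levels" "f \<longlonglongrightarrow> a" "a \<in> limit" for f a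
  proof (rule continuous_on_tendsto_compose[OF gc that(2,3)])
    have "levels \<subseteq> limit" unfolding limit_def by (rule closure_subset)
    then show "\<forall>\<^sub>F n in sequentially. f n \<in> limit" using that(1) by (intro always_eventually) auto
  qed
  have gl: "g (a + b) = g a + g b \<and> g (a * b) = g a * g b" if ab: "a \<in> levels" "b \<in> levels" for a b
  proof -
    obtain i f h where i: "i \<ge> 1" "continuous_map (K i) euclidean f" "continuous_map (K i) euclidean h"
      "a = \<phi> i f" "b = \<phi> i h" using levelsE[OF ab] by metis
    interpret function_rep "K i" "\<phi> i" by (rule rep) fact
    have "a + b = \<phi> i (\<lambda>x. f x + h x)" "a * b = \<phi> i (\<lambda>x. f x * h x)"
      using i by (simp_all add: add mult)
    then show ?thesis
      using i by (simp add: g continuous_map_add_complex continuous_map_mult_complex)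
  qed
  have gs: "g (scaleC z a) = z * g a" if a: "a \<in> levels" for a z
  proof -
    obtain i f where i: "i \<ge> 1" "continuous_map (K i) euclidean f" "a = \<phi> i f"
      using a by (auto simp: levels_def)
    interpret function_rep "K i" "\<phi> i" by (rule rep) fact
    have "scaleC z a = \<phi> i (\<lambda>x. z * f x)" using i by (simp add: scale)
    then show ?thesis
      using i by (simp add: g continuous_map_mult_complex)
  qed
  have gD: "g (a + b) = g a + g b \<and> g (a * b) = g a * g b" if ab: "a \<in> limit" "b \<in> limit" for a b
  proof -
    obtain f where f: "\<And>n::nat. f n \<in> levels" "f \<longlonglongrightarrow> a" using limit_seqE[OF ab(1)] by metis
    obtain h where h: "\<And>n::nat. h n \<in> levels" "h \<longlonglongrightarrow> b" using limit_seqE[OF ab(2)] by metis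
    have 1: "(\<lambda>n. g (f n + h n)) \<longlonglongrightarrow> g (a + b)"
      by (rule seq) (simp_all add: levels_algebra f h limit_closed ab tendsto_add)
    have 2: "(\<lambda>n. g (f n + h n)) \<longlonglongrightarrow> g a + g b"
      using tendsto_add[OF seq[OF f ab(1)] seq[OF h ab(2)]] gl[OF f(1) h(1)] by simp
    have 3: "(\<lambda>n. g (f n * h n)) \<longlonglongrightarrow> g (a * b)"
      by (rule seq) (simp_all add: levels_algebra f h limit_closed ab tendsto_mult)
    have 4: "(\<lambda>n. g (f n * h n)) \<longlonglongrightarrow> g a * g b"
      using tendsto_mult[OF seq[OF f ab(1)] seq[OF h ab(2)]] gl[OF f(1) h(1)] by simp
    show ?thesis using LIMSEQ_unique[OF 1 2] LIMSEQ_unique[OF 3 4] by simp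
  qed
  have gsD: "g (scaleC z a) = z * g a" if a: "a \<in> limit" for a z
  proof -
    obtain f where f: "\<And>n::nat. f n \<in> levels" "f \<longlonglongrightarrow> a" using limit_seqE[OF a] by metis
    have 1: "(\<lambda>n. g (scaleC z (f n))) \<longlonglongrightarrow> g (scaleC z a)"
      by (rule seq) (simp_all add: levels_scale_star f limit_closed a tendsto_scaleC)
    have 2: "(\<lambda>n. g (scaleC z (f n))) \<longlonglongrightarrow> z * g a"
      using tendsto_mult_left[OF seq[OF f a]] gs[OF f(1)] by simp
    show ?thesis by (rule LIMSEQ_unique[OF 1 2])
  qed
  have "g 1 = 1"
  proof -
    interpret function_rep "K 1" "\<phi> 1" by (rule rep) simp
    have "g (\<phi> 1 (\<lambda>x. 1)) = 1" by (rule g) simp_all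
    then show ?thesis by (simp only: one)
  qed
  then have 1: "\<exists>a\<in>limit. restrict g limit a \<noteq> 0"
    using limit_closed(1) by (intro bexI[of _ 1]) simp_all
  have 2: "restrict g limit \<in> extensional limit" by simp
  have 3: "restrict g limit (a + b) = restrict g limit a + restrict g limit b"
    "restrict g limit (a * b) = restrict g limit a * restrict g limit b"
    if "a \<in> limit" "b \<in> limit" for a b
    using that gD[OF that] limit_closed(2,3)[OF that] by simp_all
  have 4: "restrict g limit (scaleC z a) = z * restrict g limit a" if "a \<in> limit" for z a
    using that gsD[OF that] limit_closed(4)[OF that] by simp
  show ?thesis unfolding characters_def mem_Collect_eq
    by (intro conjI ballI allI 1 2 3 4)
qed

lemma thread_character:
  assumes t: "t \<in> threads"
  shows "\<exists>\<xi>\<in>characters limit. \<forall>i\<ge>1. \<forall>f. continuous_map (K i) euclidean f \<longrightarrow> \<xi> (\<phi> i f) = f (t i)"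
proof -
  obtain g where gc: "continuous_on limit g"
    and g: "\<forall>i\<ge>1. \<forall>f. continuous_map (K i) euclidean f \<longrightarrow> g (\<phi> i f) = f (t i)"
    using thread_functional[OF t] by (elim exE conjE)
  show ?thesis
  proof (rule bexI)
    show "restrict g limit \<in> characters limit"
      using continuous_evaluation_character[OF t gc] g by simp
    show "\<forall>i\<ge>1. \<forall>f. continuous_map (K i) euclidean f \<longrightarrow> restrict g limit (\<phi> i f) = f (t i)"
      using limitI g by simp
  qed
qed

text \<open>Two different characters have threads that differ at some level, and a Urysohn function
  there separates them. The bound on \<open>norm c\<close> is what the estimate for germs of
  normalisers needs.\<close>

lemma separate_characters:
  assumes "\<xi> \<in> characters limit" "\<eta> \<in> characters limit" "\<xi> \<noteq> \<eta>"
  obtains c where "c \<in> limit" "norm c \<le> 1" "\<xi> c = 1" "\<eta> c = 0"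
proof -
  obtain t where t: "t \<in> threads"
    "\<forall>i\<ge>1. \<forall>f. continuous_map (K i) euclidean f \<longrightarrow> \<xi> (\<phi> i f) = f (t i)"
    using character_thread[OF assms(1)] by (rule bexE)
  obtain s where s: "s \<in> threads"
    "\<forall>i\<ge>1. \<forall>f. continuous_map (K i) euclidean f \<longrightarrow> \<eta> (\<phi> i f) = f (s i)"
    using character_thread[OF assms(2)] by (rule bexE)
  have "\<exists>i\<ge>1. t i \<noteq> s i"
  proof (rule ccontr)
    assume "\<not> ?thesis"
    then have "\<xi> = \<eta>" using t(2) s(2) by (intro characters_eqI assms) simp
    then show False using assms(3) by simp
  qed
  then obtain i where i: "i \<ge> 1" "t i \<noteq> s i" by blast
  interpret function_rep "K i" "\<phi> i" by (rule rep) fact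
  have "t i \<in> topspace (K i)" "s i \<in> topspace (K i)" using t(1) s(1) i by (auto simp: threads_def)
  from separate_points[OF i(1) this i(2)] obtain u where
    u: "continuous_map (K i) euclidean u" "u (t i) = 1" "u (s i) = 0"
      "\<And>z. z \<in> topspace (K i) \<Longrightarrow> cmod (u z) \<le> 1" by metis
  show thesis
    using that[of "\<phi> i u"] limitI[OF i(1) u(1)] norm_le[OF u(1), of 1] u(4) t(2)[rule_format, OF i(1) u(1)]
      s(2)[rule_format, OF i(1) u(1)] u(2,3) by simp
qed

text \<open>The topology tests all elements of the limit, but characters are contractive, so the
  values at an arbitrary \<open>a\<close> are uniformly close to those at an element of a level;
  continuity on the levels suffices.\<close>

lemma continuous_map_into_spectrum:
  assumes F: "F \<in> topspace Z \<rightarrow> characters limit"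
    and cont: "\<And>i f. i \<ge> 1 \<Longrightarrow> continuous_map (K i) euclidean f \<Longrightarrow>
      continuous_map Z euclidean (\<lambda>z. F z (\<phi> i f))"
  shows "continuous_map Z (spectrum_top limit) F"
  unfolding spectrum_top_def continuous_map_in_subtopology continuous_map_componentwise
proof (intro conjI ballI)
  show "F ` topspace Z \<subseteq> extensional limit"
    using F by (auto simp: characters_def)
  show "F \<in> topspace Z \<rightarrow> characters limit" by (rule F)
  fix a assume a: "a \<in> limit"
  show "continuous_map Z euclidean (\<lambda>z. F z a)"
    unfolding continuous_map_euclidean_iff
  proof (intro ballI tendstoI)
    fix z and e :: real assume z: "z \<in> topspace Z" and e: "e > 0"
    have e3: "e / 3 > 0" using e by simp
    obtain i f where f: "i \<ge> 1" "continuous_map (K i) euclidean f" "norm (a - \<phi> i f) < e / 3"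
      using limit_approx[OF a e3] by metis
    have near: "dist (F w a) (F w (\<phi> i f)) < e / 3" if "w \<in> topspace Z" for w
    proof -
      have w: "F w \<in> characters limit" using F that by auto
      have "a - \<phi> i f \<in> limit" by (intro limit_closed a limitI f)
      from character_le_norm[OF w subalgebra_limit closed_limit this] f(3) show ?thesis
        using a limitI[OF f(1,2)] by (simp add: characterD[OF w subalgebra_limit] dist_norm)
    qed
    have "((\<lambda>w. F w (\<phi> i f)) \<longlongrightarrow> F z (\<phi> i f)) (atin Z z)"
      using cont[OF f(1,2)] z by (simp add: continuous_map_euclidean_iff)
    then have "\<forall>\<^sub>F w in atin Z z. dist (F w (\<phi> i f)) (F z (\<phi> i f)) < e / 3"
      using e by (intro tendstoD) auto
    moreover have "\<forall>\<^sub>F w in atin Z z. w \<in> topspace Z"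
      using z by (auto simp: eventually_atin intro!: exI[of _ "topspace Z"])
    ultimately show "\<forall>\<^sub>F w in atin Z z. dist (F w a) (F z a) < e"
    proof eventually_elim
      case (elim w)
      show ?case using near[OF elim(2)] near[OF z] elim(1) by metric
    qed
  qed
qed

end


section \<open>The finite levels\<close>

text \<open>With blocks of equal size, row \<open>r\<close> lies in block \<open>r div k\<close> at
  position \<open>r mod k\<close>. The same arithmetic later splits an index of one level into an
  edge and an index of the level below.\<close>

lemma diag_block_mat_blocks:
  assumes "\<And>A. A \<in> set As \<Longrightarrow> A \<in> carrier_mat k k" "k > 0"
  shows "diag_block_mat As = mat (length As * k) (length As * k)
    (\<lambda>(r, s). if r div k = s div k then (As ! (r div k)) $$ (r mod k, s mod k) else 0)"
  using assms(1)
proof (induction As)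
  case Nil
  then show ?case by auto
next
  case (Cons A As)
  define B where "B = diag_block_mat As"
  have B: "B = mat (length As * k) (length As * k)
    (\<lambda>(r, s). if r div k = s div k then (As ! (r div k)) $$ (r mod k, s mod k) else 0)"
    unfolding B_def using Cons by simp
  have A: "dim_row A = k" "dim_col A = k" using Cons(2)[of A] by auto
  have dB: "dim_row B = length As * k" "dim_col B = length As * k" by (simp_all add: B)
  have dv: "r div k = Suc ((r - k) div k) \<and> r mod k = (r - k) mod k" if "\<not> r < k" for r
    using that assms(2) by (simp add: le_div_geq le_mod_geq)
  show ?case
    unfolding diag_block_mat.simps Let_def B_def[symmetric]
  proof (rule eq_matI)
    fix r s
    assume "r < dim_row (mat (length (A # As) * k) (length (A # As) * k)
        (\<lambda>(r, s). if r div k = s div k then ((A # As) ! (r div k)) $$ (r mod k, s mod k) else (0::'a)))"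
      "s < dim_col (mat (length (A # As) * k) (length (A # As) * k)
        (\<lambda>(r, s). if r div k = s div k then ((A # As) ! (r div k)) $$ (r mod k, s mod k) else (0::'a)))"
    then have rs: "r < k + length As * k" "s < k + length As * k" by auto
    show "four_block_mat A (0\<^sub>m (dim_row A) (dim_col B)) (0\<^sub>m (dim_row B) (dim_col A)) B $$ (r, s) =
      mat (length (A # As) * k) (length (A # As) * k)
        (\<lambda>(r, s). if r div k = s div k then ((A # As) ! (r div k)) $$ (r mod k, s mod k) else 0) $$ (r, s)"
    proof (cases "r < k"; cases "s < k")
      assume "\<not> r < k" "\<not> s < k"
      then show ?thesis using rs dv[of r] dv[of s]
        by (simp add: A dB) (simp add: B)
    qed (use rs dv[of r] dv[of s] in \<open>simp_all add: A dB\<close>)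
  qed (simp_all add: A dB)
qed

lemma sum_delta_mult:
  fixes h :: "nat \<Rightarrow> 'b::semiring_0"
  shows "a < n \<Longrightarrow> (\<Sum>c<n. (if a = c then z else 0) * h c) = z * h a"
  by (subst sum.cong[OF refl, where h = "\<lambda>c. if a = c then z * h c else 0"]) simp_all

lemma continuous_map_prod_discrete_iff:
  "continuous_map (prod_topology Y (discrete_topology S)) Z g \<longleftrightarrow>
     (\<forall>a\<in>S. continuous_map Y Z (\<lambda>y. g (y, a)))"
proof
  assume g: "continuous_map (prod_topology Y (discrete_topology S)) Z g"
  show "\<forall>a\<in>S. continuous_map Y Z (\<lambda>y. g (y, a))"
  proof
    fix a assume "a \<in> S"
    then have "continuous_map Y (prod_topology Y (discrete_topology S)) (\<lambda>y. (y, a))"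
      by (intro continuous_map_pairedI) auto
    from continuous_map_compose[OF this g] show "continuous_map Y Z (\<lambda>y. g (y, a))"
      by (simp add: o_def)
  qed
next
  assume g: "\<forall>a\<in>S. continuous_map Y Z (\<lambda>y. g (y, a))"
  show "continuous_map (prod_topology Y (discrete_topology S)) Z g"
    unfolding continuous_map_def
  proof (intro conjI allI impI)
    show "g \<in> topspace (prod_topology Y (discrete_topology S)) \<rightarrow> topspace Z"
      using g by (auto simp: continuous_map_def)
    fix U assume U: "openin Z U"
    have "{x \<in> topspace (prod_topology Y (discrete_topology S)). g x \<in> U} =
        (\<Union>a\<in>S. {y \<in> topspace Y. g (y, a) \<in> U} \<times> {a})" by auto
    moreover have "openin (prod_topology Y (discrete_topology S)) ({y \<in> topspace Y. g (y, a) \<in> U} \<times> {a})"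
      if "a \<in> S" for a
      using openin_continuous_map_preimage[of Y Z "\<lambda>y. g (y, a)" U] g U that
      by (simp add: openin_prod_Times_iff)
    ultimately show "openin (prod_topology Y (discrete_topology S))
        {x \<in> topspace (prod_topology Y (discrete_topology S)). g x \<in> U}"
      by (auto intro!: openin_Union)
  qed
qed

locale villadsen_limit =
  fixes V :: "'x villadsen"
    and \<Phi> :: "nat \<Rightarrow> ((nat \<Rightarrow> 'x) \<Rightarrow> complex mat) \<Rightarrow> 'a::unital_cstar_algebra"
  assumes data: "villadsen_data V" and lim: "is_inductive_limit V \<Phi>"
begin

abbreviation X :: "'x topology" where "X \<equiv> base_space V"
abbreviation k :: "nat \<Rightarrow> nat" where "k \<equiv> vk V"
abbreviation pts :: "nat \<Rightarrow> (nat \<Rightarrow> 'x) set" where "pts \<equiv> level_points V"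
abbreviation Y :: "nat \<Rightarrow> (nat \<Rightarrow> 'x) topology" where "Y i \<equiv> power_top X (vn V i)"

lemma X: "compact_space X" "Hausdorff_space X" "topspace X \<noteq> {}"
  using data by (auto simp: villadsen_data_def)

lemma k_pos: "i \<ge> 1 \<Longrightarrow> k i > 0"
  using data by (auto simp: villadsen_data_def)

lemma k_Suc: "i \<ge> 1 \<Longrightarrow> k (Suc i) = k i * (vp V i + vq V i)"
  using data by (auto simp: villadsen_data_def)

lemma n_pos: "i \<ge> 1 \<Longrightarrow> vn V i > 0"
  using data by (auto simp: villadsen_data_def)

lemma k_dvd:
  assumes "n \<ge> 1" "n \<le> j"
  shows "k n dvd k j"
  using assms(2)
proof (induction j rule: dec_induct)
  case (step j)
  then show ?case using assms(1) k_Suc[of j] by (simp add: dvd_mult2)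
qed simp

lemma proj_bound:
  assumes "i \<ge> 1" "s < vp V i" "j < vn V i"
  shows "proj_comp V i s * vn V i + j < vn V (Suc i)"
proof -
  have "vn V i dvd vn V (Suc i)" "proj_comp V i s < vn V (Suc i) div vn V i"
    using data assms by (auto simp: villadsen_data_def)
  then obtain m where m: "vn V (Suc i) = vn V i * m" by blast
  with \<open>proj_comp V i s < _\<close> n_pos[OF assms(1)] have "proj_comp V i s < m" by simp
  then have "Suc (proj_comp V i s) * vn V i \<le> m * vn V i" by (intro mult_le_mono1) simp
  with assms(3) m show ?thesis by (simp add: mult.commute)
qed

lemma continuous_eigenfun:
  assumes "i \<ge> 1" "e < vp V i + vq V i"
  shows "continuous_map (Y (Suc i)) (Y i) (eigenfun V i e)"
proof (cases "e < vp V i")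
  case True
  have "continuous_map (Y (Suc i)) X (\<lambda>y. y (proj_comp V i e * vn V i + j))" if "j < vn V i" for j
    unfolding power_top_def
    by (rule continuous_map_product_projection) (use proj_bound[OF assms(1) True that] in simp)
  with True show ?thesis
    by (simp add: eigenfun_def[abs_def] power_top_def continuous_map_componentwise image_subset_iff)
next
  case False
  have "const_val V i (e - vp V i) \<in> topspace (Y i)"
    using data assms False by (auto simp: villadsen_data_def)
  with False show ?thesis by (simp add: eigenfun_def[abs_def])
qed

lemma eigenfun_in_pts: "i \<ge> 1 \<Longrightarrow> e < vp V i + vq V i \<Longrightarrow> y \<in> pts (Suc i) \<Longrightarrow> eigenfun V i e y \<in> pts i"
  using continuous_map_funspace[OF continuous_eigenfun, of i e] by auto

lemma block_bound: "i \<ge> 1 \<Longrightarrow> r < k (Suc i) \<Longrightarrow> r div k i < vp V i + vq V i"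
  using k_pos[of i] by (simp add: k_Suc div_less_iff_less_mult mult.commute)

text \<open>Elements of a level are handled as functions of a point and two indices. Values at
  indices from \<open>k i\<close> on are cut off, so equalities and continuity are only ever
  required below \<open>k i\<close>.\<close>

definition entry_fun :: "nat \<Rightarrow> ((nat \<Rightarrow> 'x) \<Rightarrow> nat \<Rightarrow> nat \<Rightarrow> complex) \<Rightarrow> (nat \<Rightarrow> 'x) \<Rightarrow> complex mat" where
  "entry_fun i F = (\<lambda>y\<in>pts i. mat (k i) (k i) (\<lambda>(a, b). F y a b))"

definition cont_entries :: "nat \<Rightarrow> ((nat \<Rightarrow> 'x) \<Rightarrow> nat \<Rightarrow> nat \<Rightarrow> complex) \<Rightarrow> bool" where
  "cont_entries i F \<longleftrightarrow> (\<forall>a<k i. \<forall>b<k i. continuous_map (Y i) euclidean (\<lambda>y. F y a b))"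

definition \<Psi> :: "nat \<Rightarrow> ((nat \<Rightarrow> 'x) \<Rightarrow> nat \<Rightarrow> nat \<Rightarrow> complex) \<Rightarrow> 'a" where
  "\<Psi> i F = \<Phi> i (entry_fun i F)"

lemma entry_fun_cong:
  "(\<And>y a b. y \<in> pts i \<Longrightarrow> a < k i \<Longrightarrow> b < k i \<Longrightarrow> F y a b = G y a b) \<Longrightarrow> entry_fun i F = entry_fun i G"
  by (auto simp: entry_fun_def fun_eq_iff intro!: eq_matI)

lemma \<Psi>_cong:
  "(\<And>y a b. y \<in> pts i \<Longrightarrow> a < k i \<Longrightarrow> b < k i \<Longrightarrow> F y a b = G y a b) \<Longrightarrow> \<Psi> i F = \<Psi> i G"
  unfolding \<Psi>_def by (rule arg_cong[OF entry_fun_cong])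

lemma entry_fun_in_level_algebra [simp]:
  assumes "cont_entries i F"
  shows "entry_fun i F \<in> level_algebra V i"
proof -
  have "continuous_map (Y i) euclidean (\<lambda>y. entry_fun i F y $$ (a, b))" if "a < k i" "b < k i" for a b
  proof (rule continuous_map_eq)
    show "continuous_map (Y i) euclidean (\<lambda>y. F y a b)" using assms that by (simp add: cont_entries_def)
  qed (use that in \<open>simp add: entry_fun_def\<close>)
  then show ?thesis by (auto simp: level_algebra_def entry_fun_def)
qed

lemma level_algebra_entries:
  assumes "f \<in> level_algebra V i"
  shows "cont_entries i (\<lambda>y a b. f y $$ (a, b))" "f = entry_fun i (\<lambda>y a b. f y $$ (a, b))"
proof -
  show "cont_entries i (\<lambda>y a b. f y $$ (a, b))"
    using assms by (auto simp: level_algebra_def cont_entries_def)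
  have f: "f \<in> pts i \<rightarrow>\<^sub>E carrier_mat (k i) (k i)" using assms by (simp add: level_algebra_def)
  show "f = entry_fun i (\<lambda>y a b. f y $$ (a, b))"
  proof
    fix y show "f y = entry_fun i (\<lambda>y a b. f y $$ (a, b)) y"
    proof (cases "y \<in> pts i")
      case True
      then have "f y \<in> carrier_mat (k i) (k i)" using f by auto
      with True show ?thesis by (auto simp: entry_fun_def intro!: eq_matI)
    next
      case False
      then show ?thesis using f by (auto simp: entry_fun_def)
    qed
  qed
qed

lemma hom: "i \<ge> 1 \<Longrightarrow> level_star_hom V i (\<Phi> i)"
  and hom_inj: "i \<ge> 1 \<Longrightarrow> inj_on (\<Phi> i) (level_algebra V i)"
  and hom_compat: "i \<ge> 1 \<Longrightarrow> f \<in> level_algebra V i \<Longrightarrow> \<Phi> (Suc i) (connecting_map V i f) = \<Phi> i f"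
  and dense: "closure (\<Union>i\<in>{1..}. \<Phi> i ` level_algebra V i) = UNIV"
  using lim by (auto simp: is_inductive_limit_def)

lemma cont_entries_mult:
  "cont_entries i F \<Longrightarrow> cont_entries i G \<Longrightarrow> cont_entries i (\<lambda>y a b. \<Sum>c<k i. F y a c * G y c b)"
  by (auto simp: cont_entries_def continuous_map_euclidean_iff intro!: tendsto_sum tendsto_mult)

lemma cont_entries_const [simp]: "cont_entries i (\<lambda>y. F)"
  by (simp add: cont_entries_def)

lemma \<Psi>_add:
  assumes "i \<ge> 1" "cont_entries i F" "cont_entries i G"
  shows "\<Psi> i (\<lambda>y a b. F y a b + G y a b) = \<Psi> i F + \<Psi> i G"
proof -
  have "entry_fun i (\<lambda>y a b. F y a b + G y a b) = (\<lambda>y\<in>pts i. entry_fun i F y + entry_fun i G y)"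
    by (auto simp: entry_fun_def fun_eq_iff intro!: eq_matI)
  then show ?thesis
    using hom[OF assms(1)] assms(2,3) by (simp add: \<Psi>_def level_star_hom_def)
qed

lemma \<Psi>_mult:
  assumes "i \<ge> 1" "cont_entries i F" "cont_entries i G"
  shows "\<Psi> i (\<lambda>y a b. \<Sum>c<k i. F y a c * G y c b) = \<Psi> i F * \<Psi> i G"
proof -
  have "entry_fun i (\<lambda>y a b. \<Sum>c<k i. F y a c * G y c b) = (\<lambda>y\<in>pts i. entry_fun i F y * entry_fun i G y)"
    by (auto simp: entry_fun_def fun_eq_iff scalar_prod_def atLeast0LessThan intro!: eq_matI sum.cong)
  then show ?thesis
    using hom[OF assms(1)] assms(2,3) by (simp add: \<Psi>_def level_star_hom_def)
qed

lemma \<Psi>_scale: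
  assumes "i \<ge> 1" "cont_entries i F"
  shows "\<Psi> i (\<lambda>y a b. z * F y a b) = scaleC z (\<Psi> i F)"
proof -
  have "entry_fun i (\<lambda>y a b. z * F y a b) = (\<lambda>y\<in>pts i. z \<cdot>\<^sub>m entry_fun i F y)"
    by (auto simp: entry_fun_def fun_eq_iff intro!: eq_matI)
  then show ?thesis
    using hom[OF assms(1)] assms(2) by (simp add: \<Psi>_def level_star_hom_def)
qed

lemma \<Psi>_star:
  assumes "i \<ge> 1" "cont_entries i F"
  shows "\<Psi> i (\<lambda>y a b. cnj (F y b a)) = star (\<Psi> i F)"
proof -
  have "entry_fun i (\<lambda>y a b. cnj (F y b a)) = (\<lambda>y\<in>pts i. map_mat cnj (transpose_mat (entry_fun i F y)))"
    by (auto simp: entry_fun_def fun_eq_iff intro!: eq_matI)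
  then show ?thesis
    using hom[OF assms(1)] assms(2) by (simp add: \<Psi>_def level_star_hom_def)
qed

lemma \<Psi>_one:
  assumes "i \<ge> 1"
  shows "\<Psi> i (\<lambda>y a b. if a = b then 1 else 0) = 1"
proof -
  have "entry_fun i (\<lambda>y a b. if a = b then 1 else 0) = (\<lambda>y\<in>pts i. 1\<^sub>m (k i))"
    by (auto simp: entry_fun_def fun_eq_iff intro!: eq_matI)
  then show ?thesis
    using hom[OF assms(1)] by (simp add: \<Psi>_def level_star_hom_def)
qed

lemma \<Psi>_zero:
  assumes "i \<ge> 1"
  shows "\<Psi> i (\<lambda>y a b. 0) = 0"
  using \<Psi>_scale[OF assms, of "\<lambda>y a b. 0" 0] by simp

lemma \<Psi>_eq_0D:
  assumes "i \<ge> 1" "cont_entries i F" "\<Psi> i F = 0" "y \<in> pts i" "a < k i" "b < k i"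
  shows "F y a b = 0"
proof -
  have "\<Phi> i (entry_fun i F) = \<Phi> i (entry_fun i (\<lambda>y a b. 0))"
    using assms(3) \<Psi>_zero[OF assms(1)] by (simp add: \<Psi>_def)
  then have "entry_fun i F = entry_fun i (\<lambda>y a b. 0)"
    by (rule inj_onD[OF hom_inj[OF assms(1)]]) (simp_all add: assms)
  from fun_cong[OF this, of y] have "mat (k i) (k i) (\<lambda>(a, b). F y a b) $$ (a, b) = mat (k i) (k i) (\<lambda>(a, b). 0) $$ (a, b)"
    using assms(4) by (simp add: entry_fun_def)
  then show ?thesis using assms(5,6) by simp
qed

lemma \<Psi>_compat:
  assumes "i \<ge> 1" "cont_entries i F"
  shows "\<Psi> (Suc i) (\<lambda>y r s. if r div k i = s div k i
      then F (eigenfun V i (r div k i) y) (r mod k i) (s mod k i) else 0) = \<Psi> i F"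
proof -
  have "connecting_map V i (entry_fun i F) = entry_fun (Suc i) (\<lambda>y r s. if r div k i = s div k i
      then F (eigenfun V i (r div k i) y) (r mod k i) (s mod k i) else 0)"
  proof
    fix y
    show "connecting_map V i (entry_fun i F) y = entry_fun (Suc i) (\<lambda>y r s. if r div k i = s div k i
      then F (eigenfun V i (r div k i) y) (r mod k i) (s mod k i) else 0) y"
    proof (cases "y \<in> pts (Suc i)")
      case True
      let ?As = "map (\<lambda>e. entry_fun i F (eigenfun V i e y)) [0..<vp V i + vq V i]"
      have "diag_block_mat ?As = mat (length ?As * k i) (length ?As * k i)
        (\<lambda>(r, s). if r div k i = s div k i then (?As ! (r div k i)) $$ (r mod k i, s mod k i) else 0)"
      proof (rule diag_block_mat_blocks)
        fix A assume "A \<in> set ?As"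
        then show "A \<in> carrier_mat (k i) (k i)"
          using True eigenfun_in_pts[OF assms(1)] by (auto simp: entry_fun_def)
      qed (rule k_pos[OF assms(1)])
      also have "length ?As * k i = k (Suc i)" by (simp add: k_Suc[OF assms(1)] mult.commute)
      also have "mat (k (Suc i)) (k (Suc i))
        (\<lambda>(r, s). if r div k i = s div k i then (?As ! (r div k i)) $$ (r mod k i, s mod k i) else 0) =
        mat (k (Suc i)) (k (Suc i)) (\<lambda>(r, s). if r div k i = s div k i
        then F (eigenfun V i (r div k i) y) (r mod k i) (s mod k i) else 0)"
        using k_pos[OF assms(1)] eigenfun_in_pts[OF assms(1) _ True] block_bound[OF assms(1)]
        by (intro cong_mat) (auto simp: entry_fun_def)
      finally show ?thesis using True by (simp add: connecting_map_def entry_fun_def)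
    qed (simp add: connecting_map_def entry_fun_def)
  qed
  then show ?thesis using hom_compat[OF assms(1), of "entry_fun i F"] assms(2) by (simp add: \<Psi>_def)
qed

section \<open>The diagonal of a level as functions on its spectrum\<close>

definition level_space :: "nat \<Rightarrow> ((nat \<Rightarrow> 'x) \<times> nat) topology" where
  "level_space i = prod_topology (Y i) (discrete_topology {..<k i})"

text \<open>The map of spectra dual to the connecting map on diagonal matrices: an index
  \<open>a\<close> of level \<open>i + 1\<close> is the edge \<open>a div k i\<close> appended to
  the index \<open>a mod k i\<close>.\<close>

definition level_map :: "nat \<Rightarrow> (nat \<Rightarrow> 'x) \<times> nat \<Rightarrow> (nat \<Rightarrow> 'x) \<times> nat" where
  "level_map i = (\<lambda>(y, a). (eigenfun V i (a div k i) y, a mod k i))"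

definition diag :: "nat \<Rightarrow> ((nat \<Rightarrow> 'x) \<times> nat \<Rightarrow> complex) \<Rightarrow> 'a" where
  "diag i g = \<Psi> i (\<lambda>y a b. if a = b then g (y, a) else 0)"

lemma topspace_level_space: "topspace (level_space i) = pts i \<times> {..<k i}"
  by (simp add: level_space_def)

lemma cont_entries_diag:
  "continuous_map (level_space i) euclidean g \<Longrightarrow> cont_entries i (\<lambda>y a b. if a = b then g (y, a) else 0)"
  by (auto simp: level_space_def continuous_map_prod_discrete_iff cont_entries_def)

lemma function_rep_diag:
  assumes i: "i \<ge> 1"
  shows "function_rep (level_space i) (diag i)"
proof
  have YX: "compact_space (Y i)" "Hausdorff_space (Y i)"
    by (simp_all add: power_top_def compact_space_product_topology Hausdorff_space_product_topology X)
  show "compact_space (level_space i)" "Hausdorff_space (level_space i)"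
    using YX by (simp_all add: level_space_def compact_space_prod_topology Hausdorff_space_prod_topology
        compact_space_discrete_topology Hausdorff_space_discrete_topology)
  show "diag i f = diag i g" if "\<And>x. x \<in> topspace (level_space i) \<Longrightarrow> f x = g x" for f g
    unfolding diag_def by (rule \<Psi>_cong) (use that in \<open>simp add: topspace_level_space\<close>)
  show "diag i (\<lambda>x. 1) = 1" using \<Psi>_one[OF i] by (simp add: diag_def)
  fix f :: "(nat \<Rightarrow> 'x) \<times> nat \<Rightarrow> complex" assume f: "continuous_map (level_space i) euclidean f"
  show "diag i (\<lambda>x. z * f x) = scaleC z (diag i f)" for z
    unfolding diag_def \<Psi>_scale[OF i cont_entries_diag[OF f], symmetric]
    by (rule \<Psi>_cong) simp
  show "diag i (\<lambda>x. cnj (f x)) = star (diag i f)"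
    unfolding diag_def \<Psi>_star[OF i cont_entries_diag[OF f], symmetric]
    by (rule \<Psi>_cong) simp
  show "f x = 0" if "diag i f = 0" "x \<in> topspace (level_space i)" for x
    using \<Psi>_eq_0D[OF i cont_entries_diag[OF f], of "fst x" "snd x" "snd x"] that
    by (auto simp: diag_def topspace_level_space)
  fix g :: "(nat \<Rightarrow> 'x) \<times> nat \<Rightarrow> complex" assume g: "continuous_map (level_space i) euclidean g"
  show "diag i (\<lambda>x. f x + g x) = diag i f + diag i g"
    unfolding diag_def \<Psi>_add[OF i cont_entries_diag[OF f] cont_entries_diag[OF g], symmetric]
    by (rule \<Psi>_cong) simp
  show "diag i (\<lambda>x. f x * g x) = diag i f * diag i g"
    unfolding diag_def \<Psi>_mult[OF i cont_entries_diag[OF f] cont_entries_diag[OF g], symmetric]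
    by (rule \<Psi>_cong) (simp add: sum_delta_mult)
qed

lemma continuous_level_map:
  assumes i: "i \<ge> 1"
  shows "continuous_map (level_space (Suc i)) (level_space i) (level_map i)"
  unfolding level_space_def continuous_map_prod_discrete_iff
proof
  fix a assume "a \<in> {..<k (Suc i)}"
  then show "continuous_map (Y (Suc i)) (prod_topology (Y i) (discrete_topology {..<k i}))
      (\<lambda>y. level_map i (y, a))"
    using continuous_eigenfun[OF i block_bound[OF i]] k_pos[OF i] unfolding level_map_def prod.case
    by (intro continuous_map_pairedI) auto
qed

sublocale tower level_space level_map diag
proof (rule tower.intro)
  fix i :: nat assume i: "i \<ge> 1"
  show "function_rep (level_space i) (diag i)" by (rule function_rep_diag[OF i])
  show "continuous_map (level_space (Suc i)) (level_space i) (level_map i)"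
    by (rule continuous_level_map[OF i])
  fix f :: "(nat \<Rightarrow> 'x) \<times> nat \<Rightarrow> complex" assume f: "continuous_map (level_space i) euclidean f"
  show "diag (Suc i) (f \<circ> level_map i) = diag i f"
    unfolding diag_def \<Psi>_compat[OF i cont_entries_diag[OF f], symmetric]
    by (rule \<Psi>_cong) (auto simp: level_map_def, metis div_mult_mod_eq)
qed

lemma canonical_diagonal_eq: "canonical_diagonal V \<Phi> = limit"
proof -
  have "\<Phi> i ` {f \<in> level_algebra V i. \<forall>y\<in>pts i. diagonal_mat (f y)} =
      diag i ` {f. continuous_map (level_space i) euclidean f}" if i: "i \<ge> 1" for i
  proof (intro equalityI subsetI)
    fix c assume "c \<in> \<Phi> i ` {f \<in> level_algebra V i. \<forall>y\<in>pts i. diagonal_mat (f y)}"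
    then obtain f where f: "f \<in> level_algebra V i" "\<And>y. y \<in> pts i \<Longrightarrow> diagonal_mat (f y)" "c = \<Phi> i f"
      by blast
    define g where "g = (\<lambda>(y, a). f y $$ (a, a))"
    have "continuous_map (level_space i) euclidean g"
      using f(1) by (auto simp: level_space_def continuous_map_prod_discrete_iff g_def level_algebra_def)
    moreover have "c = diag i g"
    proof -
      have "c = \<Psi> i (\<lambda>y a b. f y $$ (a, b))"
        unfolding \<Psi>_def f(3) using level_algebra_entries(2)[OF f(1)] by simp
      also have "\<dots> = diag i g"
        unfolding diag_def
      proof (rule \<Psi>_cong)
        fix y a b assume y: "y \<in> pts i" "a < k i" "b < k i"
        then have "f y \<in> carrier_mat (k i) (k i)" using f(1) by (auto simp: level_algebra_def)
        with f(2)[OF y(1)] y show "f y $$ (a, b) = (if a = b then g (y, a) else 0)"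
          by (auto simp: diagonal_mat_def g_def)
      qed
      finally show ?thesis .
    qed
    ultimately show "c \<in> diag i ` {f. continuous_map (level_space i) euclidean f}" by blast
  next
    fix c assume "c \<in> diag i ` {f. continuous_map (level_space i) euclidean f}"
    then obtain g where g: "continuous_map (level_space i) euclidean g" "c = diag i g" by blast
    have "c = \<Phi> i (entry_fun i (\<lambda>y a b. if a = b then g (y, a) else 0))"
      by (simp add: g diag_def \<Psi>_def)
    moreover have "diagonal_mat (entry_fun i (\<lambda>y a b. if a = b then g (y, a) else 0) y)" if "y \<in> pts i" for y
      using that by (simp add: entry_fun_def diagonal_mat_def)
    ultimately show "c \<in> \<Phi> i ` {f \<in> level_algebra V i. \<forall>y\<in>pts i. diagonal_mat (f y)}"
      using entry_fun_in_level_algebra[OF cont_entries_diag[OF g(1)]] by blast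
  qed
  then show ?thesis unfolding canonical_diagonal_def limit_def levels_def by simp
qed

end


section \<open>Matrix units\<close>

text \<open>Read in mixed radix, the digits above \<open>n\<close> are those above \<open>l\<close>
  together with those between \<open>n\<close> and \<open>l\<close>. This combines the block
  conditions of successive levels.\<close>

lemma div_eq_iff_div_mod_eq:
  fixes r s :: nat
  assumes "n dvd l" "n > 0"
  shows "r div n = s div n \<longleftrightarrow> r div l = s div l \<and> (r mod l) div n = (s mod l) div n"
proof -
  obtain m where m: "l = n * m" using assms(1) by blast
  have d: "t div l = (t div n) div m" for t by (simp add: m div_mult2_eq)
  have e: "(t mod l) div n = (t div n) mod m" for t
    using assms(2) by (simp add: m mod_mult2_eq)
  show ?thesis unfolding d e by (metis div_mult_mod_eq)
qed

context villadsen_limit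
begin

definition munit :: "nat \<Rightarrow> nat \<Rightarrow> nat \<Rightarrow> 'a" where
  "munit n a b = \<Psi> n (\<lambda>y r s. if r = a \<and> s = b then 1 else 0)"

text \<open>A constant matrix is unchanged by composition with eigenfunctions, so each connecting
  map just repeats it along the diagonal. The quotients by \<open>k n\<close> encode the edges
  between the two levels, which must coincide.\<close>

lemma munit_lift:
  assumes n: "n \<ge> 1" and "n \<le> j" and ab: "a < k n" "b < k n"
  shows "munit n a b = \<Psi> j (\<lambda>y r s. if r mod k n = a \<and> s mod k n = b \<and> r div k n = s div k n then 1 else 0)"
  using assms(2)
proof (induction j rule: dec_induct)
  case base
  show ?case unfolding munit_def by (rule \<Psi>_cong) auto
next
  case (step j)
  have j: "j \<ge> 1" using step n by simp
  have dvd: "k n dvd k j" using step n k_dvd by simp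
  note eq = div_eq_iff_div_mod_eq[OF dvd k_pos[OF n]]
  show ?case
    unfolding step(3) \<Psi>_compat[OF j cont_entries_const, symmetric]
  proof (rule \<Psi>_cong)
    fix y and r s :: nat
    show "(if r div k j = s div k j then if (r mod k j) mod k n = a \<and> (s mod k j) mod k n = b \<and>
        (r mod k j) div k n = (s mod k j) div k n then 1 else 0 else 0) =
      (if r mod k n = a \<and> s mod k n = b \<and> r div k n = s div k n then 1 else (0::complex))"
      using eq[of r s] by (simp add: mod_mod_cancel[OF dvd])
  qed
qed

lemma munit_mult:
  assumes "n \<ge> 1" "b < k n"
  shows "munit n a b * munit n c d = (if b = c then munit n a d else 0)"
proof -
  have "munit n a b * munit n c d =
      \<Psi> n (\<lambda>y r s. \<Sum>t<k n. (if r = a \<and> t = b then 1 else 0) * (if t = c \<and> s = d then 1 else 0))"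
    unfolding munit_def by (rule \<Psi>_mult[OF assms(1), symmetric]) simp_all
  also have "\<dots> = \<Psi> n (\<lambda>y r s. if b = c then (if r = a \<and> s = d then 1 else 0) else 0)"
  proof (rule \<Psi>_cong)
    fix r s
    have "(\<Sum>t<k n. (if r = a \<and> t = b then 1 else 0) * (if t = c \<and> s = d then 1 else 0)) =
        (\<Sum>t<k n. (if b = t then (if r = a then 1 else 0) else 0) * (if t = c \<and> s = d then 1 else (0::complex)))"
      by (intro sum.cong) auto
    then show "(\<Sum>t<k n. (if r = a \<and> t = b then 1 else 0) * (if t = c \<and> s = d then 1 else 0)) =
        (if b = c then (if r = a \<and> s = d then 1 else 0) else (0::complex))"
      unfolding sum_delta_mult[OF assms(2)] by auto
  qed
  also have "\<dots> = (if b = c then munit n a d else 0)"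
    using \<Psi>_zero[OF assms(1)] by (simp add: munit_def)
  finally show ?thesis .
qed

lemma star_munit:
  assumes "n \<ge> 1"
  shows "star (munit n a b) = munit n b a"
  unfolding munit_def by (subst \<Psi>_star[OF assms, symmetric], simp) (rule \<Psi>_cong, auto)

lemma munit_eq_diag: "munit n a a = diag n (\<lambda>x. if snd x = a then 1 else 0)"
  unfolding munit_def diag_def by (rule \<Psi>_cong) auto

lemma continuous_snd_eq:
  "continuous_map (level_space n) euclidean (\<lambda>x. if snd x = a then 1 else (0::complex))"
  by (simp add: level_space_def continuous_map_prod_discrete_iff)

lemma munit_in_limit: "n \<ge> 1 \<Longrightarrow> munit n a a \<in> limit"
  unfolding munit_eq_diag by (rule limitI[OF _ continuous_snd_eq])

lemma \<Psi>_diagonal_in_limit: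
  assumes "j \<ge> 1" "cont_entries j G"
    and "\<And>y r s. r < k j \<Longrightarrow> s < k j \<Longrightarrow> r \<noteq> s \<Longrightarrow> G y r s = 0"
  shows "\<Psi> j G \<in> limit"
proof -
  have "continuous_map (level_space j) euclidean (\<lambda>(y, r). G y r r)"
    using assms(2) by (simp add: level_space_def continuous_map_prod_discrete_iff cont_entries_def)
  from limitI[OF assms(1) this] show ?thesis
    unfolding diag_def by (subst \<Psi>_cong[where F = G]) (use assms(3) in auto)
qed

text \<open>At a common level the conjugated matrix is diagonal again, because a matrix unit of a
  lower level only moves entries between positions with the same higher edges; closedness of
  \<open>limit\<close> extends this from the levels.\<close>

lemma munit_conj_in_limit:
  assumes n: "n \<ge> 1" and ab: "a < k n" "b < k n" and c: "c \<in> limit"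
  shows "munit n b a * c * munit n a b \<in> limit"
proof -
  have lev: "munit n b a * c * munit n a b \<in> limit" if c: "c \<in> levels" for c
  proof -
    obtain i f where i: "i \<ge> 1" "continuous_map (level_space i) euclidean f" "c = diag i f"
      using c by (auto simp: levels_def)
    define j where "j = max i n"
    have j: "j \<ge> 1" "i \<le> j" "n \<le> j" using i by (auto simp: j_def)
    obtain g where g: "continuous_map (level_space j) euclidean g" "diag j g = c"
      using lift[OF i(1) j(2) i(2)] i(3) by blast
    define U :: "nat \<Rightarrow> nat \<Rightarrow> (nat \<Rightarrow> 'x) \<Rightarrow> nat \<Rightarrow> nat \<Rightarrow> complex" where
      "U a b = (\<lambda>y r s. if r mod k n = a \<and> s mod k n = b \<and> r div k n = s div k n then 1 else 0)" for a b
    define D where "D = (\<lambda>y r s. if r = s then g (y, r) else 0)"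
    have U: "cont_entries j (U a b)" for a b unfolding U_def by (rule cont_entries_const)
    have D: "cont_entries j D" unfolding D_def by (rule cont_entries_diag[OF g(1)])
    note UD = cont_entries_mult[OF U[of b a] D]
    have "munit n b a * c * munit n a b = \<Psi> j (U b a) * \<Psi> j D * \<Psi> j (U a b)"
      using munit_lift[OF n j(3)] ab g(2) by (simp add: U_def D_def diag_def)
    also have "\<dots> = \<Psi> j (\<lambda>y r s. \<Sum>u<k j. (\<Sum>t<k j. U b a y r t * D y t u) * U a b y u s)"
      by (simp only: \<Psi>_mult[OF j(1) U D, symmetric] \<Psi>_mult[OF j(1) UD U, symmetric])
    also have "\<dots> \<in> limit"
    proof (rule \<Psi>_diagonal_in_limit[OF j(1) cont_entries_mult[OF UD U]])
      fix y and r s :: nat assume "r \<noteq> s"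
      then have "\<not> (r mod k n = s mod k n \<and> r div k n = s div k n)" by (metis div_mult_mod_eq)
      \<comment> \<open>A nonzero product would force \<open>r\<close> and \<open>s\<close> to have
        the same remainder \<open>b\<close> and the same quotient as the middle index, hence to
        coincide.\<close>
      then have z: "U b a y r t * D y t u * U a b y u s = 0" for t u
        by (auto simp: U_def D_def)
      show "(\<Sum>u<k j. (\<Sum>t<k j. U b a y r t * D y t u) * U a b y u s) = 0"
        unfolding sum_distrib_right by (intro sum.neutral ballI z)
    qed
    finally show ?thesis .
  qed
  obtain f where f: "\<And>m::nat. f m \<in> levels" "f \<longlonglongrightarrow> c" using limit_seqE[OF c] by metis
  have "(\<lambda>m. munit n b a * f m * munit n a b) \<longlonglongrightarrow> munit n b a * c * munit n a b"
    by (intro tendsto_mult tendsto_const f(2))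
  with closed_limit lev[OF f(1)] show ?thesis by (rule closed_sequentially)
qed

lemma munit_normaliser:
  assumes "n \<ge> 1" "a < k n" "b < k n"
  shows "munit n a b \<in> normalisers limit"
  using munit_conj_in_limit[OF assms] munit_conj_in_limit[OF assms(1,3,2)]
  by (simp add: normalisers_def star_munit[OF assms(1)])

lemma munit_compress_eq:
  assumes i: "i \<ge> 1" and F: "cont_entries i F" and ab: "a < k i" "b < k i"
  shows "munit i a a * \<Psi> i F * munit i b b = \<Psi> i (\<lambda>y r s. if r = a \<and> s = b then F y a b else 0)"
proof -
  define e :: "nat \<Rightarrow> nat \<Rightarrow> (nat \<Rightarrow> 'x) \<Rightarrow> nat \<Rightarrow> nat \<Rightarrow> complex" where
    "e a b = (\<lambda>y r s. if r = a \<and> s = b then 1 else 0)" for a b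
  have e: "cont_entries i (e a b)" for a b unfolding e_def by (rule cont_entries_const)
  have m: "munit i a b = \<Psi> i (e a b)" for a b by (simp add: munit_def e_def)
  have "munit i a a * \<Psi> i F * munit i b b =
      \<Psi> i (\<lambda>y r s. \<Sum>u<k i. (\<Sum>t<k i. e a a y r t * F y t u) * e b b y u s)"
    unfolding m
    by (simp only: \<Psi>_mult[OF i e F, symmetric] \<Psi>_mult[OF i cont_entries_mult[OF e F] e, symmetric])
  also have "\<dots> = \<Psi> i (\<lambda>y r s. if r = a \<and> s = b then F y a b else 0)"
  proof (rule \<Psi>_cong)
    fix y r s
    have 1: "(\<Sum>t<k i. e a a y r t * F y t u) = (if r = a then F y a u else 0)" for u
    proof -
      have "(\<Sum>t<k i. e a a y r t * F y t u) = (\<Sum>t<k i. (if a = t then (if r = a then 1 else 0) else 0) * F y t u)"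
        by (intro sum.cong) (auto simp: e_def)
      then show ?thesis unfolding sum_delta_mult[OF ab(1)] by simp
    qed
    have "(\<Sum>u<k i. (\<Sum>t<k i. e a a y r t * F y t u) * e b b y u s) =
        (\<Sum>u<k i. (if b = u then (if s = b then 1 else 0) else 0) * (if r = a then F y a u else 0))"
      unfolding 1 by (intro sum.cong) (auto simp: e_def)
    then show "(\<Sum>u<k i. (\<Sum>t<k i. e a a y r t * F y t u) * e b b y u s) = (if r = a \<and> s = b then F y a b else 0)"
      unfolding sum_delta_mult[OF ab(2)] by simp
  qed
  finally show ?thesis .
qed

text \<open>The coefficient \<open>g\<close> is the scalar function \<open>F y a b\<close> on the
  whole diagonal of level \<open>i\<close>. Writing the compressed matrix as an element of
  \<open>limit\<close> times a matrix unit allows its effect on characters to be compared with that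
  of the unit.\<close>

lemma munit_compress:
  assumes i: "i \<ge> 1" and F: "cont_entries i F" and ab: "a < k i" "b < k i"
  shows "\<exists>g\<in>limit. munit i a a * \<Psi> i F * munit i b b = g * munit i a b"
proof
  have c: "continuous_map (level_space i) euclidean (\<lambda>x. F (fst x) a b)"
    using F ab by (simp add: level_space_def continuous_map_prod_discrete_iff cont_entries_def)
  show "diag i (\<lambda>x. F (fst x) a b) \<in> limit" by (rule limitI[OF i c])
  show "munit i a a * \<Psi> i F * munit i b b = diag i (\<lambda>x. F (fst x) a b) * munit i a b"
    unfolding munit_compress_eq[OF i F ab]
    unfolding munit_def diag_def \<Psi>_mult[OF i cont_entries_diag[OF c] cont_entries_const, symmetric]
    by (rule \<Psi>_cong) (auto simp: sum_delta_mult)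
qed

lemma norm_munit_le:
  assumes "n \<ge> 1" "a < k n" "b < k n"
  shows "norm (munit n a b) \<le> 1"
proof -
  have le: "norm (munit n c c) \<le> 1" if "c < k n" for c
  proof -
    have "(norm (munit n c c))\<^sup>2 = norm (munit n c c)"
      using assms(1) that by (simp add: cstar_identity[symmetric] star_munit munit_mult)
    then have "norm (munit n c c) = 0 \<or> norm (munit n c c) = 1" by (simp add: power2_eq_square)
    then show ?thesis by auto
  qed
  have "(norm (munit n a b))\<^sup>2 = norm (munit n b b)"
    using assms by (simp add: cstar_identity[symmetric] star_munit munit_mult)
  then show ?thesis using le[OF assms(3)] power2_le_imp_le[of "norm (munit n a b)" 1] by simp
qed

text \<open>As \<open>a\<close> and \<open>b\<close> have the same edges above level
  \<open>n\<close>, the finer unit is the coarser one cut down by a diagonal projection of level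
  \<open>m\<close>. To a character with value \<open>1\<close> at this projection, conjugation by
  the two looks the same.\<close>

lemma munit_refine:
  assumes n: "n \<ge> 1" "n \<le> m" and ab: "a < k m" "b < k m" "a div k n = b div k n"
  shows "munit m a b = munit n (a mod k n) (b mod k n) * munit m b b"
proof -
  have m: "m \<ge> 1" using n by simp
  have "munit n (a mod k n) (b mod k n) * munit m b b =
    \<Psi> m (\<lambda>y r s. \<Sum>t<k m. (if r mod k n = a mod k n \<and> t mod k n = b mod k n \<and> r div k n = t div k n then 1 else 0) *
       (if t = b \<and> s = b then 1 else 0))"
    unfolding munit_lift[OF n mod_less_divisor[OF k_pos[OF n(1)]] mod_less_divisor[OF k_pos[OF n(1)]]]
    unfolding munit_def
    by (rule \<Psi>_mult[OF m, symmetric]) simp_all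
  also have "\<dots> = \<Psi> m (\<lambda>y r s. if r = a \<and> s = b then 1 else 0)"
  proof (rule \<Psi>_cong)
    fix r s
    have "(\<Sum>t<k m. (if r mod k n = a mod k n \<and> t mod k n = b mod k n \<and> r div k n = t div k n then 1 else 0) *
        (if t = b \<and> s = b then 1 else 0)) =
      (\<Sum>t<k m. (if b = t then (if s = b then 1 else 0) else 0) *
        (if r mod k n = a mod k n \<and> t mod k n = b mod k n \<and> r div k n = t div k n then 1 else (0::complex)))"
      by (intro sum.cong) auto
    also have "\<dots> = (if s = b then 1 else 0) * (if r mod k n = a mod k n \<and> r div k n = a div k n then 1 else 0)"
      unfolding sum_delta_mult[OF ab(2)] ab(3) by simp
    also have "(r mod k n = a mod k n \<and> r div k n = a div k n) = (r = a)" by (metis div_mult_mod_eq)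
    finally show "(\<Sum>t<k m. (if r mod k n = a mod k n \<and> t mod k n = b mod k n \<and> r div k n = t div k n then 1 else 0) *
        (if t = b \<and> s = b then 1 else 0)) = (if r = a \<and> s = b then 1 else (0::complex))" by simp
  qed
  finally show ?thesis unfolding munit_def by simp
qed


section \<open>Paths and threads\<close>

text \<open>The mixed-radix number with digit \<open>x j\<close> at place value \<open>k j\<close>,
  or \<open>1\<close> for \<open>j = 0\<close>. Quotients and remainders by \<open>k n\<close>
  therefore separate the edges from level \<open>n\<close> on from those before.\<close>

definition idx :: "(nat \<Rightarrow> nat) \<Rightarrow> nat \<Rightarrow> nat" where
  "idx x i = path_index V (map x [0..<i])"

lemma idx_eq: "idx x i = (\<Sum>j<i. x j * (if j = 0 then 1 else k j))"
  by (simp add: idx_def path_index_def)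

lemma idx_1: "idx x (Suc 0) = x 0"
  by (simp add: idx_eq)

lemma idx_Suc: "i \<ge> 1 \<Longrightarrow> idx x (Suc i) = x i * k i + idx x i"
  by (simp add: idx_eq)

lemma inf_pathsD:
  assumes "x \<in> inf_paths V"
  shows "x 0 < k 1" "i \<ge> 1 \<Longrightarrow> x i < vp V i + vq V i"
proof -
  have "x i < edge_count V i" for i using assms by (simp add: inf_paths_def)
  from this[of 0] this[of i] show "x 0 < k 1" "i \<ge> 1 \<Longrightarrow> x i < vp V i + vq V i"
    by (simp_all add: edge_count_def)
qed

lemma edge_count_pos: "edge_count V i > 0"
  using data k_pos[of 1] by (auto simp: edge_count_def villadsen_data_def dest!: spec[of _ i])

lemma idx_less:
  assumes "x \<in> inf_paths V" "i \<ge> 1"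
  shows "idx x i < k i"
  using assms(2)
proof (induction i rule: dec_induct)
  case base
  then show ?case using inf_pathsD(1)[OF assms(1)] by (simp add: idx_1)
next
  case (step i)
  then have "idx x (Suc i) < Suc (x i) * k i" by (simp add: idx_Suc)
  also have "\<dots> \<le> (vp V i + vq V i) * k i"
    using inf_pathsD(2)[OF assms(1) step(1)] by (intro mult_le_mono1 Suc_leI)
  finally show ?case using step by (simp add: k_Suc mult.commute)
qed

lemma idx_Suc_div_mod:
  assumes "x \<in> inf_paths V" "i \<ge> 1"
  shows "idx x (Suc i) div k i = x i" "idx x (Suc i) mod k i = idx x i"
proof -
  have "idx x (Suc i) = x i * k i + idx x i" "idx x i < k i"
    using idx_Suc[OF assms(2)] idx_less[OF assms] by simp_all
  then show "idx x (Suc i) div k i = x i" "idx x (Suc i) mod k i = idx x i" by simp_all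
qed

lemma idx_mod:
  assumes "x \<in> inf_paths V" "n \<ge> 1" "n \<le> j"
  shows "idx x j mod k n = idx x n"
  using assms(3)
proof (induction j rule: dec_induct)
  case base
  then show ?case using idx_less[OF assms(1,2)] by simp
next
  case (step j)
  then have "idx x (Suc j) mod k n = (idx x (Suc j) mod k j) mod k n"
    using k_dvd[OF assms(2)] by (simp add: mod_mod_cancel)
  then show ?case using step assms(2) idx_Suc_div_mod(2)[OF assms(1), of j] by simp
qed

lemma idx_div_tail:
  assumes "x \<in> inf_paths V" "z \<in> inf_paths V" "n \<ge> 1" "n \<le> j" "\<And>i. i \<ge> n \<Longrightarrow> x i = z i"
  shows "idx x j div k n = idx z j div k n"
  using assms(4)
proof (induction j rule: dec_induct)
  case base
  then show ?case using idx_less[OF assms(1,3)] idx_less[OF assms(2,3)] by simp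
next
  case (step j)
  then have j: "j \<ge> 1" using assms(3) by simp
  show ?case
    using step assms(5)[of j] idx_Suc_div_mod[OF assms(1) j] idx_Suc_div_mod[OF assms(2) j]
    by (subst div_eq_iff_div_mod_eq[OF k_dvd[OF assms(3) step(1)] k_pos[OF assms(3)]]) simp
qed

lemma idx_eq_iff:
  assumes "x \<in> inf_paths V" "z \<in> inf_paths V" "n \<ge> 1"
  shows "idx x n = idx z n \<longleftrightarrow> (\<forall>i<n. x i = z i)"
proof
  show "\<forall>i<n. x i = z i" if "idx x n = idx z n"
    using assms(3) that
  proof (induction n rule: dec_induct)
    case base
    then show ?case by (simp add: idx_1)
  next
    case (step n)
    have "x n = z n" "idx x n = idx z n"
      using step idx_Suc_div_mod[OF assms(1) step(1)] idx_Suc_div_mod[OF assms(2) step(1)] by metis+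
    with step show ?case by (simp add: less_Suc_eq)
  qed
qed (simp add: idx_eq)

definition fibre_points :: "(nat \<Rightarrow> nat) \<Rightarrow> (nat \<Rightarrow> nat \<Rightarrow> 'x) set" where
  "fibre_points x = {y. \<forall>i\<ge>1. y i \<in> pts i \<and> eigenfun V i (x i) (y (Suc i)) = y i}"

text \<open>A point of the spectrum is a path together with a compatible sequence of points of the
  spaces \<open>X\<^bsup>n i\<^esup>\<close>.\<close>

definition located :: "('a \<Rightarrow> complex) \<Rightarrow> (nat \<Rightarrow> nat) \<Rightarrow> (nat \<Rightarrow> nat \<Rightarrow> 'x) \<Rightarrow> bool" where
  "located \<xi> x y \<longleftrightarrow> \<xi> \<in> characters limit \<and> x \<in> inf_paths V \<and> y \<in> fibre_points x \<and>
     (\<forall>i\<ge>1. \<forall>f. continuous_map (level_space i) euclidean f \<longrightarrow> \<xi> (diag i f) = f (y i, idx x i))"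

lemma locatedD:
  assumes "located \<xi> x y"
  shows "\<xi> \<in> characters limit" "x \<in> inf_paths V" "y \<in> fibre_points x"
    "i \<ge> 1 \<Longrightarrow> continuous_map (level_space i) euclidean f \<Longrightarrow> \<xi> (diag i f) = f (y i, idx x i)"
  using assms by (auto simp: located_def)

lemma ex_located:
  assumes "\<xi> \<in> characters limit"
  shows "\<exists>x y. located \<xi> x y"
proof -
  obtain t where t: "t \<in> threads"
    "\<forall>i\<ge>1. \<forall>f. continuous_map (level_space i) euclidean f \<longrightarrow> \<xi> (diag i f) = f (t i)"
    using character_thread[OF assms] by (rule bexE)
  have t1: "t i \<in> pts i \<times> {..<k i}" "level_map i (t (Suc i)) = t i" if "i \<ge> 1" for i
    using t(1) that by (auto simp: threads_def topspace_level_space)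
  \<comment> \<open>The edge entering level \<open>i + 1\<close> is the block number of the index
    there; at level \<open>1\<close> the index is itself the edge from the root.\<close>
  define x where "x i = (if i = 0 then snd (t 1) else snd (t (Suc i)) div k i)" for i
  define y where "y i = fst (t i)" for i
  have sp: "fst (t i) = eigenfun V i (snd (t (Suc i)) div k i) (fst (t (Suc i)))"
    "snd (t i) = snd (t (Suc i)) mod k i" if "i \<ge> 1" for i
    using t1(2)[OF that] by (simp_all add: level_map_def split_beta prod_eq_iff)
  have x: "x \<in> inf_paths V"
  proof -
    have "x i < edge_count V i" for i
      using t1(1)[of 1] t1(1)[of "Suc i"] block_bound[of i "snd (t (Suc i))"]
      by (auto simp: x_def edge_count_def mem_Times_iff)
    then show ?thesis by (simp add: inf_paths_def)
  qed
  have idx: "idx x i = snd (t i)" if "i \<ge> 1" for i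
    using that
  proof (induction i rule: dec_induct)
    case base
    then show ?case by (simp add: idx_1 x_def)
  next
    case (step i)
    then show ?case using sp(2)[of i] by (simp add: idx_Suc x_def div_mult_mod_eq)
  qed
  have "y i \<in> pts i \<and> eigenfun V i (x i) (y (Suc i)) = y i" if i: "i \<ge> 1" for i
    using t1(1)[OF i] sp(1)[OF i] i by (simp add: y_def x_def mem_Times_iff)
  then have "y \<in> fibre_points x" by (simp add: fibre_points_def)
  moreover have "t i = (y i, idx x i)" if "i \<ge> 1" for i
    using idx[OF that] by (simp add: y_def)
  ultimately have "located \<xi> x y" using assms x t(2) by (simp add: located_def)
  then show ?thesis by blast
qed

lemma character_at:
  assumes x: "x \<in> inf_paths V" and y: "y \<in> fibre_points x"
  shows "\<exists>\<xi>. located \<xi> x y"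
proof -
  have "(\<lambda>i. (y i, idx x i)) \<in> threads"
    using y idx_less[OF x] idx_Suc_div_mod[OF x]
    by (auto simp: threads_def topspace_level_space fibre_points_def level_map_def)
  from thread_character[OF this] show ?thesis
    using x y by (auto simp: located_def)
qed

lemma located_point_unique:
  assumes "located \<xi> x y" "located \<xi> x' y'" "i \<ge> 1"
  shows "(y i, idx x i) = (y' i, idx x' i)"
proof (rule ccontr)
  assume ne: "\<not> ?thesis"
  note L = locatedD[OF assms(1)] and L' = locatedD[OF assms(2)]
  have "(y i, idx x i) \<in> topspace (level_space i)" "(y' i, idx x' i) \<in> topspace (level_space i)"
    using L(3) L'(3) idx_less[OF L(2) assms(3)] idx_less[OF L'(2) assms(3)] assms(3)
    by (auto simp: topspace_level_space fibre_points_def)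
  from separate_points[OF assms(3) this ne]
  obtain u :: "(nat \<Rightarrow> 'x) \<times> nat \<Rightarrow> complex" where
    u: "continuous_map (level_space i) euclidean u" "u (y i, idx x i) = 1" "u (y' i, idx x' i) = 0" by metis
  from L(4)[OF assms(3) u(1)] L'(4)[OF assms(3) u(1)] u(2,3) show False by simp
qed

lemma located_path_unique:
  assumes "located \<xi> x y" "located \<xi> x' y'"
  shows "x = x'"
proof
  fix i
  have "idx x (Suc i) = idx x' (Suc i)" using located_point_unique[OF assms, of "Suc i"] by simp
  then show "x i = x' i" using idx_eq_iff[of x x' "Suc i"] locatedD(2)[OF assms(1)] locatedD(2)[OF assms(2)] by simp
qed

lemma located_munit:
  assumes "located \<xi> x y" "n \<ge> 1"
  shows "\<xi> (munit n a a) = (if idx x n = a then 1 else 0)"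
  using locatedD(4)[OF assms(1,2) continuous_snd_eq] by (simp add: munit_eq_diag)


subsection \<open>Points over a given path\<close>

primrec descend :: "(nat \<Rightarrow> nat) \<Rightarrow> nat \<Rightarrow> nat \<Rightarrow> (nat \<Rightarrow> 'x) \<Rightarrow> (nat \<Rightarrow> 'x)" where
  "descend x 0 i y = y"
| "descend x (Suc d) i y = eigenfun V i (x i) (descend x d (Suc i) y)"

lemma continuous_descend:
  assumes "x \<in> inf_paths V" "i \<ge> 1"
  shows "continuous_map (Y (i + d)) (Y i) (descend x d i)"
  using assms(2)
proof (induction d arbitrary: i)
  case 0
  then show ?case by (simp add: continuous_map_id[unfolded id_def] cong del: if_weak_cong)
next
  case (Suc d)
  have "continuous_map (Y (Suc i + d)) (Y i) (eigenfun V i (x i) \<circ> descend x d (Suc i))"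
    by (rule continuous_map_compose[OF Suc.IH continuous_eigenfun])
      (use Suc.prems inf_pathsD(2)[OF assms(1)] in auto)
  then show ?case by (simp add: o_def)
qed

lemma descend_in_pts:
  "x \<in> inf_paths V \<Longrightarrow> i \<ge> 1 \<Longrightarrow> y \<in> pts (i + d) \<Longrightarrow> descend x d i y \<in> pts i"
  using continuous_map_funspace[OF continuous_descend] by auto

lemma fibre_points_descend:
  assumes "y \<in> fibre_points x" "i \<ge> 1"
  shows "descend x d i (y (i + d)) = y i"
  using assms(2)
proof (induction d arbitrary: i)
  case (Suc d)
  then show ?case using Suc.IH[of "Suc i"] assms(1) by (simp add: fibre_points_def)
qed simp

definition const_edges :: "(nat \<Rightarrow> nat) \<Rightarrow> nat set" where
  "const_edges x = {i. i \<ge> 1 \<and> \<not> x i < vp V i}"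

text \<open>A constant edge at some level \<open>m >= i\<close> determines the point at
  \<open>m\<close> regardless of what lies above, and the point at \<open>i\<close> is obtained from
  it by descending.\<close>

lemma fibre_points_const_unique:
  assumes "infinite (const_edges x)" "y \<in> fibre_points x" "z \<in> fibre_points x" "i \<ge> 1"
  shows "y i = z i"
proof -
  obtain m where m: "m \<ge> i" "m \<in> const_edges x" using assms(1) infinite_nat_iff_unbounded_le by blast
  have "m \<ge> 1" "\<not> x m < vp V m" using m(2) by (simp_all add: const_edges_def)
  moreover from this(1) have "eigenfun V m (x m) (y (Suc m)) = y m" "eigenfun V m (x m) (z (Suc m)) = z m"
    using assms(2,3) by (simp_all add: fibre_points_def)
  ultimately have "y m = z m" by (simp add: eigenfun_def)
  then show ?thesis
    using fibre_points_descend[OF assms(2,4), of "m - i"] fibre_points_descend[OF assms(3,4), of "m - i"] m(1)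
    by simp
qed

lemma fibre_points_const_ex:
  assumes "infinite (const_edges x)" "x \<in> inf_paths V"
  shows "fibre_points x \<noteq> {}"
proof -
  obtain x0 where x0: "x0 \<in> topspace X" using X(3) by blast
  define b where "b i = (\<lambda>j\<in>{..<vn V i}. x0)" for i
  have b: "b i \<in> pts i" for i using x0 by (auto simp: b_def power_top_def)
  \<comment> \<open>Level \<open>m i\<close> carries the first constant edge from \<open>i\<close>
    on. Descending from just above it passes through that edge, so the choice of base point there
    has no effect.\<close>
  define m where "m i = (LEAST m. m \<ge> i \<and> m \<in> const_edges x)" for i
  have ex: "\<exists>m. m \<ge> i \<and> m \<in> const_edges x" for i
    using assms(1) infinite_nat_iff_unbounded_le by blast
  have m: "m i \<ge> i" "m i \<in> const_edges x" for i using LeastI_ex[OF ex[of i]] by (simp_all add: m_def)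
  define y where "y i = descend x (Suc (m i) - i) i (b (Suc (m i)))" for i
  have "y \<in> fibre_points x"
    unfolding fibre_points_def
  proof (intro CollectI allI impI conjI)
    fix i :: nat assume i: "i \<ge> 1"
    show "y i \<in> pts i"
      unfolding y_def by (rule descend_in_pts[OF assms(2) i]) (use m(1)[of i] b in simp)
    \<comment> \<open>At a constant edge the points at \<open>i\<close> and \<open>i + 1\<close> may
      descend from different base points, but the eigenfunction ignores its argument; elsewhere
      \<open>m i = m (Suc i)\<close> and both lie on the same descent.\<close>
    show "eigenfun V i (x i) (y (Suc i)) = y i"
    proof (cases "i \<in> const_edges x")
      case True
      then have "m i = i" unfolding m_def by (intro Least_equality) auto
      with True show ?thesis by (simp add: y_def const_edges_def eigenfun_def)
    next
      case False
      have "m i = m (Suc i)"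
        unfolding m_def by (rule arg_cong[where f = Least]) (use False in \<open>auto simp: fun_eq_iff le_Suc_eq Suc_le_eq order.strict_iff_order\<close>)
      moreover have "Suc (m (Suc i)) - i = Suc (Suc (m (Suc i)) - Suc i)" using m(1)[of "Suc i"] by simp
      ultimately show ?thesis by (simp add: y_def)
    qed
  qed
  then show ?thesis by blast
qed

end

text \<open>Suppose that all edges of \<open>x\<close> from level \<open>N\<close> on are projections onto blocks of coordinates. A
  coordinate \<open>j\<close> at level \<open>i\<close> is then identified with the coordinate \<open>s n\<^sub>i + j\<close> at level \<open>i + 1\<close>, \<open>s\<close> the
  number of the block. Labelling \<open>j\<close> by the integer \<open>j - o\<^sub>i\<close>, where \<open>o\<^sub>i\<close> is the total shift, turns these
  identifications into inclusions of intervals of integers.\<close>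

locale projection_tail = villadsen_limit V \<Phi>
  for V :: "'x villadsen" and \<Phi> :: "nat \<Rightarrow> ((nat \<Rightarrow> 'x) \<Rightarrow> complex mat) \<Rightarrow> 'a::unital_cstar_algebra" +
  fixes x :: "nat \<Rightarrow> nat" and N :: nat
  assumes x: "x \<in> inf_paths V" and N: "N \<ge> 1" and proj: "i \<ge> N \<Longrightarrow> x i < vp V i"
begin

definition shift :: "nat \<Rightarrow> nat" where
  "shift i = (\<Sum>l=N..<i. proj_comp V l (x l) * vn V l)"

definition labels :: "nat \<Rightarrow> int set" where
  "labels i = {- int (shift i)..<int (vn V i) - int (shift i)}"

text \<open>The intervals \<open>labels i\<close> increase with \<open>i\<close>. The fibre will be
  the power of \<open>X\<close> with exponent \<open>J\<close>, so the size of this union decides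
  between a finite power and the countable one.\<close>

definition J :: "int set" where "J = (\<Union>i\<in>{N..}. labels i)"

lemma shift_Suc: "i \<ge> N \<Longrightarrow> shift (Suc i) = shift i + proj_comp V i (x i) * vn V i"
  by (simp add: shift_def)

lemma labels_Suc:
  assumes "i \<ge> N"
  shows "labels i \<subseteq> labels (Suc i)"
proof -
  have "vn V i > 0" using n_pos assms N by simp
  then have "proj_comp V i (x i) * vn V i + (vn V i - 1) < vn V (Suc i)"
    using proj_bound[of i "x i" "vn V i - 1"] assms N proj by simp
  then have "int (proj_comp V i (x i) * vn V i) + int (vn V i) \<le> int (vn V (Suc i))"
    using \<open>vn V i > 0\<close> by linarith
  then show ?thesis using assms by (auto simp: labels_def shift_Suc)
qed

lemma labels_mono:
  assumes "N \<le> i" "i \<le> m"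
  shows "labels i \<subseteq> labels m"
  using assms(2)
proof (induction m rule: dec_induct)
  case (step m)
  then show ?case using labels_Suc[of m] assms(1) by auto
qed simp

lemma labels_subset_J: "i \<ge> N \<Longrightarrow> labels i \<subseteq> J"
  by (auto simp: J_def)

lemma J_nonempty: "J \<noteq> {}"
proof -
  have "- int (shift N) \<in> labels N" using n_pos[OF N] by (simp add: labels_def)
  then show ?thesis using labels_subset_J by blast
qed

abbreviation X_J :: "(int \<Rightarrow> 'x) topology" where "X_J \<equiv> product_topology (\<lambda>_. X) J"

text \<open>From level \<open>N\<close> on, the points are plain selections of coordinates of
  \<open>z\<close>; below \<open>N\<close> the path may contain constant edges, and the point is
  forced by descending.\<close>

definition point :: "(int \<Rightarrow> 'x) \<Rightarrow> nat \<Rightarrow> (nat \<Rightarrow> 'x)" where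
  "point z i = (if i < N then descend x (N - i) i (\<lambda>j\<in>{..<vn V N}. z (int j - int (shift N)))
     else (\<lambda>j\<in>{..<vn V i}. z (int j - int (shift i))))"

lemma continuous_tail_point:
  assumes "i \<ge> N"
  shows "continuous_map X_J (Y i) (\<lambda>z. \<lambda>j\<in>{..<vn V i}. z (int j - int (shift i)))"
proof -
  have "continuous_map X_J X (\<lambda>z. z (int j - int (shift i)))" if "j < vn V i" for j
    by (rule continuous_map_product_projection)
      (use labels_subset_J[OF assms] that in \<open>auto simp: labels_def\<close>)
  then show ?thesis by (simp add: power_top_def continuous_map_componentwise image_subset_iff)
qed

lemma continuous_point:
  assumes "i \<ge> 1"
  shows "continuous_map X_J (Y i) (\<lambda>z. point z i)"
proof (cases "i < N")
  case True
  have "continuous_map (Y N) (Y i) (descend x (N - i) i)"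
    using continuous_descend[OF x assms, of "N - i"] True by simp
  from continuous_map_compose[OF continuous_tail_point[OF order_refl] this]
  show ?thesis using True by (simp add: point_def o_def)
next
  case False
  then show ?thesis using continuous_tail_point[of i] by (simp add: point_def)
qed

lemma point_in_fibre:
  assumes "z \<in> topspace X_J"
  shows "point z \<in> fibre_points x"
  unfolding fibre_points_def
proof (intro CollectI allI impI conjI)
  fix i :: nat assume i: "i \<ge> 1"
  show "point z i \<in> pts i" using continuous_map_funspace[OF continuous_point[OF i]] assms by auto
  show "eigenfun V i (x i) (point z (Suc i)) = point z i"
  proof (cases "i < N")
    case True
    then have eq: "N - i = Suc (N - Suc i)" by simp
    have "descend x (N - i) i w = eigenfun V i (x i) (descend x (N - Suc i) (Suc i) w)" for w
      unfolding eq by (rule descend.simps)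
    then have "point z i = eigenfun V i (x i) (descend x (N - Suc i) (Suc i) (\<lambda>j\<in>{..<vn V N}. z (int j - int (shift N))))"
      using True by (simp add: point_def)
    moreover have "point z (Suc i) = descend x (N - Suc i) (Suc i) (\<lambda>j\<in>{..<vn V N}. z (int j - int (shift N)))"
    proof (cases "Suc i < N")
      case False
      then have "Suc i = N" using True by simp
      then show ?thesis by (simp add: point_def)
    qed (simp add: point_def)
    ultimately show ?thesis by simp
  next
    case False
    then have iN: "i \<ge> N" by simp
    have "point z (Suc i) (proj_comp V i (x i) * vn V i + j) = z (int j - int (shift i))" if "j < vn V i" for j
      using proj_bound[OF i proj[OF iN] that] iN by (simp add: point_def shift_Suc)
    then show ?thesis using iN proj[OF iN] by (auto simp: eigenfun_def point_def fun_eq_iff)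
  qed
qed

text \<open>A label keeps its coordinate value from one level to the next, so the value may be read
  off at any level where the label occurs; collecting these values gives \<open>z\<close>.\<close>

lemma point_surj:
  assumes y: "y \<in> fibre_points x"
  shows "\<exists>z\<in>topspace X_J. \<forall>i\<ge>1. point z i = y i"
proof -
  have shift_step: "y (Suc i) (nat (v + int (shift (Suc i)))) = y i (nat (v + int (shift i)))"
    if "i \<ge> N" "v \<in> labels i" for i v
  proof -
    define j where "j = nat (v + int (shift i))"
    have j: "j < vn V i" "v + int (shift i) = int j" using that(2) by (auto simp: labels_def j_def)
    have "v + int (shift (Suc i)) = int (proj_comp V i (x i) * vn V i + j)"
      using j(2) by (simp add: shift_Suc[OF that(1)])
    then have "nat (v + int (shift (Suc i))) = proj_comp V i (x i) * vn V i + j"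
      by (simp only: nat_int)
    moreover have "eigenfun V i (x i) (y (Suc i)) = y i"
      using y that(1) N by (simp add: fibre_points_def)
    from fun_cong[OF this, of j] have "y (Suc i) (proj_comp V i (x i) * vn V i + j) = y i j"
      using proj[OF that(1)] j(1) by (simp add: eigenfun_def)
    ultimately show ?thesis by (simp add: j_def)
  qed
  have indep: "y m (nat (v + int (shift m))) = y i (nat (v + int (shift i)))"
    if i: "i \<ge> N" "v \<in> labels i" "i \<le> m" for i m v
    using i(3)
  proof (induction m rule: dec_induct)
    case (step m)
    then have "v \<in> labels m" using labels_mono[of i m] i by auto
    then show ?case using shift_step step i by simp
  qed simp
  define lev where "lev v = (SOME i. i \<ge> N \<and> v \<in> labels i)" for v
  have lev: "lev v \<ge> N" "v \<in> labels (lev v)" if "v \<in> J" for v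
  proof -
    have "\<exists>i. i \<ge> N \<and> v \<in> labels i" using that by (auto simp: J_def)
    from someI_ex[OF this] show "lev v \<ge> N" "v \<in> labels (lev v)" by (simp_all add: lev_def)
  qed
  define z where "z = (\<lambda>v\<in>J. y (lev v) (nat (v + int (shift (lev v)))))"
  have z: "z v = y i (nat (v + int (shift i)))" if "i \<ge> N" "v \<in> labels i" for i v
  proof -
    have v: "v \<in> J" using that labels_subset_J by blast
    have "y (max i (lev v)) (nat (v + int (shift (max i (lev v))))) = y i (nat (v + int (shift i)))"
      by (rule indep) (use that in auto)
    moreover have "y (max i (lev v)) (nat (v + int (shift (max i (lev v))))) = y (lev v) (nat (v + int (shift (lev v))))"
      by (rule indep) (use lev[OF v] in auto)
    ultimately show ?thesis using v by (simp add: z_def)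
  qed
  have yp: "y i \<in> pts i" if "i \<ge> 1" for i using y that by (simp add: fibre_points_def)
  have tail: "(\<lambda>j\<in>{..<vn V i}. z (int j - int (shift i))) = y i" if "i \<ge> N" for i
  proof -
    have "z (int j - int (shift i)) = y i j" if "j < vn V i" for j
      using z[of i "int j - int (shift i)"] \<open>i \<ge> N\<close> that by (simp add: labels_def)
    moreover have "y i \<in> extensional {..<vn V i}"
      using yp[of i] that N by (auto simp: power_top_def PiE_def)
    ultimately show ?thesis by (auto simp: fun_eq_iff extensional_def)
  qed
  show ?thesis
  proof (intro bexI allI impI)
    show "z \<in> topspace X_J"
    proof -
      have "z v \<in> topspace X" if "v \<in> J" for v
      proof -
        have "nat (v + int (shift (lev v))) < vn V (lev v)"
          using lev[OF that] n_pos[of "lev v"] N by (auto simp: labels_def)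
        then show ?thesis
          using yp[of "lev v"] lev(1)[OF that] N that by (auto simp: z_def power_top_def)
      qed
      then show ?thesis by (auto simp: z_def)
    qed
    show "point z i = y i" if "i \<ge> 1" for i
    proof (cases "i < N")
      case True
      then show ?thesis
        using fibre_points_descend[OF y that, of "N - i"] tail[of N] by (simp add: point_def)
    next
      case False
      then show ?thesis using tail[of i] by (simp add: point_def)
    qed
  qed
qed

lemma point_inj:
  assumes "z \<in> topspace X_J" "z' \<in> topspace X_J"
    and eq: "\<And>i. i \<ge> 1 \<Longrightarrow> point z i = point z' i"
  shows "z = z'"
proof (rule extensionalityI[of _ J])
  fix v assume "v \<in> J"
  then obtain i where i: "i \<ge> N" "v \<in> labels i" by (auto simp: J_def)
  then have "nat (v + int (shift i)) < vn V i" "int (nat (v + int (shift i))) - int (shift i) = v"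
    by (auto simp: labels_def)
  with fun_cong[OF eq[of i], of "nat (v + int (shift i))"] i N show "z v = z' v"
    by (simp add: point_def)
qed (use assms in \<open>auto simp: PiE_def\<close>)

end


section \<open>The fibration\<close>

context villadsen_limit
begin

lemma ex_projection_tail:
  assumes x: "x \<in> inf_paths V" and fin: "finite (const_edges x)"
  shows "\<exists>N. projection_tail V \<Phi> x N"
proof
  \<comment> \<open>Inserting \<open>0\<close> keeps the maximum defined when there is no constant
    edge, and the successor passes every constant edge and makes the bound at least
    \<open>1\<close>.\<close>
  let ?N = "Suc (Max (insert 0 (const_edges x)))"
  have "x i < vp V i" if "i \<ge> ?N" for i
  proof (rule ccontr)
    assume "\<not> x i < vp V i"
    then have "i \<in> insert 0 (const_edges x)" using that by (simp add: const_edges_def)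
    then have "i \<le> Max (insert 0 (const_edges x))" using fin by (intro Max_ge) auto
    with that show False by (simp)
  qed
  then show "projection_tail V \<Phi> x ?N"
    by unfold_locales (use x in \<open>auto\<close>)
qed

text \<open>The purpose is a character over every path: the uniqueness part of
  \<open>anchor_eq\<close> rests on it. With finitely many constant edges, a constant family over
  \<open>J\<close> gives a point.\<close>

lemma fibre_points_nonempty:
  assumes x: "x \<in> inf_paths V"
  shows "fibre_points x \<noteq> {}"
proof (cases "finite (const_edges x)")
  case False
  then show ?thesis using fibre_points_const_ex x by blast
next
  case True
  obtain N where "projection_tail V \<Phi> x N" using ex_projection_tail[OF x True] by blast
  then interpret projection_tail V \<Phi> x N .
  obtain x0 where "x0 \<in> topspace X" using X(3) by blast
  then have "(\<lambda>v\<in>J. x0) \<in> topspace X_J" by simp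
  from point_in_fibre[OF this] show ?thesis by blast
qed

text \<open>A working version of the anchor, read off from the thread of \<xi>;
  \<open>anchor_eq\<close> identifies the two once the characters of \<open>CB\<close> are
  understood.\<close>

definition path_of :: "('a \<Rightarrow> complex) \<Rightarrow> nat \<Rightarrow> nat" where
  "path_of \<xi> = (SOME x. \<exists>y. located \<xi> x y)"

lemma path_of_located:
  assumes "\<xi> \<in> characters limit"
  shows "\<exists>y. located \<xi> (path_of \<xi>) y"
  using someI_ex[OF ex_located[OF assms]] by (simp add: path_of_def)

lemma path_of_eq: "located \<xi> x y \<Longrightarrow> path_of \<xi> = x"
  using path_of_located[OF locatedD(1)] located_path_unique by metis

lemma path_of_in: "\<xi> \<in> characters limit \<Longrightarrow> path_of \<xi> \<in> inf_paths V"
  using path_of_located locatedD(2) by metis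

lemma character_munit:
  assumes "\<xi> \<in> characters limit" "n \<ge> 1"
  shows "\<xi> (munit n a a) = (if idx (path_of \<xi>) n = a then 1 else 0)"
  using path_of_located[OF assms(1)] located_munit[OF _ assms(2)] by metis

abbreviation prefix :: "(nat \<Rightarrow> nat) \<Rightarrow> nat \<Rightarrow> nat list" where
  "prefix x n \<equiv> map x [0..<n]"

lemma path_unit_prefix: "path_unit V \<Phi> (prefix x n) (prefix z n) = munit n (idx x n) (idx z n)"
  by (simp add: path_unit_def munit_def \<Psi>_def entry_fun_def idx_def)

text \<open>Every level has an outgoing edge, so finite paths extend. This turns lists into prefixes
  of infinite paths, for which the arithmetic of \<open>idx\<close> is available.\<close>

lemma fin_paths_eq: "fin_paths V n = (\<lambda>x. prefix x n) ` inf_paths V"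
proof (intro equalityI subsetI)
  fix p assume "p \<in> fin_paths V n"
  then have p: "length p = n" "\<And>i. i < n \<Longrightarrow> p ! i < edge_count V i" by (auto simp: fin_paths_def)
  define x where "x i = (if i < n then p ! i else 0)" for i
  have "x \<in> inf_paths V" using p(2) edge_count_pos by (simp add: inf_paths_def x_def)
  moreover have "p = prefix x n" using p(1) by (intro nth_equalityI) (auto simp: x_def)
  ultimately show "p \<in> (\<lambda>x. prefix x n) ` inf_paths V" by blast
qed (auto simp: fin_paths_def inf_paths_def)

lemma cylinder_prefix: "x \<in> cylinder V (prefix z n) \<longleftrightarrow> x \<in> inf_paths V \<and> (\<forall>i<n. x i = z i)"
  by (auto simp: cylinder_def)

lemma path_unit_fin_path:
  assumes "\<xi> \<in> characters limit" "n \<ge> 1" "p \<in> fin_paths V n"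
  shows "\<xi> (path_unit V \<Phi> p p) = (if path_of \<xi> \<in> cylinder V p then 1 else 0)"
proof -
  obtain z where z: "z \<in> inf_paths V" "p = prefix z n" using assms(3) by (auto simp: fin_paths_eq)
  show ?thesis
    using idx_eq_iff[OF path_of_in[OF assms(1)] z(1) assms(2)] path_of_in[OF assms(1)]
    by (simp add: z(2) path_unit_prefix character_munit[OF assms(1,2)] cylinder_prefix)
qed

section \<open>Characters of the intersection of the diagonal with the AF-subsystem\<close>

abbreviation CB :: "'a set" where "CB \<equiv> limit \<inter> af_subsystem V \<Phi>"

definition constants :: "'a set" where
  "constants = (\<Union>i\<in>{1..}. range (\<lambda>F. \<Psi> i (\<lambda>y. F)))"

lemma af_subsystem_eq: "af_subsystem V \<Phi> = closure constants"
proof -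
  have "\<Phi> i ` {(\<lambda>y\<in>pts i. M) | M. M \<in> carrier_mat (k i) (k i)} = range (\<lambda>F. \<Psi> i (\<lambda>y. F))" for i
  proof (intro equalityI subsetI)
    fix c assume "c \<in> \<Phi> i ` {(\<lambda>y\<in>pts i. M) | M. M \<in> carrier_mat (k i) (k i)}"
    then obtain M where M: "M \<in> carrier_mat (k i) (k i)" "c = \<Phi> i (\<lambda>y\<in>pts i. M)" by blast
    have "(\<lambda>y\<in>pts i. M) = entry_fun i (\<lambda>y a b. M $$ (a, b))"
      using M(1) by (auto simp: entry_fun_def fun_eq_iff intro!: eq_matI)
    then show "c \<in> range (\<lambda>F. \<Psi> i (\<lambda>y. F))" using M(2) by (auto simp: \<Psi>_def)
  next
    fix c assume "c \<in> range (\<lambda>F. \<Psi> i (\<lambda>y. F))"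
    then obtain F where "c = \<Phi> i (\<lambda>y\<in>pts i. mat (k i) (k i) (\<lambda>(a, b). F a b))"
      by (auto simp: \<Psi>_def entry_fun_def)
    moreover have "mat (k i) (k i) (\<lambda>(a, b). F a b) \<in> carrier_mat (k i) (k i)" by simp
    ultimately show "c \<in> \<Phi> i ` {(\<lambda>y\<in>pts i. M) | M. M \<in> carrier_mat (k i) (k i)}"
      by blast
  qed
  then show ?thesis by (simp add: af_subsystem_def constants_def)
qed

lemma constants_lift:
  assumes "i \<ge> 1" "i \<le> j"
  shows "\<exists>G. \<Psi> i (\<lambda>y. F) = \<Psi> j (\<lambda>y. G)"
  using assms(2)
proof (induction j rule: dec_induct)
  case (step j)
  then obtain G where "\<Psi> i (\<lambda>y. F) = \<Psi> j (\<lambda>y. G)" by blast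
  also have "\<dots> = \<Psi> (Suc j) (\<lambda>y r s. if r div k j = s div k j then G (r mod k j) (s mod k j) else 0)"
    using step assms(1) by (subst \<Psi>_compat) auto
  finally show ?case by blast
qed blast

lemma constantsI: "i \<ge> 1 \<Longrightarrow> \<Psi> i (\<lambda>y. F) \<in> constants"
  by (auto simp: constants_def)

lemma subalgebra_constants: "unital_subalgebra constants"
  unfolding unital_subalgebra_def
proof (intro conjI ballI allI)
  have "(1::nat) \<ge> 1" by simp
  from \<Psi>_one[OF this] constantsI[OF this, of "\<lambda>a b. if a = b then 1 else 0"]
  show "1 \<in> constants" by simp
next
  fix c d assume "c \<in> constants" "d \<in> constants"
  then obtain i j F G where ij: "i \<ge> 1" "j \<ge> 1" "c = \<Psi> i (\<lambda>y. F)" "d = \<Psi> j (\<lambda>y. G)"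
    by (auto simp: constants_def)
  have m: "max i j \<ge> 1" using ij by simp
  obtain F' where F': "c = \<Psi> (max i j) (\<lambda>y. F')" using constants_lift[of i "max i j" F] ij by auto
  obtain G' where G': "d = \<Psi> (max i j) (\<lambda>y. G')" using constants_lift[of j "max i j" G] ij by auto
  show "c + d \<in> constants" "c * d \<in> constants"
    unfolding F' G' \<Psi>_add[OF m cont_entries_const cont_entries_const, symmetric]
      \<Psi>_mult[OF m cont_entries_const cont_entries_const, symmetric]
    by (rule constantsI[OF m])+
next
  fix z c assume "c \<in> constants"
  then obtain i F where i: "i \<ge> 1" "c = \<Psi> i (\<lambda>y. F)" by (auto simp: constants_def)
  show "scaleC z c \<in> constants"
    unfolding i(2) \<Psi>_scale[OF i(1) cont_entries_const, symmetric] by (rule constantsI[OF i(1)])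
qed

lemma subalgebra_CB: "unital_subalgebra CB"
  unfolding af_subsystem_eq
  by (intro unital_subalgebra_Int subalgebra_limit unital_subalgebra_closure subalgebra_constants)

lemma closed_CB: "closed CB"
  unfolding af_subsystem_eq by (intro closed_Int closed_limit closed_closure)

lemma munit_in_CB: "n \<ge> 1 \<Longrightarrow> munit n a a \<in> CB"
  using munit_in_limit constantsI[of n "\<lambda>r s. if r = a \<and> s = a then 1 else 0"]
    closure_subset[of constants]
  by (auto simp: af_subsystem_eq munit_def)

lemma restrict_character_CB:
  assumes "\<xi> \<in> characters limit"
  shows "restrict \<xi> CB \<in> characters CB"
proof -
  note \<xi> = characterD[OF assms subalgebra_limit] and B = unital_subalgebraD[OF subalgebra_CB]
  have "\<exists>a\<in>CB. restrict \<xi> CB a \<noteq> 0" using B(1) \<xi>(4) by (intro bexI[of _ 1]) auto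
  moreover have "restrict \<xi> CB (a + b) = restrict \<xi> CB a + restrict \<xi> CB b \<and>
      restrict \<xi> CB (a * b) = restrict \<xi> CB a * restrict \<xi> CB b" if "a \<in> CB" "b \<in> CB" for a b
    using B(2,3)[OF that] that \<xi>(1,2)[of a b] by simp
  moreover have "restrict \<xi> CB (scaleC z a) = z * restrict \<xi> CB a" if "a \<in> CB" for a z
    using B(4)[OF that] that \<xi>(3)[of a z] by simp
  ultimately show ?thesis by (simp add: characters_def)
qed

text \<open>If \<open>\<psi>\<close> takes the value \<open>1\<close> at the projection \<open>e\<close> of the path \<open>x\<close> at level \<open>i\<close>, and \<open>c\<close> is close to
  a constant matrix \<open>F\<close> of level \<open>i\<close>, then \<open>\<psi>(c) = \<psi>(e c e)\<close> is close to the corresponding diagonal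
  entry of \<open>F\<close>, whatever \<open>\<psi>\<close> is.\<close>

lemma character_CB_unique:
  assumes \<psi>: "\<psi> \<in> characters CB" "\<psi>' \<in> characters CB" and x: "x \<in> inf_paths V"
    and one: "\<And>n. n \<ge> 1 \<Longrightarrow> \<psi> (munit n (idx x n) (idx x n)) = 1"
      "\<And>n. n \<ge> 1 \<Longrightarrow> \<psi>' (munit n (idx x n) (idx x n)) = 1"
  shows "\<psi> = \<psi>'"
proof (rule extensionalityI[of _ CB])
  fix c assume c: "c \<in> CB"
  have "cmod (\<psi> c - \<psi>' c) \<le> e" if e: "e > 0" for e
  proof -
    have "c \<in> closure constants" using c by (simp add: af_subsystem_eq)
    then have "\<exists>d\<in>constants. dist d c < e / 2" using e unfolding closure_approachable by (meson half_gt_zero)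
    then obtain i F where i: "i \<ge> 1" "norm (c - \<Psi> i (\<lambda>y. F)) < e / 2"
      by (auto simp: constants_def dist_norm norm_minus_commute)
    define a where "a = idx x i"
    have a: "a < k i" using idx_less[OF x i(1)] by (simp add: a_def)
    define E where "E = munit i a a"
    have E: "E \<in> CB" unfolding E_def by (rule munit_in_CB[OF i(1)])
    have comp: "E * \<Psi> i (\<lambda>y. F) * E = scaleC (F a a) E"
      unfolding E_def munit_compress_eq[OF i(1) cont_entries_const a a]
      unfolding munit_def \<Psi>_scale[OF i(1) cont_entries_const, symmetric]
      by (rule \<Psi>_cong) auto
    note B = unital_subalgebraD[OF subalgebra_CB]
    have close: "cmod (\<theta> c - F a a) \<le> e / 2" if \<theta>: "\<theta> \<in> characters CB" "\<theta> E = 1" for \<theta>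
    proof -
      note ch = characterD[OF \<theta>(1) subalgebra_CB]
      have mem: "E * c * E \<in> CB" "scaleC (F a a) E \<in> CB" by (intro B E c)+
      have "\<theta> (E * c * E - scaleC (F a a) E) = \<theta> c - F a a"
        using mem E c B(3)[OF E c] by (simp add: ch \<theta>(2))
      moreover have "cmod (\<theta> (E * c * E - scaleC (F a a) E)) \<le> norm (E * c * E - scaleC (F a a) E)"
        by (rule character_le_norm[OF \<theta>(1) subalgebra_CB closed_CB B(6)[OF mem]])
      moreover have "E * c * E - scaleC (F a a) E = E * (c - \<Psi> i (\<lambda>y. F)) * E"
        by (simp add: comp[symmetric] algebra_simps)
      moreover have "norm (E * (c - \<Psi> i (\<lambda>y. F)) * E) \<le> 1 * norm (c - \<Psi> i (\<lambda>y. F)) * 1"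
        using norm_munit_le[OF i(1) a a]
        by (intro order_trans[OF norm_mult_ineq] mult_mono) (auto simp: E_def intro!: order_trans[OF norm_mult_ineq] mult_left_le_one_le)
      ultimately show ?thesis using i(2) by simp
    qed
    have "cmod (\<psi> c - \<psi>' c) \<le> cmod (\<psi> c - F a a) + cmod (\<psi>' c - F a a)"
      using norm_triangle_ineq4[of "\<psi> c - F a a" "\<psi>' c - F a a"] by simp
    also have "\<dots> \<le> e" using close[OF \<psi>(1)] close[OF \<psi>(2)] one i(1) by (simp add: E_def a_def)
    finally show ?thesis .
  qed
  then show "\<psi> c = \<psi>' c" using field_le_epsilon[of "cmod (\<psi> c - \<psi>' c)" 0] by simp
qed (use \<psi> in \<open>auto simp: characters_def\<close>)

lemma path_character_path_of:
  assumes \<xi>: "\<xi> \<in> characters limit"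
  shows "path_character V \<Phi> (path_of \<xi>) = restrict \<xi> CB"
  unfolding path_character_def canonical_diagonal_eq
proof (rule the_equality)
  let ?x = "path_of \<xi>"
  have unit: "path_unit V \<Phi> p p \<in> CB" if "n \<ge> 1" "p \<in> fin_paths V n" for n p
    using that munit_in_CB by (auto simp: fin_paths_eq path_unit_prefix)
  show "restrict \<xi> CB \<in> characters CB \<and> (\<forall>n\<ge>1. \<forall>p\<in>fin_paths V n.
      restrict \<xi> CB (path_unit V \<Phi> p p) = (if ?x \<in> cylinder V p then 1 else 0))"
    using restrict_character_CB[OF \<xi>] unit path_unit_fin_path[OF \<xi>] by simp
  fix \<psi> assume \<psi>: "\<psi> \<in> characters CB \<and> (\<forall>n\<ge>1. \<forall>p\<in>fin_paths V n.
      \<psi> (path_unit V \<Phi> p p) = (if ?x \<in> cylinder V p then 1 else 0))"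
  have x: "?x \<in> inf_paths V" by (rule path_of_in[OF \<xi>])
  show "\<psi> = restrict \<xi> CB"
  proof (rule character_CB_unique[OF _ restrict_character_CB[OF \<xi>] x])
    fix n :: nat assume n: "n \<ge> 1"
    have "prefix ?x n \<in> fin_paths V n" using x by (auto simp: fin_paths_eq)
    then have "\<psi> (path_unit V \<Phi> (prefix ?x n) (prefix ?x n)) = 1"
      using \<psi> n x cylinder_prefix[of ?x ?x n] by simp
    then show "\<psi> (munit n (idx ?x n) (idx ?x n)) = 1" by (simp add: path_unit_prefix)
    show "restrict \<xi> CB (munit n (idx ?x n) (idx ?x n)) = 1"
      using munit_in_CB[OF n] character_munit[OF \<xi> n] by simp
  qed (use \<psi> in simp)
qed

text \<open>For uniqueness, a candidate path \<open>x\<close> is realised as the path of some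
  character \<eta>. Then \<xi> and \<eta> agree on all diagonal projections, and these determine the
  path level by level.\<close>

lemma anchor_eq:
  assumes \<xi>: "\<xi> \<in> characters limit"
  shows "anchor V \<Phi> \<xi> = path_of \<xi>"
  unfolding anchor_def canonical_diagonal_eq
proof (rule the_equality)
  show "path_of \<xi> \<in> inf_paths V \<and> restrict \<xi> CB = path_character V \<Phi> (path_of \<xi>)"
    using path_of_in[OF \<xi>] path_character_path_of[OF \<xi>] by simp
  fix x assume x: "x \<in> inf_paths V \<and> restrict \<xi> CB = path_character V \<Phi> x"
  obtain y where "y \<in> fibre_points x" using fibre_points_nonempty x by blast
  then obtain \<eta> where \<eta>: "located \<eta> x y" using character_at x by blast
  then have \<eta>c: "\<eta> \<in> characters limit" and \<eta>x: "path_of \<eta> = x" by (auto dest: locatedD path_of_eq)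
  have eq: "restrict \<xi> CB = restrict \<eta> CB" using x path_character_path_of[OF \<eta>c] \<eta>x by simp
  have "idx (path_of \<xi>) (Suc i) = idx x (Suc i)" for i
  proof -
    have "\<xi> (munit (Suc i) (idx x (Suc i)) (idx x (Suc i))) = \<eta> (munit (Suc i) (idx x (Suc i)) (idx x (Suc i)))"
      using fun_cong[OF eq, of "munit (Suc i) (idx x (Suc i)) (idx x (Suc i))"] munit_in_CB[of "Suc i"] by simp
    then show ?thesis
      using character_munit[OF \<xi>, of "Suc i"] character_munit[OF \<eta>c, of "Suc i"] \<eta>x
      by (simp split: if_splits)
  qed
  then show "x = path_of \<xi>"
    using idx_eq_iff[of "path_of \<xi>" x "Suc _"] path_of_in[OF \<xi>] x by (metis ext le_add1 lessI plus_1_eq_Suc)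
qed

text \<open>The preimage of a cylinder is the set where its diagonal projection does not vanish,
  which is open for pointwise convergence.\<close>

lemma continuous_anchor: "continuous_map (spectrum_top limit) (path_space V) (anchor V \<Phi>)"
  unfolding path_space_def
proof (rule continuous_on_generated_topo)
  fix U assume "U \<in> {cylinder V p | p n. p \<in> fin_paths V n}"
  then obtain z n where z: "z \<in> inf_paths V" "U = cylinder V (prefix z n)" by (auto simp: fin_paths_eq)
  show "openin (spectrum_top limit) (anchor V \<Phi> -` U \<inter> topspace (spectrum_top limit))"
  proof (cases "n = 0")
    \<comment> \<open>There is no matrix unit of level \<open>0\<close>; the cylinder of the empty
      path is the whole path space.\<close>
    case True
    then have "anchor V \<Phi> -` U \<inter> topspace (spectrum_top limit) = topspace (spectrum_top limit)"
      using z path_of_in by (auto simp: anchor_eq cylinder_def)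
    then show ?thesis by (metis openin_topspace)
  next
    case False
    then have n: "n \<ge> 1" by simp
    let ?e = "munit n (idx z n) (idx z n)"
    have "anchor V \<Phi> -` U \<inter> topspace (spectrum_top limit) =
        {\<xi> \<in> topspace (spectrum_top limit). \<xi> ?e \<in> - {0}}"
      using idx_eq_iff[OF path_of_in z(1) n] path_of_in
      by (auto simp: z(2) cylinder_prefix anchor_eq character_munit[OF _ n] split: if_splits)
    also have "openin (spectrum_top limit) \<dots>"
      by (rule openin_continuous_map_preimage[OF continuous_map_character[OF munit_in_limit[OF n]]])
        (simp add: open_Compl)
    finally show ?thesis .
  qed
next
  have "path_of \<xi> \<in> cylinder V []" if "\<xi> \<in> characters limit" for \<xi>
    using path_of_in[OF that] by (simp add: cylinder_def)
  moreover have "[] \<in> fin_paths V 0" by (simp add: fin_paths_def)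
  ultimately show "anchor V \<Phi> ` topspace (spectrum_top limit) \<subseteq> \<Union> {cylinder V p | p n. p \<in> fin_paths V n}"
    by (auto simp: anchor_eq)
qed

lemma topspace_path_space: "topspace (path_space V) = inf_paths V"
proof -
  have "cylinder V [] = inf_paths V" "[] \<in> fin_paths V 0" by (auto simp: cylinder_def fin_paths_def)
  then show ?thesis
    by (fastforce simp: path_space_def topology_generated_by_topspace cylinder_def)
qed

lemma topspace_fibre: "topspace (fibre_top V \<Phi> x) = {\<xi> \<in> characters limit. path_of \<xi> = x}"
  by (auto simp: fibre_top_def canonical_diagonal_eq anchor_eq)

end

section \<open>The homeomorphism type of the fibres\<close>

lemma homeomorphic_space_singletonI:
  assumes "topspace T = {a}"
  shows "T homeomorphic_space discrete_topology {()}"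
proof -
  have "homeomorphic_maps T (discrete_topology {()}) (\<lambda>_. ()) (\<lambda>_. a)"
    using assms by (simp add: homeomorphic_maps_def)
  then show ?thesis by (auto simp: homeomorphic_space_def)
qed

lemma homeomorphic_space_product_reindex:
  assumes "bij_betw h I K"
  shows "product_topology (\<lambda>_. T) K homeomorphic_space product_topology (\<lambda>_. T) I"
proof -
  let ?g = "inv_into I h"
  have h: "h i \<in> K" "?g (h i) = i" if "i \<in> I" for i
    using assms that by (auto simp: bij_betw_def inv_into_f_f)
  have g: "?g j \<in> I" "h (?g j) = j" if "j \<in> K" for j
    using assms that by (auto simp: bij_betw_def inv_into_into f_inv_into_f)
  have "homeomorphic_maps (product_topology (\<lambda>_. T) K) (product_topology (\<lambda>_. T) I)
      (\<lambda>f. \<lambda>i\<in>I. f (h i)) (\<lambda>f. \<lambda>j\<in>K. f (?g j))"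
    unfolding homeomorphic_maps_def
  proof (intro conjI ballI)
    show "continuous_map (product_topology (\<lambda>_. T) K) (product_topology (\<lambda>_. T) I) (\<lambda>f. \<lambda>i\<in>I. f (h i))"
      using h by (auto simp: continuous_map_componentwise intro!: continuous_map_product_projection)
    show "continuous_map (product_topology (\<lambda>_. T) I) (product_topology (\<lambda>_. T) K) (\<lambda>f. \<lambda>j\<in>K. f (?g j))"
      using g by (auto simp: continuous_map_componentwise intro!: continuous_map_product_projection)
    show "(\<lambda>j\<in>K. (\<lambda>i\<in>I. f (h i)) (?g j)) = f" if "f \<in> topspace (product_topology (\<lambda>_. T) K)" for f
      using that g by (auto simp: fun_eq_iff PiE_def extensional_def)
    show "(\<lambda>i\<in>I. (\<lambda>j\<in>K. f (?g j)) (h i)) = f" if "f \<in> topspace (product_topology (\<lambda>_. T) I)" for f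
      using that h by (auto simp: fun_eq_iff PiE_def extensional_def)
  qed
  then show ?thesis by (auto simp: homeomorphic_space_def)
qed

context projection_tail
begin

text \<open>A continuous bijection from a compact space to a Hausdorff space is a homeomorphism. The
  map goes from the product into the fibre because in this direction continuity can be tested on the
  levels.\<close>

lemma fibre_homeomorphic_product:
  "product_topology (\<lambda>_. X) J homeomorphic_space fibre_top V \<Phi> x"
proof -
  define F where "F z = (SOME \<xi>. located \<xi> x (point z))" for z
  have F: "located (F z) x (point z)" if "z \<in> topspace X_J" for z
    unfolding F_def by (rule someI_ex[OF character_at[OF x point_in_fibre[OF that]]])
  have "homeomorphic_map X_J (fibre_top V \<Phi> x) F"
  proof (rule continuous_imp_homeomorphic_map)
    show "compact_space X_J" using X(1) by (simp add: compact_space_product_topology)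
    show "Hausdorff_space (fibre_top V \<Phi> x)"
      unfolding fibre_top_def by (intro Hausdorff_space_subtopology Hausdorff_spectrum)
    show "continuous_map X_J (fibre_top V \<Phi> x) F"
      unfolding fibre_top_def canonical_diagonal_eq continuous_map_in_subtopology
    proof (intro conjI)
      show "continuous_map X_J (spectrum_top limit) F"
      proof (rule continuous_map_into_spectrum)
        show "F \<in> topspace X_J \<rightarrow> characters limit"
          using F locatedD(1) by blast
        fix i and f :: "(nat \<Rightarrow> 'x) \<times> nat \<Rightarrow> complex"
        assume i: "i \<ge> 1" and f: "continuous_map (level_space i) euclidean f"
        have "continuous_map (Y i) euclidean (\<lambda>y. f (y, idx x i))"
          using f idx_less[OF x i] by (simp add: level_space_def continuous_map_prod_discrete_iff)
        from continuous_map_compose[OF continuous_point[OF i] this]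
        have "continuous_map X_J euclidean (\<lambda>z. f (point z i, idx x i))"
          by (simp add: o_def)
        then show "continuous_map X_J euclidean (\<lambda>z. F z (diag i f))"
          by (rule continuous_map_eq) (use locatedD(4)[OF F i f] in simp)
      qed
      show "F \<in> topspace X_J \<rightarrow> {\<xi>. anchor V \<Phi> \<xi> = x}"
      proof
        fix z assume "z \<in> topspace X_J"
        from F[OF this] show "F z \<in> {\<xi>. anchor V \<Phi> \<xi> = x}"
          by (simp add: anchor_eq[OF locatedD(1)] path_of_eq)
      qed
    qed
    show "F ` topspace X_J = topspace (fibre_top V \<Phi> x)"
    proof (intro equalityI subsetI)
      fix \<xi> assume "\<xi> \<in> F ` topspace X_J"
      then obtain z where "located \<xi> x (point z)" using F by blast
      then show "\<xi> \<in> topspace (fibre_top V \<Phi> x)"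
        by (simp add: topspace_fibre path_of_eq locatedD(1))
    next
      fix \<xi> assume "\<xi> \<in> topspace (fibre_top V \<Phi> x)"
      then have \<xi>: "\<xi> \<in> characters limit" "path_of \<xi> = x" by (simp_all add: topspace_fibre)
      then obtain y where y: "located \<xi> x y" using path_of_located by blast
      obtain z where z: "z \<in> topspace X_J" "\<And>i. i \<ge> 1 \<Longrightarrow> point z i = y i"
        using point_surj[OF locatedD(3)[OF y]] by blast
      have "\<xi> = F z"
      proof (rule characters_eqI[OF \<xi>(1) locatedD(1)[OF F[OF z(1)]]])
        fix i and f :: "(nat \<Rightarrow> 'x) \<times> nat \<Rightarrow> complex"
        assume i: "i \<ge> 1" and f: "continuous_map (level_space i) euclidean f"
        show "\<xi> (diag i f) = F z (diag i f)"
          using locatedD(4)[OF y i f] locatedD(4)[OF F[OF z(1)] i f] z(2)[OF i] by simp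
      qed
      with z(1) show "\<xi> \<in> F ` topspace X_J" by blast
    qed
    show "inj_on F (topspace X_J)"
    proof (rule inj_onI)
      fix z z' assume z: "z \<in> topspace X_J"
        "z' \<in> topspace X_J" and eq: "F z = F z'"
      show "z = z'"
      proof (rule point_inj[OF z])
        fix i :: nat assume "i \<ge> 1"
        then show "point z i = point z' i"
          using located_point_unique[OF F[OF z(1)], of x "point z'" i] F[OF z(2)] eq by simp
      qed
    qed
  qed
  then show ?thesis by (rule homeomorphic_map_imp_homeomorphic_space)
qed

lemma fibre_homeomorphic_power:
  "(\<exists>n\<ge>1. fibre_top V \<Phi> x homeomorphic_space power_top X n) \<or>
    fibre_top V \<Phi> x homeomorphic_space product_topology (\<lambda>_. X) (UNIV :: nat set)"
proof -
  have J: "fibre_top V \<Phi> x homeomorphic_space product_topology (\<lambda>_. X) J"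
    using fibre_homeomorphic_product homeomorphic_space_sym by blast
  show ?thesis
  proof (cases "finite J")
    case True
    then obtain h where "bij_betw h {..<card J} J"
      using ex_bij_betw_nat_finite[OF True] by (auto simp: atLeast0LessThan)
    from homeomorphic_space_product_reindex[OF this, of X]
    have "fibre_top V \<Phi> x homeomorphic_space power_top X (card J)"
      using J unfolding power_top_def by (rule homeomorphic_space_trans[rotated])
    moreover have "card J \<ge> 1" using True J_nonempty by (simp add: Suc_le_eq card_gt_0_iff)
    ultimately show ?thesis by blast
  next
    case False
    then obtain h :: "nat \<Rightarrow> int" where "bij_betw h UNIV J"
      using bij_betw_from_nat_into[of J] by auto
    from homeomorphic_space_product_reindex[OF this, of X] J show ?thesis
      using homeomorphic_space_trans by blast
  qed
qed

end

context villadsen_limit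
begin

text \<open>With infinitely many constant edges the points over \<open>x\<close> are unique at every
  level, so any two characters over \<open>x\<close> coincide; otherwise \<open>x\<close> has
  nothing but projections from some level on.\<close>

lemma fibre_cases:
  assumes x: "x \<in> inf_paths V"
  shows "fibre_top V \<Phi> x homeomorphic_space discrete_topology {()} \<or>
    (\<exists>n\<ge>1. fibre_top V \<Phi> x homeomorphic_space power_top X n) \<or>
    fibre_top V \<Phi> x homeomorphic_space product_topology (\<lambda>_. X) (UNIV :: nat set)"
proof (cases "finite (const_edges x)")
  case False
  obtain y \<xi> where \<xi>: "located \<xi> x y" using character_at[OF x] fibre_points_nonempty[OF x] by blast
  have "\<eta> = \<xi>" if \<eta>: "\<eta> \<in> characters limit" "path_of \<eta> = x" for \<eta>
  proof -
    obtain w where w: "located \<eta> x w" using path_of_located[OF \<eta>(1)] \<eta>(2) by blast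
    show ?thesis
    proof (rule characters_eqI[OF \<eta>(1) locatedD(1)[OF \<xi>]])
      fix i and f :: "(nat \<Rightarrow> 'x) \<times> nat \<Rightarrow> complex"
      assume i: "i \<ge> 1" and f: "continuous_map (level_space i) euclidean f"
      show "\<eta> (diag i f) = \<xi> (diag i f)"
        using locatedD(4)[OF w i f] locatedD(4)[OF \<xi> i f]
          fibre_points_const_unique[OF False locatedD(3)[OF w] locatedD(3)[OF \<xi>] i] by simp
    qed
  qed
  then have "topspace (fibre_top V \<Phi> x) = {\<xi>}"
    using locatedD(1)[OF \<xi>] path_of_eq[OF \<xi>] unfolding topspace_fibre by blast
  then show ?thesis by (intro disjI1 homeomorphic_space_singletonI)
next
  case True
  obtain N where "projection_tail V \<Phi> x N" using ex_projection_tail[OF x True] by blast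
  then interpret projection_tail V \<Phi> x N .
  show ?thesis using fibre_homeomorphic_power by (rule disjI2)
qed

end


section \<open>Germs\<close>

lemma germ_cong:
  assumes "openin T U" "x \<in> U" "U \<subseteq> dom f \<inter> dom g" "\<And>z. z \<in> U \<Longrightarrow> f z = g z"
  shows "germ T S f x = germ T S g x"
proof -
  have "germ T S f x \<subseteq> germ T S g x"
    if U: "openin T U" "x \<in> U" "U \<subseteq> dom f \<inter> dom g" "\<And>z. z \<in> U \<Longrightarrow> f z = g z" for f g
  proof
    fix a assume "a \<in> germ T S f x"
    then obtain h W where a: "a = (h, x)" "h \<in> S" "openin T W" "x \<in> W" "W \<subseteq> dom f \<inter> dom h"
      "\<And>z. z \<in> W \<Longrightarrow> f z = h z" by (auto simp: germ_def)
    have "openin T (U \<inter> W)" "x \<in> U \<inter> W" "U \<inter> W \<subseteq> dom g \<inter> dom h"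
      using U a by (auto intro: openin_Int)
    moreover have "\<forall>z\<in>U \<inter> W. g z = h z" by (metis IntE U(4) a(6))
    ultimately show "a \<in> germ T S g x" using a(1,2) unfolding germ_def by blast
  qed
  from this[of f g] this[of g f] assms show ?thesis by auto
qed

lemma germ_memI: "f \<in> S \<Longrightarrow> openin T (dom f) \<Longrightarrow> x \<in> dom f \<Longrightarrow> (f, x) \<in> germ T S f x"
  unfolding germ_def by blast

lemma germ_memD:
  assumes "(g, y) \<in> germ T S f x"
  shows "y = x" "g \<in> S"
    "\<exists>U. openin T U \<and> x \<in> U \<and> U \<subseteq> dom f \<inter> dom g \<and> (\<forall>z\<in>U. f z = g z)"
  using assms by (auto simp: germ_def)


section \<open>The partial homeomorphisms of normalisers\<close>

context villadsen_limit
begin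

abbreviation T :: "('a \<Rightarrow> complex) topology" where "T \<equiv> spectrum_top limit"
abbreviation \<alpha> :: "'a \<Rightarrow> ('a \<Rightarrow> complex) \<rightharpoonup> ('a \<Rightarrow> complex)" where "\<alpha> \<equiv> normaliser_map limit"
abbreviation \<S> :: "(('a \<Rightarrow> complex) \<rightharpoonup> ('a \<Rightarrow> complex)) set" where "\<S> \<equiv> \<alpha> ` normalisers limit"

lemma normaliserD:
  assumes "n \<in> normalisers limit"
  shows "c \<in> limit \<Longrightarrow> star n * c * n \<in> limit" "c \<in> limit \<Longrightarrow> n * c * star n \<in> limit"
    "star n * n \<in> limit" "n * star n \<in> limit"
proof -
  show *: "c \<in> limit \<Longrightarrow> star n * c * n \<in> limit" "c \<in> limit \<Longrightarrow> n * c * star n \<in> limit" for c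
    using assms by (auto simp: normalisers_def)
  from *[of 1] limit_closed(1) show "star n * n \<in> limit" "n * star n \<in> limit" by simp_all
qed

lemma dom_\<alpha>: "dom (\<alpha> n) = {\<xi> \<in> characters limit. \<xi> (star n * n) \<noteq> 0}"
  by (auto simp: normaliser_map_def split: if_splits)

lemma \<alpha>_SomeD: "\<alpha> n \<xi> = Some \<eta> \<Longrightarrow> \<xi> \<in> characters limit \<and> \<xi> (star n * n) \<noteq> 0 \<and>
    \<eta> = (\<lambda>c\<in>limit. \<xi> (star n * c * n) / \<xi> (star n * n))"
  by (auto simp: normaliser_map_def split: if_splits)

lemma openin_character_preimage: "a \<in> limit \<Longrightarrow> open O' \<Longrightarrow> openin T {\<xi> \<in> characters limit. \<xi> a \<in> O'}"
  using openin_continuous_map_preimage[OF continuous_map_character, of a limit O'] by simp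

lemma openin_dom_\<alpha>:
  assumes "n \<in> normalisers limit"
  shows "openin T (dom (\<alpha> n))"
  using openin_character_preimage[OF normaliserD(3)[OF assms], of "- {0}"]
  by (simp add: dom_\<alpha> open_Compl)

text \<open>Multiplicativity of \<open>c \<mapsto> \<xi>(n*cn) / \<xi>(n*n)\<close> uses that \<open>nn*\<close> lies in the commutative algebra \<open>C\<close>, so
  that \<open>(n*cn)(n*dn) = (n*n)(n*cdn)\<close>.\<close>

lemma \<alpha>_character:
  assumes n: "n \<in> normalisers limit" and \<alpha>: "\<alpha> n \<xi> = Some \<eta>"
  shows "\<eta> \<in> characters limit"
proof -
  note N = normaliserD[OF n]
  have \<xi>: "\<xi> \<in> characters limit" "\<xi> (star n * n) \<noteq> 0"
    and \<eta>: "\<eta> = (\<lambda>c\<in>limit. \<xi> (star n * c * n) / \<xi> (star n * n))" using \<alpha>_SomeD[OF \<alpha>] by auto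
  note ch = characterD[OF \<xi>(1) subalgebra_limit]
  have mult: "\<xi> (star n * (c * d) * n) * \<xi> (star n * n) = \<xi> (star n * c * n) * \<xi> (star n * d * n)"
    if cd: "c \<in> limit" "d \<in> limit" for c d
  proof -
    have "(star n * c * n) * (star n * d * n) = star n * (c * (n * star n)) * d * n"
      by (simp add: mult.assoc)
    also have "c * (n * star n) = n * star n * c" by (rule limit_commute[OF cd(1) N(4)])
    finally have "(star n * c * n) * (star n * d * n) = (star n * n) * (star n * (c * d) * n)"
      by (simp add: mult.assoc)
    then show ?thesis
      using ch(2)[OF N(1)[OF cd(1)] N(1)[OF cd(2)]]
        ch(2)[OF N(3) N(1)[OF limit_closed(3)[OF cd]]] by (simp add: mult.commute)
  qed
  have 1: "\<eta> (c + d) = \<eta> c + \<eta> d \<and> \<eta> (c * d) = \<eta> c * \<eta> d" if cd: "c \<in> limit" "d \<in> limit" for c d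
  proof
    have "star n * (c + d) * n = star n * c * n + star n * d * n" by (simp add: algebra_simps)
    then show "\<eta> (c + d) = \<eta> c + \<eta> d"
      using ch(1)[OF N(1)[OF cd(1)] N(1)[OF cd(2)]] cd limit_closed(2)[OF cd]
      by (simp add: \<eta> add_divide_distrib)
    show "\<eta> (c * d) = \<eta> c * \<eta> d"
      using mult[OF cd] cd limit_closed(3)[OF cd] \<xi>(2) by (simp add: \<eta> field_simps)
  qed
  have 2: "\<eta> (scaleC z c) = z * \<eta> c" if c: "c \<in> limit" for z c
  proof -
    have "star n * scaleC z c * n = scaleC z (star n * c * n)"
      by (simp add: mult_scaleC_left mult_scaleC_right)
    then show ?thesis using ch(3)[OF N(1)[OF c], of z] c limit_closed(4)[OF c, of z] by (simp add: \<eta>)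
  qed
  have 3: "\<exists>c\<in>limit. \<eta> c \<noteq> 0" using limit_closed(1) \<xi>(2) by (intro bexI[of _ 1]) (simp_all add: \<eta>)
  have 4: "\<eta> \<in> extensional limit" by (simp add: \<eta>)
  show ?thesis unfolding characters_def mem_Collect_eq by (intro conjI ballI allI 1 2 3 4)
qed

lemma continuous_\<alpha>:
  assumes n: "n \<in> normalisers limit"
  shows "continuous_map (subtopology T (dom (\<alpha> n))) T (\<lambda>\<xi>. the (\<alpha> n \<xi>))"
proof -
  have top: "topspace (subtopology T (dom (\<alpha> n))) = dom (\<alpha> n)" by (auto simp: dom_\<alpha>)
  have val: "\<alpha> n \<xi> = Some (\<lambda>c\<in>limit. \<xi> (star n * c * n) / \<xi> (star n * n))" if "\<xi> \<in> dom (\<alpha> n)" for \<xi>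
    using that \<alpha>_SomeD[of n \<xi>] by auto
  have "continuous_map (subtopology T (dom (\<alpha> n))) euclidean (\<lambda>\<xi>. the (\<alpha> n \<xi>) c)" if c: "c \<in> limit" for c
  proof (rule continuous_map_eq)
    have "continuous_map (subtopology T (dom (\<alpha> n))) euclidean (\<lambda>\<xi>. \<xi> (star n * c * n))"
      "continuous_map (subtopology T (dom (\<alpha> n))) euclidean (\<lambda>\<xi>. \<xi> (star n * n))"
      using normaliserD(1)[OF n c] normaliserD(3)[OF n]
      by (auto intro: continuous_map_from_subtopology continuous_map_character)
    then show "continuous_map (subtopology T (dom (\<alpha> n))) euclidean (\<lambda>\<xi>. \<xi> (star n * c * n) / \<xi> (star n * n))"
      unfolding continuous_map_euclidean_iff top by (auto simp: dom_\<alpha> intro!: tendsto_divide)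
    show "\<xi> (star n * c * n) / \<xi> (star n * n) = the (\<alpha> n \<xi>) c"
      if "\<xi> \<in> topspace (subtopology T (dom (\<alpha> n)))" for \<xi>
      using val[of \<xi>] that c unfolding top by simp
  qed
  moreover have "the (\<alpha> n \<xi>) \<in> characters limit" if "\<xi> \<in> dom (\<alpha> n)" for \<xi>
    using \<alpha>_character[OF n val[OF that]] val[OF that] by simp
  moreover from this have "the (\<alpha> n \<xi>) \<in> extensional limit" if "\<xi> \<in> dom (\<alpha> n)" for \<xi>
    using that by (auto simp: characters_def)
  ultimately show ?thesis
    unfolding spectrum_top_def[of limit] continuous_map_in_subtopology continuous_map_componentwise
    unfolding spectrum_top_def[of limit, symmetric] top by auto
qed

text \<open>Serves the product of germs: the first map is restricted to the open set that it carries
  into a neighbourhood on which the second one is known.\<close>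

lemma openin_\<alpha>_preimage:
  assumes n: "n \<in> normalisers limit" and W: "openin T W"
  shows "openin T {\<xi> \<in> dom (\<alpha> n). the (\<alpha> n \<xi>) \<in> W}"
proof -
  have "openin (subtopology T (dom (\<alpha> n))) {\<xi> \<in> topspace (subtopology T (dom (\<alpha> n))). the (\<alpha> n \<xi>) \<in> W}"
    by (rule openin_continuous_map_preimage[OF continuous_\<alpha>[OF n] W])
  moreover have "{\<xi> \<in> topspace (subtopology T (dom (\<alpha> n))). the (\<alpha> n \<xi>) \<in> W} =
      {\<xi> \<in> dom (\<alpha> n). the (\<alpha> n \<xi>) \<in> W}" by (auto simp: dom_\<alpha>)
  ultimately show ?thesis using openin_trans_full[OF _ openin_dom_\<alpha>[OF n]] by simp
qed


section \<open>The partial homeomorphisms of pairs of paths\<close>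

definition swap_unit :: "nat \<Rightarrow> (nat \<Rightarrow> nat) \<Rightarrow> (nat \<Rightarrow> nat) \<Rightarrow> 'a" where
  "swap_unit n x z = munit n (idx x n) (idx z n)"

text \<open>The partial homeomorphism of the matrix unit, from characters over the prefix of
  \<open>z\<close> to characters over the prefix of \<open>x\<close>; so \<open>z\<close> belongs to
  the source and \<open>x\<close> to the range.\<close>

definition swap :: "nat \<Rightarrow> (nat \<Rightarrow> nat) \<Rightarrow> (nat \<Rightarrow> nat) \<Rightarrow> ('a \<Rightarrow> complex) \<rightharpoonup> ('a \<Rightarrow> complex)" where
  "swap n x z = \<alpha> (swap_unit n x z)"

definition tail_eq :: "nat \<Rightarrow> (nat \<Rightarrow> nat) \<Rightarrow> (nat \<Rightarrow> nat) \<Rightarrow> bool" where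
  "tail_eq n x z \<longleftrightarrow> n \<ge> 1 \<and> x \<in> inf_paths V \<and> z \<in> inf_paths V \<and> (\<forall>j\<ge>n. x j = z j)"

lemma swap_unit_normaliser:
  "n \<ge> 1 \<Longrightarrow> x \<in> inf_paths V \<Longrightarrow> z \<in> inf_paths V \<Longrightarrow> swap_unit n x z \<in> normalisers limit"
  unfolding swap_unit_def by (intro munit_normaliser idx_less)

lemma star_swap_unit: "n \<ge> 1 \<Longrightarrow> star (swap_unit n x z) = swap_unit n z x"
  by (simp add: swap_unit_def star_munit)

lemma swap_unit_mult:
  "n \<ge> 1 \<Longrightarrow> z \<in> inf_paths V \<Longrightarrow> swap_unit n x z * swap_unit n z w = swap_unit n x w"
  by (simp add: swap_unit_def munit_mult idx_less)

lemma swap_unit_in_limit: "n \<ge> 1 \<Longrightarrow> swap_unit n x x \<in> limit"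
  by (simp add: swap_unit_def munit_in_limit)

lemma character_swap_unit:
  "\<xi> \<in> characters limit \<Longrightarrow> n \<ge> 1 \<Longrightarrow>
    \<xi> (swap_unit n z z) = (if idx (path_of \<xi>) n = idx z n then 1 else 0)"
  by (simp add: swap_unit_def character_munit)

text \<open>On the domain the character takes the value \<open>1\<close> at the source projection,
  so the denominator in \<open>normaliser_map\<close> disappears.\<close>

lemma swap_eq:
  assumes "n \<ge> 1" "x \<in> inf_paths V"
  shows "swap n x z \<xi> = (if \<xi> \<in> characters limit \<and> idx (path_of \<xi>) n = idx z n
     then Some (\<lambda>c\<in>limit. \<xi> (swap_unit n z x * c * swap_unit n x z)) else None)"
  using character_swap_unit[OF _ assms(1), of \<xi> z]
  by (auto simp: swap_def normaliser_map_def star_swap_unit[OF assms(1)] swap_unit_mult[OF assms(1,2)]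
      split: if_splits)

lemma dom_swap:
  "n \<ge> 1 \<Longrightarrow> x \<in> inf_paths V \<Longrightarrow> dom (swap n x z) = {\<xi> \<in> characters limit. idx (path_of \<xi>) n = idx z n}"
  by (auto simp: swap_eq split: if_splits)

lemma swap_in_\<S>: "n \<ge> 1 \<Longrightarrow> x \<in> inf_paths V \<Longrightarrow> z \<in> inf_paths V \<Longrightarrow> swap n x z \<in> \<S>"
  unfolding swap_def by (intro imageI swap_unit_normaliser)

lemma openin_dom_swap:
  "n \<ge> 1 \<Longrightarrow> x \<in> inf_paths V \<Longrightarrow> z \<in> inf_paths V \<Longrightarrow> openin T (dom (swap n x z))"
  unfolding swap_def by (intro openin_dom_\<alpha> swap_unit_normaliser)

lemma swap_character:
  "n \<ge> 1 \<Longrightarrow> x \<in> inf_paths V \<Longrightarrow> z \<in> inf_paths V \<Longrightarrow> swap n x z \<xi> = Some \<eta> \<Longrightarrow> \<eta> \<in> characters limit"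
  unfolding swap_def using \<alpha>_character swap_unit_normaliser by blast

lemma swap_cong: "idx x n = idx x' n \<Longrightarrow> idx z n = idx z' n \<Longrightarrow> swap n x z = swap n x' z'"
  by (simp add: swap_def swap_unit_def)

text \<open>By \<open>munit_refine\<close> the finer unit is the coarser one times a projection at
  which \<xi> is \<open>1\<close>; in the conjugation formula this projection drops out.\<close>

lemma swap_refine:
  assumes tail: "tail_eq n x z" and nm: "n \<le> m"
    and \<xi>: "\<xi> \<in> characters limit" "idx (path_of \<xi>) m = idx z m"
  shows "swap m x z \<xi> = swap n x z \<xi>" "idx (path_of \<xi>) n = idx z n"
proof -
  have n: "n \<ge> 1" "x \<in> inf_paths V" "z \<in> inf_paths V" "\<And>j. j \<ge> n \<Longrightarrow> x j = z j"
    using tail by (auto simp: tail_eq_def)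
  have m: "m \<ge> 1" using n nm by simp
  show idx: "idx (path_of \<xi>) n = idx z n"
    using idx_mod[OF path_of_in[OF \<xi>(1)] n(1) nm] idx_mod[OF n(3,1) nm] \<xi>(2) by simp
  have eq: "swap_unit m x z = swap_unit n x z * swap_unit m z z"
    unfolding swap_unit_def
    using munit_refine[OF n(1) nm idx_less[OF n(2) m] idx_less[OF n(3) m] idx_div_tail[OF n(2,3,1) nm n(4)]]
    by (simp add: idx_mod[OF n(2,1) nm] idx_mod[OF n(3,1) nm])
  have eq': "swap_unit m z x = swap_unit m z z * swap_unit n z x"
    using arg_cong[OF eq, of star] by (simp add: star_mult star_swap_unit[OF m] star_swap_unit[OF n(1)])
  have "\<xi> (swap_unit m z x * c * swap_unit m x z) = \<xi> (swap_unit n z x * c * swap_unit n x z)"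
    if c: "c \<in> limit" for c
  proof -
    note ch = characterD[OF \<xi>(1) subalgebra_limit]
    have w: "swap_unit n z x * c * swap_unit n x z \<in> limit"
      using normaliserD(1)[OF swap_unit_normaliser[OF n(1-3)] c] by (simp add: star_swap_unit[OF n(1)])
    have u: "swap_unit m z z \<in> limit" "\<xi> (swap_unit m z z) = 1"
      using swap_unit_in_limit[OF m] character_swap_unit[OF \<xi>(1) m] \<xi>(2) by simp_all
    have "swap_unit m z x * c * swap_unit m x z =
        swap_unit m z z * (swap_unit n z x * c * swap_unit n x z) * swap_unit m z z"
      unfolding eq eq' by (simp add: mult.assoc)
    then show ?thesis using ch(2)[OF limit_closed(3)[OF u(1) w] u(1)] ch(2)[OF u(1) w] u(2) by simp
  qed
  then have "(\<lambda>c\<in>limit. \<xi> (swap_unit m z x * c * swap_unit m x z)) =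
      (\<lambda>c\<in>limit. \<xi> (swap_unit n z x * c * swap_unit n x z))" by (rule restrict_ext)
  then show "swap m x z \<xi> = swap n x z \<xi>"
    using \<xi> idx by (simp add: swap_eq[OF m n(2)] swap_eq[OF n(1,2)])
qed

text \<open>Under the swap of any level \<open>m >= n\<close>, the value of \<eta> at the projection
  of \<open>x\<close> is the value of \<xi> at that of \<open>z\<close>, namely \<open>1\<close>.
  Letting \<open>m\<close> grow gives every edge.\<close>

lemma path_of_swap:
  assumes tail: "tail_eq n x z" and \<xi>: "\<xi> \<in> characters limit" "path_of \<xi> = z"
    and \<eta>: "swap n x z \<xi> = Some \<eta>"
  shows "path_of \<eta> = x"
proof
  have n: "n \<ge> 1" "x \<in> inf_paths V" "z \<in> inf_paths V" using tail by (auto simp: tail_eq_def)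
  have \<eta>c: "\<eta> \<in> characters limit" by (rule swap_character[OF n \<eta>])
  fix i
  define m where "m = max n (Suc i)"
  have m: "m \<ge> 1" "n \<le> m" "i < m" using n(1) by (auto simp: m_def)
  have "swap m x z \<xi> = Some \<eta>" using swap_refine(1)[OF tail m(2) \<xi>(1)] \<xi>(2) \<eta> by simp
  then have "\<eta> = (\<lambda>c\<in>limit. \<xi> (swap_unit m z x * c * swap_unit m x z))"
    by (simp add: swap_eq[OF m(1) n(2)] split: if_splits)
  then have "\<eta> (swap_unit m x x) = \<xi> (swap_unit m z z)"
    using swap_unit_in_limit[OF m(1), of x] by (simp add: swap_unit_mult[OF m(1)] n)
  also have "\<dots> = 1" using character_swap_unit[OF \<xi>(1) m(1)] \<xi>(2) by simp
  finally have "idx (path_of \<eta>) m = idx x m"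
    using character_swap_unit[OF \<eta>c m(1), of x] by (simp split: if_splits)
  then show "path_of \<eta> i = x i"
    using idx_eq_iff[OF path_of_in[OF \<eta>c] n(2) m(1)] m(3) by simp
qed

text \<open>The arrow with source \<open>z'\<close> in the basic set of the length \<open>n\<close> prefixes of \<open>x\<close> and \<open>z\<close>.\<close>

lemma graft:
  assumes "n \<ge> 1" "x \<in> inf_paths V" "z' \<in> inf_paths V"
  defines "x' \<equiv> (\<lambda>i. if i < n then x i else z' i)"
  shows "tail_eq n x' z'" "idx x' n = idx x n" "\<And>i. i < n \<Longrightarrow> x' i = x i"
  using assms by (auto simp: tail_eq_def x'_def inf_paths_def idx_eq)

lemma bicylinder_prefix:
  "(x', z') \<in> bicylinder V (prefix x n) (prefix z n) \<longleftrightarrow>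
     x' \<in> inf_paths V \<and> z' \<in> inf_paths V \<and> (\<forall>i<n. x' i = x i) \<and> (\<forall>i<n. z' i = z i) \<and> (\<forall>j\<ge>n. x' j = z' j)"
  by (auto simp: bicylinder_def cylinder_prefix)

text \<open>The formula that defines \<open>path_action\<close> is imposed for every admissible pair
  of prefixes; the instances agree because two levels are both refined by their maximum.\<close>

lemma path_action_eq:
  assumes tail: "tail_eq n x z" and \<xi>: "\<xi> \<in> characters limit" "path_of \<xi> = z"
  shows "swap n x z \<xi> = Some (path_action V \<Phi> (x, z) \<xi>)"
proof -
  have n: "n \<ge> 1" "x \<in> inf_paths V" "z \<in> inf_paths V" using tail by (auto simp: tail_eq_def)
  have sw: "swap m x z \<xi> = Some (\<lambda>c\<in>limit. \<xi> (swap_unit m z x * c * swap_unit m x z))" if "m \<ge> 1" for m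
    using \<xi> by (simp add: swap_eq[OF that n(2)])
  define \<eta> where "\<eta> = (\<lambda>c\<in>limit. \<xi> (swap_unit n z x * c * swap_unit n x z))"
  have "path_action V \<Phi> (x, z) \<xi> = \<eta>"
    unfolding path_action_def canonical_diagonal_eq
  proof (rule the_equality)
    have "\<eta> c = \<xi> (star (path_unit V \<Phi> p q) * c * path_unit V \<Phi> p q)"
      if m: "m \<ge> 1" "p \<in> fin_paths V m" "q \<in> fin_paths V m" "(x, z) \<in> bicylinder V p q" "c \<in> limit" for m p q c
    proof -
      obtain p' q' where pq: "p = prefix p' m" "q = prefix q' m" using m(2,3) by (auto simp: fin_paths_eq)
      have b: "\<forall>i<m. x i = p' i" "\<forall>i<m. z i = q' i" "\<forall>j\<ge>m. x j = z j"
        using m(4) by (simp_all add: pq bicylinder_prefix)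
      have pre: "p = prefix x m" "q = prefix z m" using b by (auto simp: pq)
      have tm: "tail_eq m x z" using n m(1) b(3) by (simp add: tail_eq_def)
      have "swap m x z \<xi> = swap n x z \<xi>"
        using swap_refine(1)[OF tail _ \<xi>(1), of "max m n"] swap_refine(1)[OF tm _ \<xi>(1), of "max m n"] \<xi>(2) by simp
      then have "(\<lambda>c\<in>limit. \<xi> (swap_unit m z x * c * swap_unit m x z)) = \<eta>"
        using sw[OF m(1)] sw[OF n(1)] by (simp add: \<eta>_def)
      from fun_cong[OF this, of c] m(5) show ?thesis
        by (simp add: pre path_unit_prefix swap_unit_def[symmetric] star_swap_unit[OF m(1)])
    qed
    then show "\<eta> \<in> extensional limit \<and> (\<forall>n\<ge>1. \<forall>p\<in>fin_paths V n. \<forall>q\<in>fin_paths V n.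
        (x, z) \<in> bicylinder V p q \<longrightarrow>
        (\<forall>c\<in>limit. \<eta> c = \<xi> (star (path_unit V \<Phi> p q) * c * path_unit V \<Phi> p q)))"
      by (simp add: \<eta>_def)
    fix \<psi> assume \<psi>: "\<psi> \<in> extensional limit \<and> (\<forall>n\<ge>1. \<forall>p\<in>fin_paths V n. \<forall>q\<in>fin_paths V n.
        (x, z) \<in> bicylinder V p q \<longrightarrow>
        (\<forall>c\<in>limit. \<psi> c = \<xi> (star (path_unit V \<Phi> p q) * c * path_unit V \<Phi> p q)))"
    have "prefix x n \<in> fin_paths V n" "prefix z n \<in> fin_paths V n" using n by (auto simp: fin_paths_eq)
    moreover have "(x, z) \<in> bicylinder V (prefix x n) (prefix z n)"
      using tail by (simp add: bicylinder_prefix tail_eq_def)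
    ultimately have "\<psi> c = \<xi> (star (path_unit V \<Phi> (prefix x n) (prefix z n)) * c * path_unit V \<Phi> (prefix x n) (prefix z n))"
      if "c \<in> limit" for c using \<psi> n(1) that by blast
    then have "\<psi> c = \<eta> c" if "c \<in> limit" for c
      using that by (simp add: path_unit_prefix swap_unit_def[symmetric] star_swap_unit[OF n(1)] \<eta>_def)
    then show "\<psi> = \<eta>" using \<psi> by (intro extensionalityI[of _ limit]) (auto simp: \<eta>_def)
  qed
  then show ?thesis using sw[OF n(1)] by (simp add: \<eta>_def)
qed

text \<open>This is the product rule of matrix units. The domains agree because
  \<open>swap n z w\<close> maps into the domain of \<open>swap n x z\<close>.\<close>

lemma swap_comp:
  assumes n: "n \<ge> 1" "x \<in> inf_paths V" "z \<in> inf_paths V" "w \<in> inf_paths V"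
  shows "swap n x z \<circ>\<^sub>m swap n z w = swap n x w"
proof
  fix \<xi>
  show "(swap n x z \<circ>\<^sub>m swap n z w) \<xi> = swap n x w \<xi>"
  proof (cases "\<xi> \<in> dom (swap n z w)")
    case False
    then have "swap n z w \<xi> = None" "swap n x w \<xi> = None"
      using n by (auto simp: dom_swap swap_eq split: if_splits)
    then show ?thesis by (simp add: map_comp_def)
  next
    case True
    then obtain \<eta> where \<eta>: "swap n z w \<xi> = Some \<eta>" by blast
    have \<xi>: "\<xi> \<in> characters limit" "idx (path_of \<xi>) n = idx w n" using True n by (auto simp: dom_swap)
    have \<eta>c: "\<eta> \<in> characters limit" by (rule swap_character[OF n(1,3,4) \<eta>])
    have val: "\<eta> = (\<lambda>c\<in>limit. \<xi> (swap_unit n w z * c * swap_unit n z w))"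
      using \<eta> \<xi> by (simp add: swap_eq[OF n(1,3)])
    have "\<eta> (swap_unit n z z) = \<xi> (swap_unit n w w)"
      using swap_unit_in_limit[OF n(1), of z] by (simp add: val swap_unit_mult[OF n(1,3)])
    also have "\<dots> = 1" using character_swap_unit[OF \<xi>(1) n(1)] \<xi>(2) by simp
    finally have idx: "idx (path_of \<eta>) n = idx z n"
      using character_swap_unit[OF \<eta>c n(1), of z] by (simp split: if_splits)
    have "(\<lambda>c\<in>limit. \<eta> (swap_unit n z x * c * swap_unit n x z)) =
        (\<lambda>c\<in>limit. \<xi> (swap_unit n w x * c * swap_unit n x w))"
    proof (rule restrict_ext)
      fix c assume c: "c \<in> limit"
      have "swap_unit n z x * c * swap_unit n x z \<in> limit"
        using normaliserD(1)[OF swap_unit_normaliser[OF n(1-3)] c] by (simp add: star_swap_unit[OF n(1)])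
      then have "\<eta> (swap_unit n z x * c * swap_unit n x z) =
          \<xi> ((swap_unit n w z * swap_unit n z x) * c * (swap_unit n x z * swap_unit n z w))"
        by (simp add: val mult.assoc)
      then show "\<eta> (swap_unit n z x * c * swap_unit n x z) = \<xi> (swap_unit n w x * c * swap_unit n x w)"
        by (simp add: swap_unit_mult[OF n(1,3)])
    qed
    then show ?thesis
      using \<eta> \<eta>c idx \<xi> by (simp add: map_comp_def swap_eq[OF n(1,2)])
  qed
qed

end


section \<open>Germs of normalisers come from pairs of paths\<close>

lemma norm_conj_diff_le:
  fixes a b c :: "'a::unital_cstar_algebra"
  assumes "norm c \<le> 1"
  shows "norm (star a * c * a - star b * c * b) \<le> norm (a - b) * (norm a + norm b)"
proof -
  have "star a * c * a - star b * c * b = star a * c * (a - b) + star (a - b) * c * b"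
    by (simp add: algebra_simps star_diff)
  also have "norm \<dots> \<le> norm (star a * c * (a - b)) + norm (star (a - b) * c * b)"
    by (rule norm_triangle_ineq)
  also have "norm (star a * c * (a - b)) \<le> norm (star a) * 1 * norm (a - b)"
    using assms by (intro order_trans[OF norm_mult_ineq] mult_mono order_trans[OF norm_mult_ineq]) auto
  also have "norm (star (a - b) * c * b) \<le> norm (star (a - b)) * 1 * norm b"
    using assms by (intro order_trans[OF norm_mult_ineq] mult_mono order_trans[OF norm_mult_ineq]) auto
  finally show ?thesis by (simp add: algebra_simps)
qed

context villadsen_limit
begin

lemma approx_level:
  assumes "e > 0"
  shows "\<exists>i F. i \<ge> 1 \<and> cont_entries i F \<and> norm (a - \<Psi> i F) < e"
proof -
  have "a \<in> closure (\<Union>i\<in>{1..}. \<Phi> i ` level_algebra V i)" using dense by simp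
  then have "\<exists>b\<in>(\<Union>i\<in>{1..}. \<Phi> i ` level_algebra V i). dist b a < e"
    using assms unfolding closure_approachable by blast
  then obtain i f where i: "i \<ge> 1" "f \<in> level_algebra V i" "norm (a - \<Phi> i f) < e"
    by (auto simp: dist_norm norm_minus_commute)
  then show ?thesis using level_algebra_entries[OF i(2)] by (metis \<Psi>_def)
qed

text \<open>Let \<open>\<eta> = \<alpha>\<^sub>n(\<xi>)\<close>, and let \<open>p\<close>, \<open>q\<close> be the prefixes of the paths of \<open>\<eta>\<close>, \<open>\<xi>\<close> at a level where some \<open>a\<close>
  is very close to \<open>n\<close>. Near \<open>\<xi>\<close> the map \<open>\<alpha>\<^sub>n\<close> is that of \<open>e\<^sub>p\<^sub>p n e\<^sub>q\<^sub>q\<close>, which is close to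
  \<open>e\<^sub>p\<^sub>p a e\<^sub>q\<^sub>q = g e\<^sub>p\<^sub>q\<close> with \<open>g \<in> C\<close>. If \<open>\<alpha>\<^sub>n\<close> differed from \<open>\<alpha>\<^sub>e\<close>, \<open>e = e\<^sub>p\<^sub>q\<close>, at \<open>\<xi>'\<close>, then a contraction
  \<open>c \<in> C\<close> equal to \<open>1\<close> at \<open>\<alpha>\<^sub>n(\<xi>')\<close> and to \<open>0\<close> at \<open>\<alpha>\<^sub>e(\<xi>')\<close> would make \<open>\<xi>'(n*n) = \<xi>'(n*cn)\<close> small.\<close>

lemma normaliser_germ:
  assumes n: "n \<in> normalisers limit" and \<eta>: "\<alpha> n \<xi> = Some \<eta>"
  shows "\<exists>i\<ge>1. \<exists>U. openin T U \<and> \<xi> \<in> U \<and> U \<subseteq> dom (\<alpha> n) \<inter> dom (swap i (path_of \<eta>) (path_of \<xi>)) \<and>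
    (\<forall>\<xi>'\<in>U. \<alpha> n \<xi>' = swap i (path_of \<eta>) (path_of \<xi>) \<xi>')"
proof -
  define x z where "x = path_of \<eta>" and "z = path_of \<xi>"
  have \<xi>: "\<xi> \<in> characters limit" "\<xi> (star n * n) \<noteq> 0"
    and \<eta>val: "\<eta> = (\<lambda>c\<in>limit. \<xi> (star n * c * n) / \<xi> (star n * n))" using \<alpha>_SomeD[OF \<eta>] by auto
  have \<eta>c: "\<eta> \<in> characters limit" by (rule \<alpha>_character[OF n \<eta>])
  have x: "x \<in> inf_paths V" and z: "z \<in> inf_paths V"
    using path_of_in \<xi>(1) \<eta>c by (simp_all add: x_def z_def)
  define \<delta> where "\<delta> = cmod (\<xi> (star n * n))"
  have \<delta>: "\<delta> > 0" using \<xi>(2) by (simp add: \<delta>_def)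
  define M where "M = norm n"
  have M: "M \<ge> 0" by (simp add: M_def)
  \<comment> \<open>The bound \<open>1\<close> gives \<open>norm b <= M + 1\<close>; the other bound
    makes \<open>e * (2 * M + 1)\<close> at most \<open>\<delta> / 4\<close>, which is below the
    lower bound \<open>\<delta> / 2\<close> for the modulus of \<open>\<xi>' (star n * n)\<close> on
    \<open>U\<close>.\<close>
  define e where "e = min 1 (\<delta> / (4 * (2 * M + 1)))"
  have e: "e > 0" "e \<le> 1" using \<delta> M by (simp_all add: e_def)
  have "e * (2 * M + 1) \<le> \<delta> / (4 * (2 * M + 1)) * (2 * M + 1)"
    using M by (intro mult_right_mono) (simp_all add: e_def)
  also have "\<dots> = \<delta> / 4" using M by (simp add: field_simps)
  finally have small: "e * (2 * M + 1) < \<delta> / 2" using \<delta> by simp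
  obtain i F where i: "i \<ge> 1" and F: "cont_entries i F" "norm (n - \<Psi> i F) < e"
    using approx_level[OF e(1)] by blast
  define p q where "p = idx x i" and "q = idx z i"
  have pq: "p < k i" "q < k i" using idx_less x z i by (simp_all add: p_def q_def)
  define P Q m where "P = munit i p p" and "Q = munit i q q" and "m = munit i p q"
  have PQ: "P \<in> limit" "Q \<in> limit" using munit_in_limit[OF i] by (simp_all add: P_def Q_def)
  have sPQ: "star P = P" "star Q = Q" by (simp_all add: P_def Q_def star_munit[OF i])
  have m: "m \<in> normalisers limit" unfolding m_def by (rule munit_normaliser[OF i pq])
  \<comment> \<open>The first condition puts the points of \<open>U\<close> into the domain of the
    swap, the second makes their images under \<open>\<alpha> n\<close> take the value
    \<open>1\<close> at \<open>P\<close>, and the third keeps their values at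
    \<open>star n * n\<close> away from \<open>0\<close>.\<close>
  define U where "U = {\<xi>' \<in> characters limit. \<xi>' Q \<in> - {0}} \<inter>
    {\<xi>' \<in> characters limit. \<xi>' (star n * P * n) \<in> - {0}} \<inter>
    {\<xi>' \<in> characters limit. \<xi>' (star n * n) \<in> {w. \<delta> / 2 < cmod w}}"
  have "open {w::complex. \<delta> / 2 < cmod w}" by (intro open_Collect_less continuous_intros)
  then have openU: "openin T U"
    unfolding U_def using PQ normaliserD(1)[OF n PQ(1)] normaliserD(3)[OF n]
    by (intro openin_Int openin_character_preimage) (auto simp: open_Compl)
  have \<eta>P: "\<eta> P = 1" using character_munit[OF \<eta>c i] by (simp add: P_def p_def x_def)
  then have "\<xi> (star n * P * n) \<noteq> 0" using \<eta>val PQ(1) by auto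
  then have \<xi>U: "\<xi> \<in> U"
    using \<xi> \<delta> character_munit[OF \<xi>(1) i] by (simp add: U_def Q_def q_def z_def \<delta>_def)
  have eq: "\<alpha> n \<xi>' = swap i x z \<xi>' \<and> \<alpha> n \<xi>' \<noteq> None" if "\<xi>' \<in> U" for \<xi>'
  proof -
    have \<xi>': "\<xi>' \<in> characters limit" "\<xi>' Q \<noteq> 0" "\<xi>' (star n * P * n) \<noteq> 0" "cmod (\<xi>' (star n * n)) > \<delta> / 2"
      using that by (auto simp: U_def)
    note ch = characterD[OF \<xi>'(1) subalgebra_limit]
    have nn: "\<xi>' (star n * n) \<noteq> 0" using \<xi>'(4) \<delta> by auto
    then have "\<xi>' \<in> dom (\<alpha> n)" using \<xi>'(1) by (simp add: dom_\<alpha>)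
    then obtain \<eta>1 where \<eta>1: "\<alpha> n \<xi>' = Some \<eta>1" by blast
    have \<eta>1val: "\<eta>1 = (\<lambda>c\<in>limit. \<xi>' (star n * c * n) / \<xi>' (star n * n))" using \<alpha>_SomeD[OF \<eta>1] by auto
    have \<eta>1c: "\<eta>1 \<in> characters limit" by (rule \<alpha>_character[OF n \<eta>1])
    note ch1 = characterD[OF \<eta>1c subalgebra_limit]
    have Q1: "\<xi>' Q = 1" and idx: "idx (path_of \<xi>') i = q"
      using \<xi>'(2) character_munit[OF \<xi>'(1) i, of q] by (auto simp: Q_def split: if_splits)
    define \<eta>2 where "\<eta>2 = (\<lambda>c\<in>limit. \<xi>' (star m * c * m))"
    have \<eta>2: "swap i x z \<xi>' = Some \<eta>2"
      using \<xi>'(1) idx by (simp add: swap_eq[OF i x] q_def \<eta>2_def m_def star_munit[OF i] swap_unit_def p_def)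
    have \<eta>2c: "\<eta>2 \<in> characters limit" by (rule swap_character[OF i x z \<eta>2])
    note ch2 = characterD[OF \<eta>2c subalgebra_limit]
    have "\<eta>1 = \<eta>2"
    proof (rule ccontr)
      assume "\<eta>1 \<noteq> \<eta>2"
      from separate_characters[OF \<eta>1c \<eta>2c this] obtain c where
        c: "c \<in> limit" "norm c \<le> 1" "\<eta>1 c = 1" "\<eta>2 c = 0" by blast
      have "\<eta>1 P \<noteq> 0" using \<eta>1val PQ(1) \<xi>'(3) nn by simp
      then have P1: "\<eta>1 P = 1" using character_munit[OF \<eta>1c i, of p] by (auto simp: P_def split: if_splits)
      define w where "w = star n * (P * c * P) * n"
      have PcP: "P * c * P \<in> limit" by (intro limit_closed PQ c)
      have w: "w \<in> limit" unfolding w_def by (rule normaliserD(1)[OF n PcP])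
      have "\<eta>1 (P * c * P) = 1" using ch1(2)[OF limit_closed(3)[OF PQ(1) c(1)] PQ(1)] ch1(2)[OF PQ(1) c(1)] P1 c(3) by simp
      then have "\<xi>' w = \<xi>' (star n * n)" using \<eta>1val PcP nn by (simp add: w_def)
      moreover have QwQ: "Q * w * Q \<in> limit" by (intro limit_closed PQ w)
      have "\<xi>' (Q * w * Q) = \<xi>' w"
        using ch(2)[OF limit_closed(3)[OF PQ(2) w] PQ(2)] ch(2)[OF PQ(2) w] Q1 by simp
      moreover define n1 where "n1 = P * n * Q"
      have n1: "Q * w * Q = star n1 * c * n1"
        by (simp add: n1_def w_def star_mult sPQ mult.assoc)
      ultimately have 1: "\<xi>' (star n1 * c * n1) = \<xi>' (star n * n)" by simp
      define b where "b = P * \<Psi> i F * Q"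
      obtain g where g: "g \<in> limit" "b = g * m"
        using munit_compress[OF i F(1) pq] by (auto simp: b_def P_def Q_def m_def)
      have gcg: "star g * c \<in> limit" "star g * c * g \<in> limit"
        by (intro limit_closed star_in_limit g c)+
      have bb: "star b * c * b = star m * (star g * c * g) * m" by (simp add: g(2) star_mult mult.assoc)
      have bbl: "star b * c * b \<in> limit" unfolding bb by (rule normaliserD(1)[OF m gcg(2)])
      \<comment> \<open>Conjugation by \<open>b\<close> factors through the matrix unit, so it sees
        \<open>c\<close> only through \<open>\<eta>2\<close>, where \<open>c\<close>
        vanishes.\<close>
      have "\<xi>' (star b * c * b) = \<eta>2 (star g * c * g)" using gcg by (simp add: bb \<eta>2_def)
      also have "\<dots> = 0"
        using ch2(2)[OF gcg(1) g(1)] ch2(2)[OF star_in_limit[OF g(1)] c(1)] c(4) by simp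
      finally have 2: "\<xi>' (star b * c * b) = 0" .
      have contr: "norm (P * a * Q) \<le> norm a" for a
      proof -
        have "norm (P * a * Q) \<le> 1 * norm a * 1"
          using norm_munit_le[OF i pq(1,1)] norm_munit_le[OF i pq(2,2)] unfolding P_def Q_def
          by (intro order_trans[OF norm_mult_ineq] mult_mono order_trans[OF norm_mult_ineq]) auto
        then show ?thesis by simp
      qed
      have d: "norm (n1 - b) \<le> e"
      proof -
        have "n1 - b = P * (n - \<Psi> i F) * Q" by (simp add: n1_def b_def algebra_simps)
        then show ?thesis using contr[of "n - \<Psi> i F"] F(2) by simp
      qed
      have n1M: "norm n1 \<le> M" using contr[of n] by (simp add: n1_def M_def)
      have bM: "norm b \<le> M + 1"
        using norm_triangle_ineq2[of b n1] d n1M e(2) by (simp add: norm_minus_commute)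
      have "cmod (\<xi>' (star n * n)) = cmod (\<xi>' (star n1 * c * n1 - star b * c * b))"
        using 1 2 ch(6)[of "star n1 * c * n1" "star b * c * b"] QwQ bbl n1 by simp
      also have "\<dots> \<le> norm (star n1 * c * n1 - star b * c * b)"
        using QwQ bbl n1 by (intro character_le_norm[OF \<xi>'(1) subalgebra_limit closed_limit] limit_closed(6)) simp_all
      also have "\<dots> \<le> norm (n1 - b) * (norm n1 + norm b)" by (rule norm_conj_diff_le[OF c(2)])
      also have "\<dots> \<le> e * (2 * M + 1)" using d n1M bM e by (intro mult_mono) auto
      also have "\<dots> < \<delta> / 2" by (rule small)
      finally show False using \<xi>'(4) by simp
    qed
    then show ?thesis using \<eta>1 \<eta>2 by simp
  qed
  have "\<xi>' \<in> dom (\<alpha> n) \<inter> dom (swap i x z)" if "\<xi>' \<in> U" for \<xi>'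
    using eq[OF that] by (metis IntI domI option.exhaust)
  then have "U \<subseteq> dom (\<alpha> n) \<inter> dom (swap i x z)" by (rule subsetI)
  moreover have "\<forall>\<xi>'\<in>U. \<alpha> n \<xi>' = swap i x z \<xi>'" using eq by (intro ballI) (rule conjunct1)
  ultimately show ?thesis
    using i openU \<xi>U unfolding x_def z_def by (intro exI[of _ i] conjI exI[of _ U])
qed


section \<open>The isomorphism with the Weyl groupoid\<close>

abbreviation G where "G \<equiv> path_groupoid V"
abbreviation E where "E \<equiv> transformation_groupoid G T (anchor V \<Phi>) (path_action V \<Phi>)"
abbreviation W where "W \<equiv> weyl_groupoid limit"

text \<open>Picking the least level makes \<open>arrow_germ\<close> a function of the arrow; by
  \<open>arrow_germ_eq\<close> every admissible level gives the same germ.\<close>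

definition arrow_level :: "(nat \<Rightarrow> nat) \<Rightarrow> (nat \<Rightarrow> nat) \<Rightarrow> nat" where
  "arrow_level x z = (LEAST n. tail_eq n x z)"

definition arrow_germ :: "((nat \<Rightarrow> nat) \<times> (nat \<Rightarrow> nat)) \<times> ('a \<Rightarrow> complex) \<Rightarrow> ((('a \<Rightarrow> complex) \<rightharpoonup> ('a \<Rightarrow> complex)) \<times> ('a \<Rightarrow> complex)) set" where
  "arrow_germ = (\<lambda>((x, z), \<xi>). germ T \<S> (swap (arrow_level x z) x z) \<xi>)"

lemma arrow_level: "tail_eq n x z \<Longrightarrow> tail_eq (arrow_level x z) x z \<and> arrow_level x z \<le> n"
  unfolding arrow_level_def by (auto intro: LeastI Least_le)

lemma arrow_germ_eq:
  assumes tail: "tail_eq n x z" and \<xi>: "\<xi> \<in> characters limit" "path_of \<xi> = z"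
  shows "arrow_germ ((x, z), \<xi>) = germ T \<S> (swap n x z) \<xi>"
proof -
  define l where "l = arrow_level x z"
  have l: "tail_eq l x z" "l \<le> n" using arrow_level[OF tail] by (simp_all add: l_def)
  have n: "n \<ge> 1" "l \<ge> 1" "x \<in> inf_paths V" "z \<in> inf_paths V" using tail l by (auto simp: tail_eq_def)
  have "germ T \<S> (swap l x z) \<xi> = germ T \<S> (swap n x z) \<xi>"
  proof (rule germ_cong)
    show "openin T (dom (swap n x z))" by (rule openin_dom_swap) fact+
    show "\<xi> \<in> dom (swap n x z)" using \<xi> by (simp add: dom_swap[OF n(1,3)])
    show "dom (swap n x z) \<subseteq> dom (swap l x z) \<inter> dom (swap n x z)"
      using swap_refine(2)[OF l] by (auto simp: dom_swap[OF n(1,3)] dom_swap[OF n(2,3)])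
    show "swap l x z \<xi>' = swap n x z \<xi>'" if "\<xi>' \<in> dom (swap n x z)" for \<xi>'
      using swap_refine(1)[OF l, of \<xi>'] that by (simp add: dom_swap[OF n(1,3)])
  qed
  then show ?thesis by (simp add: arrow_germ_def l_def)
qed

lemma topspace_G: "topspace (arrows G) = {(x, z). \<exists>n. tail_eq n x z}"
proof (intro equalityI subsetI)
  fix a assume "a \<in> topspace (arrows G)"
  then obtain p q n where pq: "p \<in> fin_paths V n" "q \<in> fin_paths V n" "a \<in> bicylinder V p q"
    by (auto simp: path_groupoid_def topology_generated_by_topspace)
  obtain x z where a: "a = (x, z)" by (cases a)
  have "length p = n" using pq(1) by (simp add: fin_paths_def)
  \<comment> \<open>The successor covers \<open>n = 0\<close>, a level that \<open>tail_eq\<close>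
    excludes.\<close>
  then have "tail_eq (Suc n) x z" using pq(3) by (auto simp: a bicylinder_def cylinder_def tail_eq_def)
  then show "a \<in> {(x, z). \<exists>n. tail_eq n x z}" by (auto simp: a)
next
  fix a assume "a \<in> {(x, z). \<exists>n. tail_eq n x z}"
  then obtain x z n where a: "a = (x, z)" "tail_eq n x z" by blast
  then have "a \<in> bicylinder V (prefix x n) (prefix z n)" "prefix x n \<in> fin_paths V n" "prefix z n \<in> fin_paths V n"
    by (auto simp: tail_eq_def bicylinder_prefix fin_paths_eq)
  then show "a \<in> topspace (arrows G)"
    by (auto simp: path_groupoid_def topology_generated_by_topspace)
qed

lemma openin_bicylinder:
  "x \<in> inf_paths V \<Longrightarrow> z \<in> inf_paths V \<Longrightarrow> openin (arrows G) (bicylinder V (prefix x n) (prefix z n))"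
  unfolding path_groupoid_def
  by (auto simp: fin_paths_eq intro!: topology_generated_by_Basis)

text \<open>The topology is given by generators, and the induction over generated open sets has to
  survive finite intersections; it therefore asserts containment for all sufficiently long
  prefixes.\<close>

lemma bicylinder_basis:
  assumes "openin (arrows G) O'" "(x, z) \<in> O'"
  shows "\<exists>n. tail_eq n x z \<and> bicylinder V (prefix x n) (prefix z n) \<subseteq> O'"
proof -
  have "generate_topology_on {bicylinder V p q | p q n. p \<in> fin_paths V n \<and> q \<in> fin_paths V n} O'"
    using assms(1) unfolding path_groupoid_def by (simp add: openin_topology_generated_by)
  then have "(x, z) \<in> O' \<longrightarrow> (\<exists>N. \<forall>n\<ge>N. bicylinder V (prefix x n) (prefix z n) \<subseteq> O')"
  proof (induction rule: generate_topology_on.induct)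
    case (Int a b)
    show ?case
    proof
      assume "(x, z) \<in> a \<inter> b"
      then obtain N1 N2 where "\<forall>n\<ge>N1. bicylinder V (prefix x n) (prefix z n) \<subseteq> a"
        "\<forall>n\<ge>N2. bicylinder V (prefix x n) (prefix z n) \<subseteq> b" using Int by blast
      then have "\<forall>n\<ge>max N1 N2. bicylinder V (prefix x n) (prefix z n) \<subseteq> a \<inter> b" by simp
      then show "\<exists>N. \<forall>n\<ge>N. bicylinder V (prefix x n) (prefix z n) \<subseteq> a \<inter> b" by blast
    qed
  next
    case (UN K)
    then show ?case by (meson UnionE Union_upper subset_trans)
  next
    case (Basis s)
    then obtain p q N where s: "s = bicylinder V p q" "p \<in> fin_paths V N" "q \<in> fin_paths V N" by blast
    obtain p' q' where pq: "p = prefix p' N" "q = prefix q' N" using s(2,3) by (auto simp: fin_paths_eq)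
    show ?case
    proof
      assume xz: "(x, z) \<in> s"
      have "bicylinder V (prefix x n) (prefix z n) \<subseteq> s" if "n \<ge> N" for n
      proof (rule subrelI)
        fix x' z' assume a: "(x', z') \<in> bicylinder V (prefix x n) (prefix z n)"
        have "x' j = z' j" if "j \<ge> N" for j
          using a xz \<open>j \<ge> N\<close> by (cases "j < n") (auto simp: bicylinder_prefix s(1) pq)
        then show "(x', z') \<in> s" using a xz \<open>n \<ge> N\<close> by (auto simp: bicylinder_prefix s(1) pq)
      qed
      then show "\<exists>N. \<forall>n\<ge>N. bicylinder V (prefix x n) (prefix z n) \<subseteq> s" by blast
    qed
  qed simp
  then obtain N where N: "\<And>n. n \<ge> N \<Longrightarrow> bicylinder V (prefix x n) (prefix z n) \<subseteq> O'" using assms(2) by blast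
  have "(x, z) \<in> topspace (arrows G)" using assms openin_subset by blast
  then obtain m where m: "tail_eq m x z" by (auto simp: topspace_G)
  then have "tail_eq (max m N) x z" by (auto simp: tail_eq_def)
  then show ?thesis using N[of "max m N"] by auto
qed

lemma topspace_E:
  "topspace (arrows E) = {((x, z), \<xi>). (\<exists>n. tail_eq n x z) \<and> \<xi> \<in> characters limit \<and> path_of \<xi> = z}"
proof -
  have "topspace (arrows E) = topspace (arrows G) \<times> characters limit \<inter> {(\<gamma>, \<xi>). snd \<gamma> = anchor V \<Phi> \<xi>}"
    by (simp add: transformation_groupoid_def path_groupoid_def)
  then show ?thesis unfolding topspace_G by (auto simp: anchor_eq)
qed

lemma topspace_E_D:
  assumes "a \<in> topspace (arrows E)"
  obtains x z \<xi> n where "a = ((x, z), \<xi>)" "tail_eq n x z" "\<xi> \<in> characters limit" "path_of \<xi> = z"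
  using assms unfolding topspace_E by blast

lemma openin_E:
  "openin (arrows E) S \<longleftrightarrow> (\<exists>O'. openin (prod_topology (arrows G) T) O' \<and> S = O' \<inter> topspace (arrows E))"
proof -
  define D where "D = {(\<gamma>, \<xi>). src G \<gamma> = anchor V \<Phi> \<xi>}"
  have eq: "arrows E = subtopology (prod_topology (arrows G) T) D"
    by (simp add: transformation_groupoid_def D_def)
  have key: "O' \<inter> D = O' \<inter> topspace (arrows E)" if "openin (prod_topology (arrows G) T) O'" for O'
    unfolding eq topspace_subtopology using openin_subset[OF that] by (simp only: Int_assoc[symmetric] Int_absorb2)
  have "openin (arrows E) S \<longleftrightarrow> (\<exists>O'. openin (prod_topology (arrows G) T) O' \<and> S = O' \<inter> D)"
    unfolding eq by (rule openin_subtopology)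
  also have "\<dots> \<longleftrightarrow> (\<exists>O'. openin (prod_topology (arrows G) T) O' \<and> S = O' \<inter> topspace (arrows E))"
    by (rule ex_cong1, rule conj_cong[OF refl]) (simp only: key)
  finally show ?thesis .
qed

lemma arrow_germ_mem:
  assumes "tail_eq n x z" "\<xi> \<in> characters limit" "path_of \<xi> = z"
  shows "(swap n x z, \<xi>) \<in> arrow_germ ((x, z), \<xi>)"
proof -
  have n: "n \<ge> 1" "x \<in> inf_paths V" "z \<in> inf_paths V" using assms(1) by (auto simp: tail_eq_def)
  show ?thesis unfolding arrow_germ_eq[OF assms]
    by (rule germ_memI[OF swap_in_\<S>[OF n] openin_dom_swap[OF n]]) (simp add: dom_swap[OF n(1,2)] assms)
qed

lemma arrows_W: "arrows W = topology_generated_by {germ T \<S> f ` U | f U. f \<in> \<S> \<and> openin T U \<and> U \<subseteq> dom f}"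
  by (simp add: weyl_groupoid_def germ_groupoid_def)

text \<open>The prefix of \<open>x\<close> is grafted onto the path under \<xi>. Thus every germ of
  a swap is the germ of an arrow over the same point, in the basic set of the same prefixes;
  continuity, openness and surjectivity all use this.\<close>

lemma arrow_germ_swap_germ:
  assumes "n \<ge> 1" "x \<in> inf_paths V" "z \<in> inf_paths V" "\<xi> \<in> dom (swap n x z)"
    and "\<And>i. i < n \<Longrightarrow> x' i = x i" "\<And>i. i \<ge> n \<Longrightarrow> x' i = path_of \<xi> i"
  shows "arrow_germ ((x', path_of \<xi>), \<xi>) = germ T \<S> (swap n x z) \<xi>"
    "((x', path_of \<xi>), \<xi>) \<in> topspace (arrows E)"
    "(x', path_of \<xi>) \<in> bicylinder V (prefix x n) (prefix z n)"
proof -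
  have \<xi>: "\<xi> \<in> characters limit" "idx (path_of \<xi>) n = idx z n" using assms(4) by (auto simp: dom_swap[OF assms(1,2)])
  note p = path_of_in[OF \<xi>(1)]
  have "x' = (\<lambda>i. if i < n then x i else path_of \<xi> i)" using assms(5,6) by (auto simp: fun_eq_iff)
  then have tail: "tail_eq n x' (path_of \<xi>)" and idx: "idx x' n = idx x n"
    using graft[OF assms(1,2) p] by simp_all
  show "arrow_germ ((x', path_of \<xi>), \<xi>) = germ T \<S> (swap n x z) \<xi>"
    using arrow_germ_eq[OF tail \<xi>(1) refl] swap_cong[OF idx \<xi>(2)] by simp
  show "((x', path_of \<xi>), \<xi>) \<in> topspace (arrows E)" using tail \<xi>(1) by (auto simp: topspace_E)
  show "(x', path_of \<xi>) \<in> bicylinder V (prefix x n) (prefix z n)"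
    using tail assms(5) idx_eq_iff[OF p assms(3,1)] \<xi>(2) by (simp add: bicylinder_prefix tail_eq_def)
qed

text \<open>If the germ of an arrow is that of \<open>f\<close>, then \<open>f\<close> agrees with a
  swap near the point, and nearby arrows in the basic set of that swap have germs of
  \<open>f\<close> as well.\<close>

lemma continuous_arrow_germ: "continuous_map (arrows E) (arrows W) arrow_germ"
  unfolding arrows_W
proof (rule continuous_on_generated_topo)
  fix B assume "B \<in> {germ T \<S> f ` U | f U. f \<in> \<S> \<and> openin T U \<and> U \<subseteq> dom f}"
  then obtain f U where B: "B = germ T \<S> f ` U" "f \<in> \<S>" "openin T U" "U \<subseteq> dom f" by blast
  show "openin (arrows E) (arrow_germ -` B \<inter> topspace (arrows E))"
  proof (subst openin_subopen, intro ballI)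
    fix a assume a: "a \<in> arrow_germ -` B \<inter> topspace (arrows E)"
    then obtain x z \<xi> n where xz: "a = ((x, z), \<xi>)" "tail_eq n x z" "\<xi> \<in> characters limit" "path_of \<xi> = z"
      using topspace_E_D by blast
    have n: "n \<ge> 1" "x \<in> inf_paths V" "z \<in> inf_paths V" using xz(2) by (auto simp: tail_eq_def)
    obtain \<xi>0 where \<xi>0: "\<xi>0 \<in> U" "arrow_germ a = germ T \<S> f \<xi>0" using a B(1) by blast
    have "(swap n x z, \<xi>) \<in> germ T \<S> f \<xi>0" using arrow_germ_mem[OF xz(2-4)] \<xi>0(2) xz(1) by simp
    note this = germ_memD[OF this]
    then obtain U' where U': "\<xi>0 = \<xi>" "openin T U'" "\<xi> \<in> U'" "U' \<subseteq> dom f \<inter> dom (swap n x z)"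
      "\<And>\<zeta>. \<zeta> \<in> U' \<Longrightarrow> f \<zeta> = swap n x z \<zeta>" by blast
    define S where "S = (bicylinder V (prefix x n) (prefix z n) \<times> (U \<inter> U')) \<inter> topspace (arrows E)"
    have "openin (prod_topology (arrows G) T) (bicylinder V (prefix x n) (prefix z n) \<times> (U \<inter> U'))"
      using openin_bicylinder[OF n(2,3)] B(3) U'(2) by (auto simp: openin_prod_Times_iff)
    then have "openin (arrows E) S" unfolding openin_E S_def by blast
    moreover have "a \<in> S"
      using a U' \<xi>0 xz n by (auto simp: S_def bicylinder_prefix tail_eq_def)
    moreover have "S \<subseteq> arrow_germ -` B \<inter> topspace (arrows E)"
    proof
      fix a' assume a': "a' \<in> S"
      then have top: "a' \<in> topspace (arrows E)" by (simp add: S_def)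
      then obtain x' z' \<zeta> m where a'eq: "a' = ((x', z'), \<zeta>)" "path_of \<zeta> = z'" using topspace_E_D by metis
      have b: "(x', z') \<in> bicylinder V (prefix x n) (prefix z n)" and \<zeta>: "\<zeta> \<in> U" "\<zeta> \<in> U'"
        using a' by (auto simp: S_def a'eq(1))
      have "arrow_germ ((x', path_of \<zeta>), \<zeta>) = germ T \<S> (swap n x z) \<zeta>"
        by (rule arrow_germ_swap_germ[OF n]) (use \<zeta>(2) U'(4) b a'eq(2) in \<open>auto simp: bicylinder_prefix\<close>)
      also have "\<dots> = germ T \<S> f \<zeta>"
        by (rule germ_cong[OF U'(2) \<zeta>(2)]) (use U'(4,5) in auto)
      finally show "a' \<in> arrow_germ -` B \<inter> topspace (arrows E)" using top \<zeta>(1) by (simp add: a'eq B(1))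
    qed
    ultimately show "\<exists>S. openin (arrows E) S \<and> a \<in> S \<and> S \<subseteq> arrow_germ -` B \<inter> topspace (arrows E)" by blast
  qed
next
  show "arrow_germ ` topspace (arrows E) \<subseteq> \<Union> {germ T \<S> f ` U | f U. f \<in> \<S> \<and> openin T U \<and> U \<subseteq> dom f}"
  proof
    fix b assume "b \<in> arrow_germ ` topspace (arrows E)"
    then obtain a where a: "b = arrow_germ a" "a \<in> topspace (arrows E)" by (rule imageE)
    obtain x z \<xi> n where xz: "a = ((x, z), \<xi>)" and b: "tail_eq n x z" "\<xi> \<in> characters limit" "path_of \<xi> = z"
      using topspace_E_D[OF a(2)] by blast
    have n: "n \<ge> 1" "x \<in> inf_paths V" "z \<in> inf_paths V" using b(1) by (auto simp: tail_eq_def)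
    have "b = germ T \<S> (swap n x z) \<xi>" unfolding a(1) xz by (rule arrow_germ_eq[OF b])
    moreover have "\<xi> \<in> dom (swap n x z)" using b by (simp add: dom_swap[OF n(1,2)])
    ultimately have "b \<in> germ T \<S> (swap n x z) ` dom (swap n x z)" by (rule image_eqI)
    moreover have "germ T \<S> (swap n x z) ` dom (swap n x z) \<in>
        {germ T \<S> f ` U | f U. f \<in> \<S> \<and> openin T U \<and> U \<subseteq> dom f}"
      using swap_in_\<S>[OF n] openin_dom_swap[OF n] by blast
    ultimately show "b \<in> \<Union> {germ T \<S> f ` U | f U. f \<in> \<S> \<and> openin T U \<and> U \<subseteq> dom f}"
      by (rule UnionI[rotated])
  qed
qed

text \<open>Basic sets suffice: over the bicylinder of a swap and an open set of characters, the
  image contains the germs of the swap at all points of that open set in its domain.\<close>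

lemma open_map_arrow_germ: "open_map (arrows E) (arrows W) arrow_germ"
  unfolding open_map_def
proof (intro allI impI)
  fix S assume S: "openin (arrows E) S"
  show "openin (arrows W) (arrow_germ ` S)"
  proof (subst openin_subopen, intro ballI)
    fix b assume "b \<in> arrow_germ ` S"
    then obtain a where a: "a \<in> S" "b = arrow_germ a" by blast
    have "a \<in> topspace (arrows E)" using a(1) S openin_subset by blast
    then obtain x z \<xi> n0 where xz: "a = ((x, z), \<xi>)" "tail_eq n0 x z" "\<xi> \<in> characters limit" "path_of \<xi> = z"
      using topspace_E_D by blast
    obtain O' where O': "openin (prod_topology (arrows G) T) O'" "S = O' \<inter> topspace (arrows E)"
      using S unfolding openin_E by blast
    have "((x, z), \<xi>) \<in> O'" using a(1) O'(2) xz(1) by blast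
    from openin_prod_topology_alt[THEN iffD1, OF O'(1), rule_format, OF this]
    obtain O1 O2 where O12: "openin (arrows G) O1" "openin T O2" "(x, z) \<in> O1" "\<xi> \<in> O2" "O1 \<times> O2 \<subseteq> O'"
      by (elim exE conjE)
    obtain n where n0: "tail_eq n x z" "bicylinder V (prefix x n) (prefix z n) \<subseteq> O1"
      using bicylinder_basis[OF O12(1,3)] by blast
    have n: "n \<ge> 1" "x \<in> inf_paths V" "z \<in> inf_paths V" using n0(1) by (auto simp: tail_eq_def)
    define U where "U = O2 \<inter> dom (swap n x z)"
    have U: "openin T U" unfolding U_def by (intro openin_Int O12 openin_dom_swap n)
    have "openin (arrows W) (germ T \<S> (swap n x z) ` U)"
      unfolding arrows_W using U swap_in_\<S>[OF n]
      by (intro topology_generated_by_Basis) (auto simp: U_def)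
    moreover have "b \<in> germ T \<S> (swap n x z) ` U"
      using a(2) xz arrow_germ_eq[OF n0(1) xz(3,4)] O12(4) by (auto simp: U_def dom_swap[OF n(1,2)])
    moreover have "germ T \<S> (swap n x z) ` U \<subseteq> arrow_germ ` S"
    proof
      fix c assume "c \<in> germ T \<S> (swap n x z) ` U"
      then obtain \<zeta> where \<zeta>: "\<zeta> \<in> O2" "\<zeta> \<in> dom (swap n x z)" "c = germ T \<S> (swap n x z) \<zeta>" by (auto simp: U_def)
      define x' where "x' i = (if i < n then x i else path_of \<zeta> i)" for i
      have x': "\<And>i. i < n \<Longrightarrow> x' i = x i" "\<And>i. i \<ge> n \<Longrightarrow> x' i = path_of \<zeta> i" by (simp_all add: x'_def)
      note g = arrow_germ_swap_germ[OF n \<zeta>(2) x']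
      have "((x', path_of \<zeta>), \<zeta>) \<in> S" using g(2,3) n0(2) \<zeta>(1) O12(5) O'(2) by blast
      with g(1) \<zeta>(3) show "c \<in> arrow_germ ` S" by (metis imageI)
    qed
    ultimately show "\<exists>Q. openin (arrows W) Q \<and> b \<in> Q \<and> Q \<subseteq> arrow_germ ` S" by blast
  qed
qed

lemma arrow_germ_surj: "arrow_germ ` topspace (arrows E) = topspace (arrows W)"
proof
  show "arrow_germ ` topspace (arrows E) \<subseteq> topspace (arrows W)"
    by (rule continuous_map_image_subset_topspace[OF continuous_arrow_germ])
  show "topspace (arrows W) \<subseteq> arrow_germ ` topspace (arrows E)"
  proof
    fix b assume "b \<in> topspace (arrows W)"
    then obtain f \<xi> where f: "f \<in> \<S>" "\<xi> \<in> dom f" "b = germ T \<S> f \<xi>"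
      unfolding arrows_W topology_generated_by_topspace by blast
    then obtain n \<eta> where n: "n \<in> normalisers limit" "f = \<alpha> n" "\<alpha> n \<xi> = Some \<eta>" by blast
    obtain i U where i: "i \<ge> 1" and U: "openin T U" "\<xi> \<in> U"
      "U \<subseteq> dom (\<alpha> n) \<inter> dom (swap i (path_of \<eta>) (path_of \<xi>))"
      "\<forall>\<xi>'\<in>U. \<alpha> n \<xi>' = swap i (path_of \<eta>) (path_of \<xi>) \<xi>'"
      using normaliser_germ[OF n(1,3)] by blast
    have \<xi>: "\<xi> \<in> characters limit" using f(2) n(2) by (simp add: dom_\<alpha>)
    have \<eta>: "\<eta> \<in> characters limit" by (rule \<alpha>_character[OF n(1,3)])
    note p = path_of_in[OF \<xi>] path_of_in[OF \<eta>]
    \<comment> \<open>Only the prefix of the path under \<eta> enters the swap; taking the tail from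
      the path under \<xi> gives a tail-equivalent pair without comparing the two paths further
      on.\<close>
    define x' where "x' i' = (if i' < i then path_of \<eta> i' else path_of \<xi> i')" for i'
    have d: "\<xi> \<in> dom (swap i (path_of \<eta>) (path_of \<xi>))" using U by blast
    have "arrow_germ ((x', path_of \<xi>), \<xi>) = germ T \<S> (swap i (path_of \<eta>) (path_of \<xi>)) \<xi>"
      "((x', path_of \<xi>), \<xi>) \<in> topspace (arrows E)"
      by (rule arrow_germ_swap_germ[OF i p(2,1) d]; simp add: x'_def)+
    moreover have "germ T \<S> (swap i (path_of \<eta>) (path_of \<xi>)) \<xi> = b"
      unfolding f(3) n(2) by (rule germ_cong[OF U(1,2)]) (use U(3,4) in auto)
    ultimately show "b \<in> arrow_germ ` topspace (arrows E)" by (metis imageI)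
  qed
qed

lemma arrow_germ_inj: "inj_on arrow_germ (topspace (arrows E))"
proof (rule inj_onI)
  fix a a' assume a: "a \<in> topspace (arrows E)" "a' \<in> topspace (arrows E)" and eq: "arrow_germ a = arrow_germ a'"
  obtain x z \<xi> n where xz: "a = ((x, z), \<xi>)" "tail_eq n x z" "\<xi> \<in> characters limit" "path_of \<xi> = z"
    using topspace_E_D[OF a(1)] by blast
  obtain x' z' \<xi>' n' where xz': "a' = ((x', z'), \<xi>')" "tail_eq n' x' z'" "\<xi>' \<in> characters limit" "path_of \<xi>' = z'"
    using topspace_E_D[OF a(2)] by blast
  have "(swap n x z, \<xi>) \<in> germ T \<S> (swap n' x' z') \<xi>'"
    using arrow_germ_mem[OF xz(2-4)] eq xz(1) xz'(1) arrow_germ_eq[OF xz'(2-4)] by simp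
  note g = germ_memD[OF this]
  then have \<xi>: "\<xi> = \<xi>'" by simp
  have "swap n' x' z' \<xi>' = swap n x z \<xi>'" using g(3) by blast
  then have "path_action V \<Phi> (x, z) \<xi> = path_action V \<Phi> (x', z') \<xi>'"
    using path_action_eq[OF xz(2-4)] path_action_eq[OF xz'(2-4)] \<xi> by simp
  then have "x = x'"
    using path_of_swap[OF xz(2-4) path_action_eq[OF xz(2-4)]] path_of_swap[OF xz'(2-4) path_action_eq[OF xz'(2-4)]] by simp
  with \<xi> xz xz' show "a = a'" by simp
qed

section \<open>Source, range and product in the Weyl groupoid\<close>

lemma src_W:
  assumes "f \<in> \<S>" "\<xi> \<in> dom f" "openin T (dom f)"
  shows "src W (germ T \<S> f \<xi>) = \<xi>"
proof -
  have "src W (germ T \<S> f \<xi>) = (THE x. \<exists>g. (g, x) \<in> germ T \<S> f \<xi>)"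
    by (simp add: weyl_groupoid_def germ_groupoid_def)
  also have "\<dots> = \<xi>"
  proof (rule the_equality)
    show "\<exists>g. (g, \<xi>) \<in> germ T \<S> f \<xi>" 
      by (rule exI[of _ f], rule germ_memI[OF assms(1,3,2)])
    show "x = \<xi>" if "\<exists>g. (g, x) \<in> germ T \<S> f \<xi>" for x using that by (elim exE) (rule germ_memD(1))
  qed
  finally show ?thesis .
qed

lemma rng_W:
  assumes "f \<in> \<S>" "openin T (dom f)" "f \<xi> = Some \<eta>"
  shows "rng W (germ T \<S> f \<xi>) = \<eta>"
proof -
  have "rng W (germ T \<S> f \<xi>) = (THE y. \<exists>g x. (g, x) \<in> germ T \<S> f \<xi> \<and> g x = Some y)"
    by (simp add: weyl_groupoid_def germ_groupoid_def)
  also have "\<dots> = \<eta>"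
  proof (rule the_equality)
    have "(f, \<xi>) \<in> germ T \<S> f \<xi>" using assms by (intro germ_memI) auto
    with assms(3) show "\<exists>g x. (g, x) \<in> germ T \<S> f \<xi> \<and> g x = Some \<eta>" by blast
    fix y assume "\<exists>g x. (g, x) \<in> germ T \<S> f \<xi> \<and> g x = Some y"
    then obtain g x where g: "(g, x) \<in> germ T \<S> f \<xi>" "g x = Some y" by blast
    then have "f \<xi> = g \<xi>" "x = \<xi>" using germ_memD[OF g(1)] by auto
    with g(2) assms(3) show "y = \<eta>" by simp
  qed
  finally show ?thesis .
qed

text \<open>Representatives of the two germs may be changed near their base points: at the points
  near \<xi> that \<open>\<alpha> n\<close> carries into the neighbourhood where the outer maps
  agree, both composites coincide. Hence the description determines the germ.\<close>

lemma mul_W: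
  assumes f: "f \<in> \<S>" "openin T (dom f)" "\<eta> \<in> dom f"
    and n: "n \<in> normalisers limit" "\<alpha> n \<xi> = Some \<eta>"
  shows "mul W (germ T \<S> f \<eta>) (germ T \<S> (\<alpha> n) \<xi>) = germ T \<S> (f \<circ>\<^sub>m \<alpha> n) \<xi>"
proof -
  have "mul W (germ T \<S> f \<eta>) (germ T \<S> (\<alpha> n) \<xi>) = (THE c. \<exists>f' y g x. (f', y) \<in> germ T \<S> f \<eta> \<and>
      (g, x) \<in> germ T \<S> (\<alpha> n) \<xi> \<and> c = germ T \<S> (f' \<circ>\<^sub>m g) x)"
    by (simp add: weyl_groupoid_def germ_groupoid_def)
  also have "\<dots> = germ T \<S> (f \<circ>\<^sub>m \<alpha> n) \<xi>"
  proof (rule the_equality)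
    have "(f, \<eta>) \<in> germ T \<S> f \<eta>" "(\<alpha> n, \<xi>) \<in> germ T \<S> (\<alpha> n) \<xi>"
      using f n openin_dom_\<alpha>[OF n(1)] by (auto intro!: germ_memI)
    then show "\<exists>f' y g x. (f', y) \<in> germ T \<S> f \<eta> \<and> (g, x) \<in> germ T \<S> (\<alpha> n) \<xi> \<and>
        germ T \<S> (f \<circ>\<^sub>m \<alpha> n) \<xi> = germ T \<S> (f' \<circ>\<^sub>m g) x" by blast
    fix c assume "\<exists>f' y g x. (f', y) \<in> germ T \<S> f \<eta> \<and> (g, x) \<in> germ T \<S> (\<alpha> n) \<xi> \<and> c = germ T \<S> (f' \<circ>\<^sub>m g) x"
    then obtain f' y g x where fg: "(f', y) \<in> germ T \<S> f \<eta>" "(g, x) \<in> germ T \<S> (\<alpha> n) \<xi>"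
      "c = germ T \<S> (f' \<circ>\<^sub>m g) x" by blast
    have x: "x = \<xi>" using germ_memD(1)[OF fg(2)] .
    obtain U where U: "openin T U" "\<eta> \<in> U" "U \<subseteq> dom f \<inter> dom f'" "\<And>\<zeta>. \<zeta> \<in> U \<Longrightarrow> f \<zeta> = f' \<zeta>"
      using germ_memD(3)[OF fg(1)] by blast
    obtain U' where U': "openin T U'" "\<xi> \<in> U'" "U' \<subseteq> dom (\<alpha> n) \<inter> dom g" "\<And>\<zeta>. \<zeta> \<in> U' \<Longrightarrow> \<alpha> n \<zeta> = g \<zeta>"
      using germ_memD(3)[OF fg(2)] by blast
    define P where "P = U' \<inter> {\<zeta> \<in> dom (\<alpha> n). the (\<alpha> n \<zeta>) \<in> U}"
    have P: "openin T P" unfolding P_def by (intro openin_Int U' openin_\<alpha>_preimage n U)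
    have \<xi>P: "\<xi> \<in> P" using U' U n by (auto simp: P_def)
    have val: "\<exists>\<zeta>'\<in>U. \<alpha> n \<zeta> = Some \<zeta>' \<and> g \<zeta> = Some \<zeta>'" if "\<zeta> \<in> P" for \<zeta>
    proof -
      have \<zeta>: "\<zeta> \<in> U'" "\<zeta> \<in> dom (\<alpha> n)" "the (\<alpha> n \<zeta>) \<in> U" using that by (simp_all add: P_def)
      then obtain \<zeta>' where "\<alpha> n \<zeta> = Some \<zeta>'" by blast
      then show ?thesis using \<zeta> U'(4)[of \<zeta>] by (intro bexI[of _ \<zeta>']) simp_all
    qed
    have dom: "P \<subseteq> dom (f' \<circ>\<^sub>m g) \<inter> dom (f \<circ>\<^sub>m \<alpha> n)"
    proof
      fix \<zeta> assume "\<zeta> \<in> P"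
      then obtain \<zeta>' where "\<zeta>' \<in> U" "\<alpha> n \<zeta> = Some \<zeta>'" "g \<zeta> = Some \<zeta>'" using val by blast
      then show "\<zeta> \<in> dom (f' \<circ>\<^sub>m g) \<inter> dom (f \<circ>\<^sub>m \<alpha> n)" using U(3) by (auto simp: map_comp_def)
    qed
    have same: "(f' \<circ>\<^sub>m g) \<zeta> = (f \<circ>\<^sub>m \<alpha> n) \<zeta>" if "\<zeta> \<in> P" for \<zeta>
    proof -
      obtain \<zeta>' where "\<zeta>' \<in> U" "\<alpha> n \<zeta> = Some \<zeta>'" "g \<zeta> = Some \<zeta>'" using val \<open>\<zeta> \<in> P\<close> by blast
      then show ?thesis using U(4)[of \<zeta>'] by (simp add: map_comp_def)
    qed
    show "c = germ T \<S> (f \<circ>\<^sub>m \<alpha> n) \<xi>" unfolding fg(3) x by (rule germ_cong[OF P \<xi>P dom same])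
  qed
  finally show ?thesis .
qed

lemma arrow_germ_src_rng:
  assumes "a \<in> topspace (arrows E)"
  shows "src W (arrow_germ a) = snd (src E a)" "rng W (arrow_germ a) = snd (rng E a)"
proof -
  obtain x z \<xi> n where xz: "a = ((x, z), \<xi>)" "tail_eq n x z" "\<xi> \<in> characters limit" "path_of \<xi> = z"
    using topspace_E_D[OF assms] by blast
  have n: "n \<ge> 1" "x \<in> inf_paths V" "z \<in> inf_paths V" using xz(2) by (auto simp: tail_eq_def)
  note sw = path_action_eq[OF xz(2-4)]
  have d: "\<xi> \<in> dom (swap n x z)" using sw by blast
  show "src W (arrow_germ a) = snd (src E a)" "rng W (arrow_germ a) = snd (rng E a)"
    unfolding xz(1) arrow_germ_eq[OF xz(2-4)] src_W[OF swap_in_\<S>[OF n] d openin_dom_swap[OF n]]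
      rng_W[OF swap_in_\<S>[OF n] openin_dom_swap[OF n] sw]
    by (simp_all add: transformation_groupoid_def)
qed

text \<open>Raised to a common level, composable arrows have swaps with the same middle prefix, so
  \<open>swap_comp\<close> applies.\<close>

lemma arrow_germ_mul:
  assumes a: "a \<in> topspace (arrows E)" and b: "b \<in> topspace (arrows E)" and ab: "src E a = rng E b"
  shows "arrow_germ (mul E a b) = mul W (arrow_germ a) (arrow_germ b)"
proof -
  obtain x z \<eta> n1 where xz: "a = ((x, z), \<eta>)" "tail_eq n1 x z" "\<eta> \<in> characters limit" "path_of \<eta> = z"
    using topspace_E_D[OF a] by blast
  obtain z' w \<xi> n2 where zw: "b = ((z', w), \<xi>)" "tail_eq n2 z' w" "\<xi> \<in> characters limit" "path_of \<xi> = w"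
    using topspace_E_D[OF b] by blast
  have eq: "z' = z" "\<eta> = path_action V \<Phi> (z, w) \<xi>"
    using ab by (simp_all add: xz(1) zw(1) transformation_groupoid_def path_groupoid_def)
  define n where "n = max n1 n2"
  have t: "tail_eq n x z" "tail_eq n z w" "tail_eq n x w"
    using xz(2) zw(2) eq(1) by (auto simp: tail_eq_def n_def)
  have n: "n \<ge> 1" "x \<in> inf_paths V" "z \<in> inf_paths V" "w \<in> inf_paths V" using t by (auto simp: tail_eq_def)
  have sw: "swap n z w \<xi> = Some \<eta>" using path_action_eq[OF t(2) zw(3,4)] eq(2) by simp
  have d: "\<eta> \<in> dom (swap n x z)" using path_action_eq[OF t(1) xz(3,4)] by blast
  have "arrow_germ a = germ T \<S> (swap n x z) \<eta>" unfolding xz(1) by (rule arrow_germ_eq[OF t(1) xz(3,4)])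
  moreover have "arrow_germ b = germ T \<S> (swap n z w) \<xi>"
    unfolding zw(1) eq(1) by (rule arrow_germ_eq[OF t(2) zw(3,4)])
  moreover have "mul W (germ T \<S> (swap n x z) \<eta>) (germ T \<S> (swap n z w) \<xi>) = germ T \<S> (swap n x w) \<xi>"
    using mul_W[OF swap_in_\<S>[OF n(1-3)] openin_dom_swap[OF n(1-3)] d swap_unit_normaliser[OF n(1,3,4)]
        sw[unfolded swap_def]]
    unfolding swap_def[of n z w, symmetric] swap_comp[OF n] .
  moreover have "arrow_germ (mul E a b) = germ T \<S> (swap n x w) \<xi>"
    using arrow_germ_eq[OF t(3) zw(3,4)] by (simp add: xz(1) zw(1) transformation_groupoid_def path_groupoid_def)
  ultimately show ?thesis by simp
qed

text \<open>The units of the transformation groupoid form the graph of the anchor, and the graph of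
  a continuous map is homeomorphic to its domain by projection.\<close>

lemma homeomorphic_units: "homeomorphic_map (units E) (units W) snd"
proof -
  have units: "units E = subtopology (prod_topology (path_space V) T) {(x, \<xi>). x = anchor V \<Phi> \<xi>}" "units W = T"
    by (simp_all add: transformation_groupoid_def path_groupoid_def weyl_groupoid_def germ_groupoid_def)
  have "homeomorphic_maps (units E) T snd (\<lambda>\<xi>. (anchor V \<Phi> \<xi>, \<xi>))"
    unfolding homeomorphic_maps_def
  proof (intro conjI ballI)
    show "continuous_map (units E) T snd"
      unfolding units by (intro continuous_map_from_subtopology continuous_map_snd)
    show "continuous_map T (units E) (\<lambda>\<xi>. (anchor V \<Phi> \<xi>, \<xi>))"
      unfolding units continuous_map_in_subtopology
      using continuous_anchor by (auto intro!: continuous_map_pairedI)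
  qed (auto simp: units)
  then show ?thesis unfolding units(2) by (auto simp: homeomorphic_map_maps)
qed

lemma groupoid_iso_E_W: "groupoid_iso E W arrow_germ snd"
  unfolding groupoid_iso_def
  using bijective_open_imp_homeomorphic_map[OF continuous_arrow_germ open_map_arrow_germ arrow_germ_surj arrow_germ_inj]
    homeomorphic_units arrow_germ_src_rng arrow_germ_mul by simp

end

theorem proposition5p1:
  fixes V :: "'x villadsen"
    and \<Phi> :: "nat \<Rightarrow> ((nat \<Rightarrow> 'x) \<Rightarrow> complex mat) \<Rightarrow> 'a::unital_cstar_algebra"
  assumes "villadsen_data V"
    and "is_inductive_limit V \<Phi>"
  shows "(\<exists>h. groupoid_iso
            (transformation_groupoid (path_groupoid V) (spectrum_top (canonical_diagonal V \<Phi>))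
               (anchor V \<Phi>) (path_action V \<Phi>))
            (weyl_groupoid (canonical_diagonal V \<Phi>)) h snd)
    \<and> continuous_map (spectrum_top (canonical_diagonal V \<Phi>)) (path_space V) (anchor V \<Phi>)
    \<and> (\<forall>x \<in> topspace (path_space V).
         fibre_top V \<Phi> x homeomorphic_space discrete_topology {()}
       \<or> (\<exists>n\<ge>1. fibre_top V \<Phi> x homeomorphic_space power_top (base_space V) n)
       \<or> fibre_top V \<Phi> x homeomorphic_space product_topology (\<lambda>_. base_space V) (UNIV :: nat set))"
proof -
  interpret villadsen_limit V \<Phi> using assms by unfold_locales
  show ?thesis
    unfolding canonical_diagonal_eq topspace_path_space
    using groupoid_iso_E_W continuous_anchor fibre_cases by blast
qed

end
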